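(* Let $r,s\geq 0$ be integers with $n=r+s\geq 2$. For any Lie subalgebra $\mathfrak{h}\subset\mathfrak{so}(r,s)$, the Lie algebra $\mathfrak{g}^{\mathfrak{h}}\subset\mathfrak{so}(r+2,s+2)$ (defined in the context) is the holonomy algebra of a pseudo-Riemannian manifold of signature $(r+2,s+2)$; that is, there exist a pseudo-Riemannian manifold $(M,g)$ of signature $(r+2,s+2)$, a point $x\in M$, and a linear isometry $(T_xM,g_x)\cong(\mathbb{R}^{r+2,s+2},\eta)$ under which the holonomy algebra of $(M,g)$ at $x$ is identified with $\mathfrak{g}^{\mathfrak{h}}$.
   Context: Signature convention: signature $(r,s)$ means $r$ minus signs and $s$ plus signs. Let $r+s=n\geq 2$. Let $\mathbb{R}^{r+2,s+2}$ be the pseudo-Euclidean space with metric $\eta$ of signature $(r+2,s+2)$, with a fixed basis $p_1,p_2,e_1,\dots,e_n,q_1,q_2$ for which the only non-zero values of $\eta$ on basis vectors are (up to symmetry) $$\eta(p_1,q_1)=\eta(p_2,q_2)=1,\qquad \eta(e_i,e_i)=\epsilon_i,\qquad \epsilon_1=\cdots=\epsilon_r=-1,\quad \epsilon_{r+1}=\cdots=\epsilon_n=1.$$ The span of $e_1,\dots,e_n$ is identified with $\mathbb{R}^{r,s}$; $\mathfrak{so}(r,s)$ is the Lie algebra of $\eta$-skew-symmetric endomorphisms of $\mathbb{R}^{r,s}$, written as matrices in the basis $e_1,\dots,e_n$; and $\mathfrak{so}(r+2,s+2)$ is the Lie algebra of $\eta$-skew-symmetric endomorphisms of $\mathbb{R}^{r+2,s+2}$.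 Put $E_{r,s}=\mathrm{diag}(\epsilon_1,\dots,\epsilon_n)$. For a Lie subalgebra $\mathfrak{h}\subset\mathfrak{so}(r,s)$, define, with matrices written with respect to the basis $p_1,p_2,e_1,\dots,e_n,q_1,q_2$, $$\mathfrak{g}^{\mathfrak{h}}=\left\{\left(\begin{array}{ccccc} 0&0&-(E_{r,s}X)^t&0&-c\\ 0&0&-(E_{r,s}Y)^t&c&0\\ 0&0&A&X&Y\\ 0&0&0&0&0\\ 0&0&0&0&0 \end{array}\right)\ :\ A\in\mathfrak{h},\ X,Y\in\mathbb{R}^{r,s},\ c\in\mathbb{R}\right\}.$$ This is a Lie subalgebra of $\mathfrak{so}(r+2,s+2)$. As a Lie algebra it decomposes as $\mathfrak{g}^{\mathfrak{h}}=\mathfrak{h}\ltimes(\mathbb{R}^2\otimes\mathbb{R}^{r,s}\ltimes\mathbb{R})$, where the summand to the right of $\ltimes$ is an ideal. The holonomy algebra of a pseudo-Riemannian manifold $(M,g)$ at a point $x\in M$ is the Lie algebra, contained in $\mathfrak{so}(T_xM,g_x)$, of the holonomy group at $x$ of the Levi-Civita connection of $g$. *)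

theory Defs
  imports "HOL-Analysis.Analysis"
begin

section \<open>Smooth maps\<close>

text \<open>For open \<open>S\<close>, \<open>Ck_on k S f\<close> says that \<open>f\<close> is \<open>k\<close> times differentiable on \<open>S\<close> with all
  iterated directional derivatives of order at most \<open>k\<close> continuous, i.e. that \<open>f\<close> is of class
  \<open>C\<^sup>k\<close> when the domain is finite-dimensional.\<close>

primrec Ck_on ::
    "nat \<Rightarrow> 'a::real_normed_vector set \<Rightarrow> ('a \<Rightarrow> 'b::real_normed_vector) \<Rightarrow> bool" where
  "Ck_on 0 S f \<longleftrightarrow> continuous_on S f"
| "Ck_on (Suc k) S f \<longleftrightarrow>
     (\<forall>x\<in>S. f differentiable (at x)) \<and> (\<forall>v. Ck_on k S (\<lambda>x. frechet_derivative f (at x) v))"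

definition smooth_on ::
    "'a::real_normed_vector set \<Rightarrow> ('a \<Rightarrow> 'b::real_normed_vector) \<Rightarrow> bool" where
  "smooth_on S f \<longleftrightarrow> open S \<and> (\<forall>k. Ck_on k S f)"


section \<open>Smooth manifolds and tangent spaces\<close>

text \<open>A chart is its domain together with its coordinate map; only the values of the map on the
  domain matter. The dimension of the manifold is \<open>CARD('m)\<close>. The manifold is the topological
  space \<open>X\<close>, so its points are the elements of \<open>topspace X\<close> and its topology is unrelated to any
  topology that the type \<open>'a\<close> may carry.\<close>

type_synonym ('a, 'm) chart = "'a set \<times> ('a \<Rightarrow> real ^ 'm)"

definition chart_inv :: "('a, 'm::finite) chart \<Rightarrow> real ^ 'm \<Rightarrow> 'a" where
  "chart_inv c = inv_into (fst c) (snd c)"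

definition transition :: "('a, 'm::finite) chart \<Rightarrow> ('a, 'm) chart \<Rightarrow> real ^ 'm \<Rightarrow> real ^ 'm" where
  "transition c d = snd d \<circ> chart_inv c"

definition is_chart :: "'a topology \<Rightarrow> ('a, 'm::finite) chart \<Rightarrow> bool" where
  "is_chart X c \<longleftrightarrow> openin X (fst c) \<and> open (snd c ` fst c) \<and>
     homeomorphic_map (subtopology X (fst c)) (top_of_set (snd c ` fst c)) (snd c)"

definition smooth_manifold :: "'a topology \<Rightarrow> ('a, 'm::finite) chart set \<Rightarrow> bool" where
  "smooth_manifold X \<A> \<longleftrightarrow>
     Hausdorff_space X \<and> second_countable X \<and>
     (\<forall>c\<in>\<A>. is_chart X c) \<and> (\<Union>c\<in>\<A>. fst c) = topspace X \<and>
     (\<forall>c\<in>\<A>. \<forall>d\<in>\<A>. smooth_on (snd c ` (fst c \<inter> fst d)) (transition c d))"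

text \<open>A tangent vector at \<open>x\<close> is the family of its coordinate vectors in all charts around \<open>x\<close>,
  related by the differentials of the transition maps; charts that do not contain \<open>x\<close> are
  assigned \<open>0\<close>. The vector space operations are pointwise, and for every chart \<open>c\<close> around \<open>x\<close> the
  map \<open>\<lambda>v. v c\<close> is a linear isomorphism from the tangent space onto \<open>real ^ 'm\<close> with
  inverse \<open>coord_vector \<A> c x\<close>.\<close>

type_synonym ('a, 'm) tvec = "('a, 'm) chart \<Rightarrow> real ^ 'm"

definition tangent_space :: "('a, 'm::finite) chart set \<Rightarrow> 'a \<Rightarrow> ('a, 'm) tvec set" where
  "tangent_space \<A> x = {v.
     (\<forall>c. \<not> (c \<in> \<A> \<and> x \<in> fst c) \<longrightarrow> v c = 0) \<and>
     (\<forall>c\<in>\<A>. \<forall>d\<in>\<A>. x \<in> fst c \<inter> fst d \<longrightarrow>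
        v d = frechet_derivative (transition c d) (at (snd c x)) (v c))}"

definition coord_vector ::
    "('a, 'm::finite) chart set \<Rightarrow> ('a, 'm) chart \<Rightarrow> 'a \<Rightarrow> real ^ 'm \<Rightarrow> ('a, 'm) tvec" where
  "coord_vector \<A> c x u = (\<lambda>d. if d \<in> \<A> \<and> x \<in> fst d
     then frechet_derivative (transition c d) (at (snd c x)) u else 0)"


section \<open>Pseudo-Riemannian metrics and the Levi-Civita connection\<close>

text \<open>Signature \<open>(p, q)\<close> means \<open>p\<close> minus signs and \<open>q\<close> plus signs.\<close>

definition has_signature ::
    "(real ^ 'm \<Rightarrow> real ^ 'm \<Rightarrow> real) \<Rightarrow> nat \<Rightarrow> nat \<Rightarrow> bool" where
  "has_signature b p q \<longleftrightarrow>
     (\<exists>B :: 'm::finite \<Rightarrow> real ^ 'm.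
        (\<forall>i j. i \<noteq> j \<longrightarrow> b (B i) (B j) = 0) \<and> (\<forall>i. b (B i) (B i) \<in> {-1, 1}) \<and>
        card {i. b (B i) (B i) = -1} = p \<and> card {i. b (B i) (B i) = 1} = q)"

type_synonym ('a, 'm) metric_tensor = "'a \<Rightarrow> ('a, 'm) tvec \<Rightarrow> ('a, 'm) tvec \<Rightarrow> real"

definition metric_coords ::
    "('a, 'm::finite) chart set \<Rightarrow> ('a, 'm) metric_tensor \<Rightarrow> ('a, 'm) chart \<Rightarrow>
     real ^ 'm \<Rightarrow> real ^ 'm \<Rightarrow> real ^ 'm \<Rightarrow> real" where
  "metric_coords \<A> g c y u v =
     g (chart_inv c y) (coord_vector \<A> c (chart_inv c y) u) (coord_vector \<A> c (chart_inv c y) v)"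

definition pseudo_riemannian_manifold ::
    "'a topology \<Rightarrow> ('a, 'm::finite) chart set \<Rightarrow> ('a, 'm) metric_tensor \<Rightarrow> nat \<Rightarrow> nat \<Rightarrow> bool" where
  "pseudo_riemannian_manifold X \<A> g p q \<longleftrightarrow>
     smooth_manifold X \<A> \<and>
     (\<forall>c\<in>\<A>.
        (\<forall>y\<in>snd c ` fst c.
           bilinear (metric_coords \<A> g c y) \<and>
           (\<forall>u v. metric_coords \<A> g c y u v = metric_coords \<A> g c y v u) \<and>
           has_signature (metric_coords \<A> g c y) p q) \<and>
        (\<forall>u v. smooth_on (snd c ` fst c) (\<lambda>y. metric_coords \<A> g c y u v)))"

text \<open>The Levi-Civita connection in the chart \<open>c\<close>: \<open>levi_civita \<A> g c y u v\<close> is the coordinate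
  vector at \<open>y\<close> of \<open>\<nabla>\<^sub>U V\<close>, where \<open>U\<close> and \<open>V\<close> are the vector fields with constant coordinates
  \<open>u\<close> and \<open>v\<close>. Since such fields commute, vanishing torsion is symmetry in \<open>u\<close> and \<open>v\<close>; the last
  condition is \<open>\<nabla>g = 0\<close>. For nondegenerate \<open>g\<close> there is exactly one such bilinear map, with the
  Christoffel symbols as its components.\<close>

definition levi_civita ::
    "('a, 'm::finite) chart set \<Rightarrow> ('a, 'm) metric_tensor \<Rightarrow> ('a, 'm) chart \<Rightarrow>
     real ^ 'm \<Rightarrow> real ^ 'm \<Rightarrow> real ^ 'm \<Rightarrow> real ^ 'm" where
  "levi_civita \<A> g c y = (THE \<Gamma>.
     bilinear \<Gamma> \<and> (\<forall>u v. \<Gamma> u v = \<Gamma> v u) \<and>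
     (\<forall>w u v. frechet_derivative (\<lambda>z. metric_coords \<A> g c z u v) (at y) w =
        metric_coords \<A> g c y (\<Gamma> w u) v + metric_coords \<A> g c y u (\<Gamma> w v)))"


section \<open>Parallel transport and holonomy\<close>

text \<open>A curve that is smooth on a neighbourhood of the closed interval from \<open>0\<close> to \<open>1\<close>.\<close>

definition smooth_segment ::
    "'a topology \<Rightarrow> ('a, 'm::finite) chart set \<Rightarrow> (real \<Rightarrow> 'a) \<Rightarrow> bool" where
  "smooth_segment X \<A> \<gamma> \<longleftrightarrow>
     (\<exists>J. open J \<and> {0..1} \<subseteq> J \<and> continuous_map (top_of_set J) X \<gamma> \<and>
        (\<forall>c\<in>\<A>. smooth_on {t \<in> J. \<gamma> t \<in> fst c} (snd c \<circ> \<gamma>)))"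

definition parallel_along ::
    "('a, 'm::finite) chart set \<Rightarrow> ('a, 'm) metric_tensor \<Rightarrow> (real \<Rightarrow> 'a) \<Rightarrow>
     (real \<Rightarrow> ('a, 'm) tvec) \<Rightarrow> bool" where
  "parallel_along \<A> g \<gamma> V \<longleftrightarrow>
     (\<forall>t\<in>{0..1}. V t \<in> tangent_space \<A> (\<gamma> t) \<and>
        (\<forall>c\<in>\<A>. \<gamma> t \<in> fst c \<longrightarrow>
           ((\<lambda>s. V s c) has_vector_derivative
              - levi_civita \<A> g c (snd c (\<gamma> t)) (vector_derivative (snd c \<circ> \<gamma>) (at t)) (V t c))
             (at t within {0..1})))"

text \<open>\<open>transports X \<A> g x y \<tau>\<close>: the map \<open>\<tau>\<close> from the tangent space at \<open>x\<close> to the one at \<open>y\<close>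
  is the parallel transport along some piecewise smooth curve from \<open>x\<close> to \<open>y\<close>, that is, along a
  finite concatenation of smooth segments. Linear maps on a tangent space are represented by
  functions that are \<open>undefined\<close> outside of it.\<close>

inductive transports ::
    "'a topology \<Rightarrow> ('a, 'm::finite) chart set \<Rightarrow> ('a, 'm) metric_tensor \<Rightarrow>
     'a \<Rightarrow> 'a \<Rightarrow> (('a, 'm) tvec \<Rightarrow> ('a, 'm) tvec) \<Rightarrow> bool"
  for X \<A> g x where
  refl: "x \<in> topspace X \<Longrightarrow> transports X \<A> g x x (restrict id (tangent_space \<A> x))"
| step: "\<lbrakk>transports X \<A> g x (\<gamma> 0) \<tau>; smooth_segment X \<A> \<gamma>;
         \<And>v. v \<in> tangent_space \<A> (\<gamma> 0) \<Longrightarrow>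
           \<exists>V. parallel_along \<A> g \<gamma> V \<and> V 0 = v \<and> V 1 = P v\<rbrakk>
        \<Longrightarrow> transports X \<A> g x (\<gamma> 1) (compose (tangent_space \<A> x) P \<tau>)"

definition holonomy_group ::
    "'a topology \<Rightarrow> ('a, 'm::finite) chart set \<Rightarrow> ('a, 'm) metric_tensor \<Rightarrow> 'a \<Rightarrow>
     (('a, 'm) tvec \<Rightarrow> ('a, 'm) tvec) set" where
  "holonomy_group X \<A> g x = {\<tau>. transports X \<A> g x x \<tau>}"

text \<open>The Lie algebra of the holonomy group as its tangent space at the identity: the velocities
  at \<open>0\<close> of the smooth curves \<open>C\<close> of linear maps with values in the group and \<open>C 0\<close> the identity.
  The holonomy group need not be closed in the general linear group, but it is an immersed Lie
  subgroup with at most countably many components, hence an initial submanifold: a smooth curve of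
  linear maps with values in the group is smooth as a curve in the group.\<close>

definition holonomy_algebra ::
    "'a topology \<Rightarrow> ('a, 'm::finite) chart set \<Rightarrow> ('a, 'm) metric_tensor \<Rightarrow> 'a \<Rightarrow>
     (('a, 'm) tvec \<Rightarrow> ('a, 'm) tvec) set" where
  "holonomy_algebra X \<A> g x = {B \<in> extensional (tangent_space \<A> x).
     \<exists>C :: real \<Rightarrow> ('a, 'm) tvec \<Rightarrow> ('a, 'm) tvec.
       (\<forall>t. C t \<in> holonomy_group X \<A> g x) \<and>
       C 0 = restrict id (tangent_space \<A> x) \<and>
       (\<forall>v\<in>tangent_space \<A> x. \<forall>c.
          smooth_on UNIV (\<lambda>t. C t v c) \<and>
          ((\<lambda>t. C t v c) has_vector_derivative B v c) (at 0))}"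

definition tangent_isometry ::
    "('a, 'm::finite) chart set \<Rightarrow> ('a, 'm) metric_tensor \<Rightarrow> 'a \<Rightarrow>
     (real ^ 'k \<Rightarrow> real ^ 'k \<Rightarrow> real) \<Rightarrow> (('a, 'm) tvec \<Rightarrow> real ^ 'k::finite) \<Rightarrow> bool" where
  "tangent_isometry \<A> g x b L \<longleftrightarrow>
     bij_betw L (tangent_space \<A> x) UNIV \<and>
     (\<forall>u\<in>tangent_space \<A> x. \<forall>v\<in>tangent_space \<A> x. \<forall>a a'.
        L (\<lambda>c. a *\<^sub>R u c + a' *\<^sub>R v c) = a *\<^sub>R L u + a' *\<^sub>R L v) \<and>
     (\<forall>u\<in>tangent_space \<A> x. \<forall>v\<in>tangent_space \<A> x. b (L u) (L v) = g x u v)"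

definition endo_matrix ::
    "'v set \<Rightarrow> ('v \<Rightarrow> real ^ 'k) \<Rightarrow> ('v \<Rightarrow> 'v) \<Rightarrow> real ^ 'k ^ 'k::finite" where
  "endo_matrix T L B = matrix (\<lambda>w. L (B (inv_into T L w)))"


section \<open>Pseudo-Euclidean spaces and the algebras \<open>\<gg>\<^sup>\<hh>\<close>\<close>

definition lie_subalgebra :: "(real ^ 'k ^ 'k::finite) set \<Rightarrow> (real ^ 'k ^ 'k) set \<Rightarrow> bool" where
  "lie_subalgebra \<hh> \<gg> \<longleftrightarrow> \<hh> \<subseteq> \<gg> \<and> subspace \<hh> \<and> (\<forall>A\<in>\<hh>. \<forall>B\<in>\<hh>. A ** B - B ** A \<in> \<hh>)"

definition so_form :: "(real ^ 'k \<Rightarrow> real ^ 'k \<Rightarrow> real) \<Rightarrow> (real ^ 'k ^ 'k::finite) set" where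
  "so_form b = {A. \<forall>u v. b (A *v u) v + b u (A *v v) = 0}"

text \<open>The basis \<open>e\<^sub>1, \<dots>, e\<^sub>n\<close> is indexed by a type \<open>'n\<close> with \<open>n\<close> elements, enumerated by a
  bijection \<open>e\<close> from \<open>{1..n}\<close>; the first \<open>r\<close> basis vectors get the sign \<open>-1\<close>.\<close>

definition signs :: "(nat \<Rightarrow> 'n) \<Rightarrow> nat \<Rightarrow> 'n \<Rightarrow> real" where
  "signs e r i = (if i \<in> e ` {1..r} then -1 else 1)"

definition eta0 :: "('n::finite \<Rightarrow> real) \<Rightarrow> real ^ 'n \<Rightarrow> real ^ 'n \<Rightarrow> real" where
  "eta0 \<epsilon> u v = (\<Sum>i\<in>UNIV. \<epsilon> i * u $ i * v $ i)"

text \<open>Indices of the basis \<open>p\<^sub>1, p\<^sub>2, e\<^sub>1, \<dots>, e\<^sub>n, q\<^sub>1, q\<^sub>2\<close>.\<close>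

datatype 'n idx = P1 | P2 | E 'n | Q1 | Q2

instance idx :: (finite) finite
proof
  have "(UNIV :: 'a idx set) = {P1, P2, Q1, Q2} \<union> range E"
    by (auto intro: idx.exhaust)
  then show "finite (UNIV :: 'a idx set)"
    by (metis finite finite_UnI finite_imageI finite.emptyI finite_insert)
qed

definition eta ::
    "('n::finite \<Rightarrow> real) \<Rightarrow> real ^ 'n idx \<Rightarrow> real ^ 'n idx \<Rightarrow> real" where
  "eta \<epsilon> u v =
     u $ P1 * v $ Q1 + u $ Q1 * v $ P1 + u $ P2 * v $ Q2 + u $ Q2 * v $ P2 +
     (\<Sum>i\<in>UNIV. \<epsilon> i * u $ E i * v $ E i)"

definition g_matrix ::
    "('n::finite \<Rightarrow> real) \<Rightarrow> real ^ 'n ^ 'n \<Rightarrow> real ^ 'n \<Rightarrow> real ^ 'n \<Rightarrow> real \<Rightarrow>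
     real ^ 'n idx ^ 'n idx" where
  "g_matrix \<epsilon> A X Y c = (\<chi> row col.
     case row of
       P1 \<Rightarrow> (case col of E j \<Rightarrow> - (\<epsilon> j * X $ j) | Q2 \<Rightarrow> - c | _ \<Rightarrow> 0)
     | P2 \<Rightarrow> (case col of E j \<Rightarrow> - (\<epsilon> j * Y $ j) | Q1 \<Rightarrow> c | _ \<Rightarrow> 0)
     | E i \<Rightarrow> (case col of E j \<Rightarrow> A $ i $ j | Q1 \<Rightarrow> X $ i | Q2 \<Rightarrow> Y $ i | _ \<Rightarrow> 0)
     | _ \<Rightarrow> 0)"

definition g_alg ::
    "('n::finite \<Rightarrow> real) \<Rightarrow> (real ^ 'n ^ 'n) set \<Rightarrow> (real ^ 'n idx ^ 'n idx) set" where
  "g_alg \<epsilon> \<hh> = {g_matrix \<epsilon> A X Y c | A X Y c. A \<in> \<hh>}"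

end

theory Submission
  imports Defs
begin

text \<open>
  On \<open>\<real>\<^sup>n\<^sup>+\<^sup>4\<close> with coordinates \<open>v\<^sub>1, v\<^sub>2, x, u\<^sub>1, u\<^sub>2\<close> consider
  \<open>2 dv\<^sub>1 du\<^sub>1 + 2 dv\<^sub>2 du\<^sub>2 + \<bar>dx + A(u\<^sub>1) x du\<^sub>2\<bar>\<^sup>2 - \<bar>x\<bar>\<^sup>2 (du\<^sub>1\<^sup>2 + du\<^sub>2\<^sup>2)\<close>, where \<open>A\<close> is a polynomial
  curve whose values span \<open>\<hh>\<close>. In the frame dual to \<open>dv\<^sub>a - \<bar>x\<bar>\<^sup>2 du\<^sub>a / 2\<close>, \<open>dx + A(u\<^sub>1) x du\<^sub>2\<close>, \<open>du\<^sub>a\<close>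
  the connection form takes values in \<open>\<gg>\<^sup>\<hh>\<close>, so every holonomy transformation is the endpoint of a
  piecewise smooth path tangent to \<open>\<gg>\<^sup>\<hh>\<close>, and a smooth curve through the identity consisting of such
  endpoints has its velocity in \<open>\<gg>\<^sup>\<hh>\<close>. Conversely, rectangles in the plane \<open>x = 0\<close> produce the
  one-parameter groups of the \<open>A(s)\<close>, loops that pass through \<open>x = \<xi>\<close> produce the \<open>X\<close> and \<open>Y\<close>
  components, and the component \<open>c\<close> arises from brackets of these.
\<close>

text \<open>The algebra \<open>\<hh>\<close> is arbitrary, and this creates two obstacles. A
  holonomy algebra is spanned by transported curvature operators, and in signature
  \<open>(r, s)\<close> the first Bianchi identity restricts which \<open>\<hh>\<close> can occur.
  The four extra dimensions remove the restriction: the curvature in the plane of the two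
  \<open>u\<close> coordinates has the \<open>\<hh>\<close> component \<open>A'\<close>, and its
  Bianchi defect is absorbed in equal halves by the \<open>X\<close> and \<open>Y\<close>
  components; these are the terms of \<open>conn\<close> with \<open>A'\<close> and a factor 1/2.
  The term quadratic in \<open>x\<close> produces all \<open>X\<close> and \<open>Y\<close>
  independently of \<open>\<hh>\<close>. The subgroup generated by \<open>g_alg\<close> need not be
  closed, so its Lie algebra cannot be read off from limits of group elements. Membership is
  therefore expressed by paths tangent to the algebra, and smooth curves of end points are
  controlled by countability. Neither inclusion computes the curvature: velocities of curves of
  loops form a subspace that is stable under brackets with generators of one-parameter groups of
  loops, so a few explicit rectangles suffice.\<close>

section \<open>The matrix exponential\<close>

text \<open>\<open>real ^ 'k ^ 'k\<close> carries componentwise multiplication, and the library defines \<open>exp\<close> only on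
  normed algebras with unit.\<close>

typedef (overloaded) 'a endo = "UNIV :: ('a::euclidean_space \<Rightarrow>\<^sub>L 'a) set"
  by simp

setup_lifting type_definition_endo

instantiation endo :: (euclidean_space) real_normed_algebra_1
begin

lift_definition zero_endo :: "'a endo" is 0 .
lift_definition one_endo :: "'a endo" is id_blinfun .
lift_definition plus_endo :: "'a endo \<Rightarrow> 'a endo \<Rightarrow> 'a endo" is "(+)" .
lift_definition minus_endo :: "'a endo \<Rightarrow> 'a endo \<Rightarrow> 'a endo" is "(-)" .
lift_definition uminus_endo :: "'a endo \<Rightarrow> 'a endo" is uminus .
lift_definition times_endo :: "'a endo \<Rightarrow> 'a endo \<Rightarrow> 'a endo" is "(o\<^sub>L)" .
lift_definition scaleR_endo :: "real \<Rightarrow> 'a endo \<Rightarrow> 'a endo" is scaleR .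
lift_definition norm_endo :: "'a endo \<Rightarrow> real" is norm .
lift_definition dist_endo :: "'a endo \<Rightarrow> 'a endo \<Rightarrow> real" is dist .
definition sgn_endo :: "'a endo \<Rightarrow> 'a endo" where "sgn_endo x = inverse (norm x) *\<^sub>R x"
definition uniformity_endo :: "('a endo \<times> 'a endo) filter" where
  "uniformity_endo = (INF e\<in>{0 <..}. principal {(x, y). dist x y < e})"
definition open_endo :: "'a endo set \<Rightarrow> bool" where
  "open_endo S = (\<forall>x\<in>S. \<forall>\<^sub>F (x', y) in uniformity. x' = x \<longrightarrow> y \<in> S)"

instance
proof
  fix a b c :: "'a endo" and r s :: real
  show "a * b * c = a * (b * c)" by transfer (rule blinfun_eqI, simp)
  show "1 * a = a" by transfer (rule blinfun_eqI, simp)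
  show "a * 1 = a" by transfer (rule blinfun_eqI, simp)
  show "(a + b) * c = a * c + b * c"
    by transfer (rule blinfun_eqI, simp add: blinfun.bilinear_simps)
  show "a * (b + c) = a * b + a * c"
    by transfer (rule blinfun_eqI, simp add: blinfun.bilinear_simps)
  show "r *\<^sub>R a * b = r *\<^sub>R (a * b)"
    by transfer (rule blinfun_eqI, simp add: blinfun.bilinear_simps)
  show "a * r *\<^sub>R b = r *\<^sub>R (a * b)"
    by transfer (rule blinfun_eqI, simp add: blinfun.bilinear_simps)
  show "a + b + c = a + (b + c)" by transfer (simp add: add.assoc)
  show "a + b = b + a" by transfer (simp add: add.commute)
  show "0 + a = a" by transfer simp
  show "- a + a = 0" by transfer simp
  show "a - b = a + - b" by transfer simp
  show "r *\<^sub>R (a + b) = r *\<^sub>R a + r *\<^sub>R b" by transfer (simp add: scaleR_add_right)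
  show "(r + s) *\<^sub>R a = r *\<^sub>R a + s *\<^sub>R a" by transfer (simp add: scaleR_add_left)
  show "r *\<^sub>R s *\<^sub>R a = (r * s) *\<^sub>R a" by transfer simp
  show "1 *\<^sub>R a = a" by transfer simp
  show "dist a b = norm (a - b)" by transfer (simp add: dist_norm)
  show "norm a = 0 \<longleftrightarrow> a = 0" by transfer simp
  show "norm (a + b) \<le> norm a + norm b" by transfer (rule norm_triangle_ineq)
  show "norm (r *\<^sub>R a) = \<bar>r\<bar> * norm a" by transfer simp
  show "norm (a * b) \<le> norm a * norm b" by transfer (rule norm_blinfun_compose)
  show "norm (1 :: 'a endo) = 1" by transfer (rule norm_blinfun_id)
  show "sgn a = inverse (norm a) *\<^sub>R a" by (simp add: sgn_endo_def)
  show "(0 :: 'a endo) \<noteq> 1"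
  proof transfer
    obtain i :: 'a where "i \<in> Basis" using nonempty_Basis by blast
    then have "blinfun_apply id_blinfun i \<noteq> blinfun_apply 0 i" by auto
    then show "(0 :: 'a \<Rightarrow>\<^sub>L 'a) \<noteq> id_blinfun" by metis
  qed
next
  show "(uniformity :: ('a endo \<times> 'a endo) filter) = (INF e\<in>{0 <..}. principal {(x, y). dist x y < e})"
    by (rule uniformity_endo_def)
  show "open S = (\<forall>x\<in>S. \<forall>\<^sub>F (x', y) in uniformity. x' = x \<longrightarrow> y \<in> S)" for S :: "'a endo set"
    by (rule open_endo_def)
qed

end

instance endo :: (euclidean_space) banach
proof
  fix X :: "nat \<Rightarrow> 'a endo"
  have d: "dist x y = dist (Rep_endo x) (Rep_endo y)" for x y :: "'a endo"
    by transfer simp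
  assume "Cauchy X"
  then have "Cauchy (\<lambda>n. Rep_endo (X n))"
    by (simp add: Cauchy_def d)
  then obtain L where "(\<lambda>n. Rep_endo (X n)) \<longlonglongrightarrow> L"
    using Cauchy_convergent convergent_def by blast
  then have "X \<longlonglongrightarrow> Abs_endo L"
    by (simp add: tendsto_dist_iff [of X] tendsto_dist_iff [of "\<lambda>n. Rep_endo (X n)"] d Abs_endo_inverse)
  then show "convergent X" by (auto simp: convergent_def)
qed

definition endo_of_matrix :: "real ^ 'k ^ 'k \<Rightarrow> (real ^ 'k::finite) endo" where
  "endo_of_matrix b = Abs_endo (Blinfun ((*v) b))"

definition matrix_of_endo :: "(real ^ 'k::finite) endo \<Rightarrow> real ^ 'k ^ 'k" where
  "matrix_of_endo f = matrix (blinfun_apply (Rep_endo f))"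

lemma matrix_of_endo_of_matrix [simp]: "matrix_of_endo (endo_of_matrix b) = b"
  by (simp add: matrix_of_endo_def endo_of_matrix_def Abs_endo_inverse
      bounded_linear_Blinfun_apply matrix_vector_mul_bounded_linear)

lemma matrix_of_endo_mult: "matrix_of_endo (f * g) = matrix_of_endo f ** matrix_of_endo g"
proof -
  have "blinfun_apply (Rep_endo (f * g)) = blinfun_apply (Rep_endo f) \<circ> blinfun_apply (Rep_endo g)"
    by transfer auto
  then show ?thesis
    unfolding matrix_of_endo_def
    by (simp add: matrix_compose blinfun.bounded_linear_right bounded_linear.linear)
qed

lemma bounded_linear_matrix_of_endo: "bounded_linear matrix_of_endo"
proof
  fix f g :: "(real ^ 'k) endo" and r
  show "matrix_of_endo (f + g) = matrix_of_endo f + matrix_of_endo g"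
    unfolding matrix_of_endo_def by transfer (simp add: matrix_def vec_eq_iff blinfun.bilinear_simps)
  show "matrix_of_endo (r *\<^sub>R f) = r *\<^sub>R matrix_of_endo f"
    unfolding matrix_of_endo_def by transfer (simp add: matrix_def vec_eq_iff blinfun.bilinear_simps)
next
  \<comment> \<open>Each entry is bounded by the operator norm, so the number of entries serves as
    the constant.\<close>
  have "norm (matrix_of_endo f) \<le> norm f * (\<Sum>i\<in>(UNIV::'k set). \<Sum>j\<in>(UNIV::'k set). 1)"
    for f :: "(real ^ 'k) endo"
  proof -
    have e: "\<bar>matrix_of_endo f $ i $ j\<bar> \<le> norm f" for i j
    proof -
      have "\<bar>matrix_of_endo f $ i $ j\<bar> = \<bar>blinfun_apply (Rep_endo f) (axis j 1) $ i\<bar>"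
        by (simp add: matrix_of_endo_def matrix_def)
      also have "\<dots> \<le> norm (blinfun_apply (Rep_endo f) (axis j 1))" by (rule component_le_norm_cart)
      also have "\<dots> \<le> norm (Rep_endo f) * norm (axis j 1 :: real ^ 'k)" by (rule norm_blinfun)
      finally show ?thesis by (simp add: norm_endo.rep_eq)
    qed
    have "norm (matrix_of_endo f) \<le> (\<Sum>i\<in>UNIV. norm (matrix_of_endo f $ i))"
      unfolding norm_vec_def[of "matrix_of_endo f"] by (rule L2_set_le_sum) auto
    also have "\<dots> \<le> (\<Sum>i\<in>UNIV. \<Sum>j\<in>UNIV. \<bar>matrix_of_endo f $ i $ j\<bar>)"
      by (intro sum_mono norm_le_l1_cart)
    also have "\<dots> \<le> (\<Sum>i\<in>(UNIV::'k set). \<Sum>j\<in>(UNIV::'k set). norm f)"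
      by (intro sum_mono e)
    finally show ?thesis by (simp add: algebra_simps)
  qed
  then show "\<exists>K. \<forall>f::(real ^ 'k) endo. norm (matrix_of_endo f) \<le> norm f * K" by blast
qed

definition mexp :: "real ^ 'k ^ 'k \<Rightarrow> real ^ 'k ^ 'k::finite" where
  "mexp b = matrix_of_endo (exp (endo_of_matrix b))"

lemma matrix_of_endo_1 [simp]: "matrix_of_endo 1 = mat 1"
  unfolding matrix_of_endo_def by transfer (simp add: matrix_def mat_def axis_def vec_eq_iff)

lemma endo_of_matrix_scaleR: "endo_of_matrix (r *\<^sub>R b) = r *\<^sub>R endo_of_matrix b"
proof -
  have "(*v) (r *\<^sub>R b) = (\<lambda>v. r *\<^sub>R (b *v v))"
    by (simp add: fun_eq_iff scaleR_matrix_vector_assoc)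
  then have "Blinfun ((*v) (r *\<^sub>R b)) = r *\<^sub>R Blinfun ((*v) b)"
    by (intro blinfun_eqI) (simp add: bounded_linear_Blinfun_apply matrix_vector_mul_bounded_linear
        blinfun.bilinear_simps bounded_linear_scaleR_right bounded_linear_compose[OF bounded_linear_scaleR_right])
  then show ?thesis
    by (simp add: endo_of_matrix_def scaleR_endo_def Abs_endo_inverse map_fun_def)
qed

lemma mexp_0 [simp]: "mexp (0 :: real ^ 'k ^ 'k::finite) = mat 1"
  proof -
  have "endo_of_matrix (0 :: real ^ 'k ^ 'k) = 0"
    using endo_of_matrix_scaleR[of 0 "0 :: real ^ 'k ^ 'k"] by simp
  then show ?thesis by (simp add: mexp_def)
qed

lemma mexp_scaleR_has_vector_derivative:
  "((\<lambda>t. mexp (t *\<^sub>R b)) has_vector_derivative b ** mexp (t *\<^sub>R b)) (at t within T)"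
  using bounded_linear.has_vector_derivative[OF bounded_linear_matrix_of_endo
      has_vector_derivative_at_within[OF exp_scaleR_has_vector_derivative_left[of "endo_of_matrix b" t]]]
  by (simp add: mexp_def endo_of_matrix_scaleR matrix_of_endo_mult)

lemma mexp_scaleR_has_vector_derivative':
  "((\<lambda>t. mexp (t *\<^sub>R b)) has_vector_derivative mexp (t *\<^sub>R b) ** b) (at t within T)"
  using bounded_linear.has_vector_derivative[OF bounded_linear_matrix_of_endo
      exp_scaleR_has_vector_derivative_right[of "endo_of_matrix b" t T]]
  by (simp add: mexp_def endo_of_matrix_scaleR matrix_of_endo_mult)

section \<open>Curves in the subgroup generated by a matrix Lie algebra\<close>

lemma bounded_bilinear_matrix_mult:
  "bounded_bilinear ((**) :: real ^ 'n ^ 'm \<Rightarrow> real ^ 'p ^ 'n \<Rightarrow> real ^ 'p ^ 'm)"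
  by (subst bilinear_conv_bounded_bilinear[symmetric])
    (auto simp: bilinear_def matrix_matrix_mult_def vec_eq_iff sum.distrib algebra_simps sum_distrib_left
      intro!: linearI)

lemma bounded_bilinear_matrix_vector_mult:
  "bounded_bilinear ((*v) :: real ^ 'n ^ 'm \<Rightarrow> real ^ 'n \<Rightarrow> real ^ 'm)"
  by (subst bilinear_conv_bounded_bilinear[symmetric])
    (auto simp: bilinear_def matrix_vector_right_distrib matrix_vector_mult_add_rdistrib
      scaleR_matrix_vector_assoc matrix_vector_mult_scaleR intro!: linearI)

interpretation mm: bounded_bilinear "(**) :: real ^ 'n ^ 'm \<Rightarrow> real ^ 'p ^ 'n \<Rightarrow> real ^ 'p ^ 'm"
  by (rule bounded_bilinear_matrix_mult)

interpretation mv: bounded_bilinear "(*v) :: real ^ 'n ^ 'm \<Rightarrow> real ^ 'n \<Rightarrow> real ^ 'm"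
  by (rule bounded_bilinear_matrix_vector_mult)

text \<open>The weight \<open>exp (- (2 * K) * s)\<close> turns the differential inequality into
  monotonicity: the weighted square of the norm does not increase, starts at 0 and is nonnegative.
  With \<open>K = 0\<close> this also serves to show that a function with zero derivative is
  constant.\<close>

lemma gronwall_zero:
  fixes f :: "real \<Rightarrow> 'a::real_inner"
  assumes der: "\<And>s. s \<in> {0..1} \<Longrightarrow> (f has_vector_derivative f' s) (at s within {0..1})"
    and le: "\<And>s. s \<in> {0..1} \<Longrightarrow> norm (f' s) \<le> K * norm (f s)"
    and "f 0 = 0" and t: "t \<in> {0..1}"
  shows "f t = 0"
proof -
  define h where "h s = exp (- (2 * K) * s) * (f s \<bullet> f s)" for s
  have hd: "(h has_vector_derivative
      (exp (- (2 * K) * s) * (f s \<bullet> f' s + f' s \<bullet> f s) + - (2 * K) * exp (- (2 * K) * s) * (f s \<bullet> f s)))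
      (at s within {0..1})" if s: "s \<in> {0..1}" for s
    unfolding h_def[abs_def]
  proof (rule has_vector_derivative_mult)
    show "((\<lambda>s. exp (- (2 * K) * s)) has_vector_derivative - (2 * K) * exp (- (2 * K) * s)) (at s within {0..1})"
      unfolding has_real_derivative_iff_has_vector_derivative[symmetric]
      by (auto intro!: derivative_eq_intros)
    show "((\<lambda>s. f s \<bullet> f s) has_vector_derivative (f s \<bullet> f' s + f' s \<bullet> f s)) (at s within {0..1})"
      by (rule bounded_bilinear.has_vector_derivative[OF bounded_bilinear_inner der[OF s] der[OF s]])
  qed
  have "h t \<le> h 0"
  proof (rule DERIV_nonpos_imp_decreasing_open[of 0 t h])
    show "0 \<le> t" using t by simp
    show "continuous_on {0..t} h"
      using hd t by (meson atLeastAtMost_iff continuous_on_eq_continuous_within continuous_on_subset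
          has_vector_derivative_continuous order_trans subsetI)
    fix s assume s: "0 < s" "s < t"
    have "at s within {0..1} = at s"
      using s t by (intro at_within_interior) auto
    then have "DERIV h s :> exp (- (2 * K) * s) * (f s \<bullet> f' s + f' s \<bullet> f s) + - (2 * K) * exp (- (2 * K) * s) * (f s \<bullet> f s)"
      using hd[of s] s t by (simp add: has_real_derivative_iff_has_vector_derivative)
    moreover have "exp (- (2 * K) * s) * (f s \<bullet> f' s + f' s \<bullet> f s) + - (2 * K) * exp (- (2 * K) * s) * (f s \<bullet> f s)
      = 2 * exp (- (2 * K) * s) * (f s \<bullet> f' s - K * (f s \<bullet> f s))"
      by (simp add: inner_commute algebra_simps)
    moreover have "f s \<bullet> f' s \<le> K * (f s \<bullet> f s)"
    proof -
      have "f s \<bullet> f' s \<le> norm (f s) * norm (f' s)" by (rule norm_cauchy_schwarz)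
      also have "\<dots> \<le> norm (f s) * (K * norm (f s))"
        using le[of s] s t by (intro mult_left_mono) auto
      finally show ?thesis by (simp add: dot_square_norm power2_eq_square algebra_simps)
    qed
    ultimately show "\<exists>y. DERIV h s :> y \<and> y \<le> 0"
      by (metis diff_le_0_iff_le exp_ge_zero mult_nonneg_nonpos mult_nonneg_nonneg zero_le_numeral)
  qed
  then have "exp (- (2 * K) * t) * (f t \<bullet> f t) \<le> 0" using \<open>f 0 = 0\<close> by (simp add: h_def)
  then show ?thesis by (smt (verit) exp_gt_zero inner_ge_zero mult_pos_pos inner_gt_zero_iff)
qed

text \<open>The inverse curve \<open>Zi\<close> is carried along with its own equation, so that
  matrix inversion never has to be differentiated.\<close>

definition flow :: "(real \<Rightarrow> real ^ 'k ^ 'k) \<Rightarrow> (real \<Rightarrow> real ^ 'k ^ 'k) \<Rightarrow> (real \<Rightarrow> real ^ 'k ^ 'k::finite) \<Rightarrow> bool"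
  where "flow a Z Zi \<longleftrightarrow> Z 0 = mat 1 \<and> Zi 0 = mat 1 \<and>
    (\<forall>s\<in>{0..1}. (Z has_vector_derivative a s ** Z s) (at s within {0..1}) \<and>
       (Zi has_vector_derivative - (Zi s ** a s)) (at s within {0..1}))"

lemma flow_inverse:
  assumes "flow a Z Zi" "s \<in> {0..1}"
  shows "Zi s ** Z s = mat 1" "Z s ** Zi s = mat 1"
proof -
  have "Zi s ** Z s - mat 1 = 0"
  proof (rule gronwall_zero[where K = 0 and f = "\<lambda>s. Zi s ** Z s - mat 1" and f' = "\<lambda>_. 0"])
    fix s :: real assume s: "s \<in> {0..1}"
    have "((\<lambda>s. Zi s ** Z s) has_vector_derivative (Zi s ** (a s ** Z s) + (- (Zi s ** a s)) ** Z s)) (at s within {0..1})"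
      using assms s by (intro mm.has_vector_derivative) (auto simp: flow_def)
    then show "((\<lambda>s. Zi s ** Z s - mat 1) has_vector_derivative 0) (at s within {0..1})"
      by (simp add: has_vector_derivative_diff_const matrix_mul_assoc mm.minus_left)
  qed (use assms in \<open>auto simp: flow_def\<close>)
  then show "Zi s ** Z s = mat 1" by simp
  then show "Z s ** Zi s = mat 1" by (simp add: matrix_left_right_inverse)
qed

section \<open>Projection along a matrix Lie algebra and conjugations that preserve it\<close>

locale matrix_lie_algebra =
  fixes g :: "(real ^ 'k ^ 'k::finite) set"
  assumes lie: "lie_subalgebra g UNIV"
begin

lemma sub: "subspace g" and bracket: "\<And>a b. a \<in> g \<Longrightarrow> b \<in> g \<Longrightarrow> a ** b - b ** a \<in> g"
  using lie by (auto simp: lie_subalgebra_def)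

text \<open>A list and not a set, because \<open>exp_product\<close> multiplies one-parameter groups
  in a fixed order.\<close>

definition onb :: "(real ^ 'k ^ 'k) list" where
  "onb = (SOME bs. distinct bs \<and> set bs \<subseteq> g \<and> span (set bs) = g \<and>
     pairwise orthogonal (set bs) \<and> (\<forall>b\<in>set bs. norm b = 1))"

lemma onb: "distinct onb" "set onb \<subseteq> g" "span (set onb) = g" "pairwise orthogonal (set onb)"
  "b \<in> set onb \<Longrightarrow> norm b = 1"
proof -
  obtain B where B: "B \<subseteq> g" "pairwise orthogonal B" "\<And>x. x \<in> B \<Longrightarrow> norm x = 1"
    "independent B" "card B = dim g" "span B = g"
    using orthonormal_basis_subspace[OF sub] by metis
  then obtain bs where "set bs = B" "distinct bs"
    using finite_distinct_list independent_imp_finite by metis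
  then have "\<exists>bs. distinct bs \<and> set bs \<subseteq> g \<and> span (set bs) = g \<and>
     pairwise orthogonal (set bs) \<and> (\<forall>b\<in>set bs. norm b = 1)"
    using B by blast
  from someI_ex[OF this]
  show "distinct onb" "set onb \<subseteq> g" "span (set onb) = g" "pairwise orthogonal (set onb)"
    "b \<in> set onb \<Longrightarrow> norm b = 1" unfolding onb_def by blast+
qed

text \<open>The orthogonal projection onto the complement of \<open>g\<close>, so that its vanishing
  tests membership in \<open>g\<close>. The list sum matches the derivative at 0 in
  \<open>exp_product\<close>.\<close>

definition pr :: "real ^ 'k ^ 'k \<Rightarrow> real ^ 'k ^ 'k" where
  "pr y = y - (\<Sum>b\<leftarrow>onb. (y \<bullet> b) *\<^sub>R b)"

lemma pr_sum: "pr y = y - (\<Sum>b\<in>set onb. (y \<bullet> b) *\<^sub>R b)"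
  by (simp add: pr_def sum_list_distinct_conv_sum_set onb(1))

lemma linear_pr: "linear pr"
  unfolding pr_sum
  by (intro linearI) (auto simp: inner_add_left scaleR_add_left sum.distrib scaleR_sum_right scaleR_diff_right)

lemma bounded_linear_pr: "bounded_linear pr"
  using linear_pr linear_conv_bounded_linear by blast

lemma pr_orthogonal: assumes "c \<in> g" shows "pr y \<bullet> c = 0"
proof -
  have "orthogonal (pr y) c"
  proof (rule orthogonal_to_span[of c "set onb"])
    show "c \<in> span (set onb)" using assms onb(3) by simp
    fix b assume b: "b \<in> set onb"
    have "(\<Sum>b'\<in>set onb. (y \<bullet> b') *\<^sub>R b') \<bullet> b = (\<Sum>b'\<in>set onb. if b' = b then y \<bullet> b else 0)"
      unfolding inner_sum_left
    proof (rule sum.cong)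
      fix b' assume b': "b' \<in> set onb"
      show "(y \<bullet> b') *\<^sub>R b' \<bullet> b = (if b' = b then y \<bullet> b else 0)"
      proof (cases "b' = b")
        case True
        then show ?thesis using onb(5)[OF b] by (simp add: norm_eq_1)
      next
        case False
        then show ?thesis using onb(4) b b' by (auto simp: pairwise_def orthogonal_def)
      qed
    qed simp
    then show "orthogonal (pr y) b"
      using b by (simp add: orthogonal_def pr_sum inner_diff_left)
  qed
  then show ?thesis by (simp add: orthogonal_def)
qed

lemma pr_complement: "y - pr y \<in> g"
  unfolding pr_sum using onb(2) by (auto intro!: subspace_sum[OF sub] subspace_scale[OF sub])

lemma pr_eq_0_iff: "pr y = 0 \<longleftrightarrow> y \<in> g"
proof
  assume "pr y = 0"
  then show "y \<in> g" using pr_complement[of y] by simp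
next
  assume "y \<in> g"
  then have "pr y \<in> g" using pr_complement[of y] subspace_diff[OF sub, of y "y - pr y"] by simp
  then have "pr y \<bullet> pr y = 0" by (rule pr_orthogonal)
  then show "pr y = 0" by simp
qed

text \<open>\<open>Z\<close> normalizes \<open>g\<close>. This is all that is recorded about a
  single group element; membership in the subgroup itself is expressed by paths.\<close>

definition ad_stable :: "real ^ 'k ^ 'k \<Rightarrow> real ^ 'k ^ 'k \<Rightarrow> bool" where
  "ad_stable Z Zi \<longleftrightarrow> Z ** Zi = mat 1 \<and> Zi ** Z = mat 1 \<and> (\<forall>b\<in>g. Z ** b ** Zi \<in> g \<and> Zi ** b ** Z \<in> g)"

text \<open>Conjugation by \<open>Z\<close> is injective and maps \<open>g\<close> into itself,
  hence onto itself by dimension; so the inverse conjugation preserves \<open>g\<close> as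
  well.\<close>

lemma ad_stableI:
  assumes inv: "Z ** Zi = mat 1" "Zi ** Z = mat 1" and ad: "\<And>b. b \<in> g \<Longrightarrow> Z ** b ** Zi \<in> g"
  shows "ad_stable Z Zi"
proof -
  define f where "f b = Z ** b ** Zi" for b
  have lin: "linear f"
    unfolding f_def by (intro linearI) (simp_all add: mm.add_left mm.add_right mm.scaleR_left mm.scaleR_right)
  have inj: "inj f"
  proof (rule injI)
    fix x y assume "f x = f y"
    then have "Zi ** (Z ** x ** Zi) ** Z = Zi ** (Z ** y ** Zi) ** Z" by (simp add: f_def)
    moreover have "Zi ** (Z ** x ** Zi) ** Z = (Zi ** Z) ** x ** (Zi ** Z)" for x by (simp add: matrix_mul_assoc)
    ultimately show "x = y" by (simp add: inv)
  qed
  have "f ` g = g"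
  proof (rule subspace_dim_equal)
    show "subspace (f ` g)" "subspace g" using sub lin linear_subspace_image by auto
    show "f ` g \<subseteq> g" using ad by (auto simp: f_def)
    show "dim (f ` g) \<ge> dim g" using inj by (simp add: dim_image_eq[OF lin] inj_on_subset)
  qed
  have "Zi ** b ** Z \<in> g" if b: "b \<in> g" for b
  proof -
    obtain b' where b': "b' \<in> g" "b = Z ** b' ** Zi" using b \<open>f ` g = g\<close> by (auto simp: f_def)
    have "Zi ** b ** Z = (Zi ** Z) ** b' ** (Zi ** Z)" by (simp add: b' matrix_mul_assoc)
    then show ?thesis using b' by (simp add: inv)
  qed
  then show ?thesis using assms by (auto simp: ad_stable_def)
qed

lemma ad_stable_mult: "ad_stable Z Zi \<Longrightarrow> ad_stable Y Yi \<Longrightarrow> ad_stable (Y ** Z) (Zi ** Yi)"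
proof -
  assume Z: "ad_stable Z Zi" and Y: "ad_stable Y Yi"
  have "Y ** Z ** (Zi ** Yi) = Y ** (Z ** Zi) ** Yi" "Zi ** Yi ** (Y ** Z) = Zi ** (Yi ** Y) ** Z"
    "\<And>b. Y ** Z ** b ** (Zi ** Yi) = Y ** (Z ** b ** Zi) ** Yi"
    by (simp_all add: matrix_mul_assoc)
  then show ?thesis using Z Y by (intro ad_stableI) (auto simp: ad_stable_def)
qed

text \<open>The conjugate \<open>Y\<close> of \<open>b\<close> satisfies
  \<open>Y' = a ** Y - Y ** a\<close>. Commutators with \<open>a s\<close> preserve
  \<open>g\<close>, so the derivative of \<open>pr (Y s)\<close> depends only on the part of
  \<open>Y s\<close> outside \<open>g\<close> and is bounded by a multiple of
  \<open>pr (Y s)\<close>. The Gronwall estimate then keeps this part at 0.\<close>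

lemma ad_stable_flow:
  assumes fl: "flow a Z Zi" and a: "\<And>s. s \<in> {0..1} \<Longrightarrow> a s \<in> g" and bd: "bounded (a ` {0..1})"
    and s: "s \<in> {0..1}"
  shows "ad_stable (Z s) (Zi s)"
proof (rule ad_stableI)
  fix b assume b: "b \<in> g"
  obtain Ka where Ka: "\<And>s. s \<in> {0..1} \<Longrightarrow> norm (a s) \<le> Ka" using bd unfolding bounded_iff by blast
  obtain K where K: "K > 0" "\<And>(x :: real ^ 'k ^ 'k) (y :: real ^ 'k ^ 'k). norm (x ** y) \<le> norm x * norm y * K"
    using mm.pos_bounded by blast
  obtain Kp where Kp: "Kp > 0" "\<And>x. norm (pr x) \<le> norm x * Kp"
    using bounded_linear.pos_bounded[OF bounded_linear_pr] by blast
  define Y where "Y s = Z s ** b ** Zi s" for s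
  have Yd: "(Y has_vector_derivative (a s ** Y s - Y s ** a s)) (at s within {0..1})" if "s \<in> {0..1}" for s
  proof -
    have "(Y has_vector_derivative (Z s ** b) ** (- (Zi s ** a s)) + ((Z s ** 0 + (a s ** Z s) ** b) ** Zi s)) (at s within {0..1})"
      unfolding Y_def using fl that
      by (intro mm.has_vector_derivative has_vector_derivative_const) (auto simp: flow_def)
    then show ?thesis by (simp add: Y_def matrix_mul_assoc mm.minus_right)
  qed
  have "pr (Y s) = 0"
  proof (rule gronwall_zero[where f = "\<lambda>s. pr (Y s)" and f' = "\<lambda>s. pr (a s ** Y s - Y s ** a s)" and K = "2 * K * Ka * Kp"])
    fix s :: real assume s: "s \<in> {0..1}"
    show "((\<lambda>s. pr (Y s)) has_vector_derivative pr (a s ** Y s - Y s ** a s)) (at s within {0..1})"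
      by (rule bounded_linear.has_vector_derivative[OF bounded_linear_pr Yd[OF s]])
    define u where "u = pr (Y s)"
    define v where "v = Y s - u"
    have v: "v \<in> g" "Y s = u + v" using pr_complement by (auto simp: v_def u_def)
    have "pr (a s ** Y s - Y s ** a s) = pr (a s ** u - u ** a s) + pr (a s ** v - v ** a s)"
      unfolding linear_add[OF linear_pr, symmetric] by (simp add: v(2) mm.add_left mm.add_right algebra_simps)
    also have "pr (a s ** v - v ** a s) = 0" using bracket[OF a[OF s] v(1)] by (simp add: pr_eq_0_iff)
    finally have "norm (pr (a s ** Y s - Y s ** a s)) \<le> norm (a s ** u - u ** a s) * Kp" using Kp by simp
    also have "norm (a s ** u - u ** a s) \<le> norm (a s) * norm u * K + norm u * norm (a s) * K"
      using norm_triangle_ineq4[of "a s ** u" "u ** a s"] K(2)[of "a s" u] K(2)[of u "a s"] by linarith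
    also have "\<dots> = 2 * K * norm u * norm (a s)" by simp
    also have "\<dots> \<le> 2 * K * norm u * Ka" using Ka[OF s] K by (intro mult_left_mono) auto
    finally show "norm (pr (a s ** Y s - Y s ** a s)) \<le> 2 * K * Ka * Kp * norm (pr (Y s))"
      using Kp by (simp add: u_def algebra_simps)
  next
    show "pr (Y 0) = 0" using fl b by (simp add: Y_def flow_def pr_eq_0_iff)
  qed (use s in auto)
  then show "Z s ** b ** Zi s \<in> g" by (simp add: Y_def pr_eq_0_iff)
qed (use flow_inverse[OF fl s] in auto)

end

lemma flow_mexp: "flow (\<lambda>_. b) (\<lambda>s. mexp (s *\<^sub>R b)) (\<lambda>s. mexp (s *\<^sub>R (- b)))"
  using mexp_scaleR_has_vector_derivative[of b] mexp_scaleR_has_vector_derivative'[of "- b"]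
  by (auto simp: flow_def mm.minus_right)

lemma mexp_minus_inverse: "mexp b ** mexp (- b) = mat 1" "mexp (- b) ** mexp b = mat 1"
  using flow_inverse[OF flow_mexp[of b], of 1] by auto

lemma (in matrix_lie_algebra) ad_stable_mexp: "b \<in> g \<Longrightarrow> ad_stable (mexp b) (mexp (- b))"
  using ad_stable_flow[OF flow_mexp[of b], of 1] by (auto simp: image_constant_conv)

section \<open>Piecewise smooth paths tangent to the Lie algebra\<close>

context matrix_lie_algebra
begin

text \<open>The end points \<open>Z 1\<close> stand for the elements of the subgroup generated by
  \<open>g\<close>. Corners are allowed at the finite set \<open>F\<close>. Stability under
  conjugation is stored because the quotient of two paths has a conjugated generator.\<close>

definition gpath :: "(real \<Rightarrow> real ^ 'k ^ 'k) \<Rightarrow> (real \<Rightarrow> real ^ 'k ^ 'k) \<Rightarrow> bool" where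
  "gpath Z Zi \<longleftrightarrow> continuous_on {0..1} Z \<and> continuous_on {0..1} Zi \<and> Z 0 = mat 1 \<and> Zi 0 = mat 1 \<and>
     (\<forall>s\<in>{0..1}. ad_stable (Z s) (Zi s)) \<and>
     (\<exists>F. finite F \<and> (\<forall>s\<in>{0<..<1} - F. \<exists>a\<in>g.
        (Z has_vector_derivative a ** Z s) (at s) \<and> (Zi has_vector_derivative - (Zi s ** a)) (at s)))"

lemma ad_stable_1: "ad_stable (mat 1) (mat 1)"
  by (auto simp: ad_stable_def)

lemma gpath_const: "gpath (\<lambda>_. mat 1) (\<lambda>_. mat 1)"
  unfolding gpath_def using subspace_0[OF sub]
  by (auto intro!: exI[of _ "{}"] bexI[of _ 0] simp: ad_stable_1)

lemma gpath_flow: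
  assumes fl: "flow a Z Zi" and a: "\<And>s. s \<in> {0..1} \<Longrightarrow> a s \<in> g" and bd: "bounded (a ` {0..1})"
  shows "gpath Z Zi"
proof -
  have "continuous_on {0..1} Z" "continuous_on {0..1} Zi"
    using fl unfolding flow_def continuous_on_eq_continuous_within
    by (meson has_vector_derivative_continuous)+
  moreover have "\<exists>a\<in>g. (Z has_vector_derivative a ** Z s) (at s) \<and> (Zi has_vector_derivative - (Zi s ** a)) (at s)"
    if "s \<in> {0<..<1}" for s
  proof -
    have "at s within {0..1} = at s" using that by (intro at_within_interior) auto
    then show ?thesis using fl a[of s] that
      unfolding flow_def by (metis atLeastAtMost_iff greaterThanLessThan_iff less_imp_le)
  qed
  ultimately show ?thesis
    using fl ad_stable_flow[OF assms] by (auto simp: gpath_def flow_def intro!: exI[of _ "{}"])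
qed

text \<open>The second path is multiplied by \<open>Z 1\<close> from the right, which leaves its
  generator unchanged; the doubled speed only doubles the generator, and the joint at 1/2 becomes
  one more exceptional parameter.\<close>

lemma gpath_join:
  assumes Z: "gpath Z Zi" and Y: "gpath Y Yi"
  obtains W Wi where "gpath W Wi" "W 1 = Y 1 ** Z 1"
proof -
  define W where "W s = (if s \<le> 1/2 then Z (2 * s) else Y (2 * s - 1) ** Z 1)" for s :: real
  define Wi where "Wi s = (if s \<le> 1/2 then Zi (2 * s) else Zi 1 ** Yi (2 * s - 1))" for s :: real
  obtain F where F: "finite F" "\<And>s. s \<in> {0<..<1} - F \<Longrightarrow> \<exists>a\<in>g.
        (Z has_vector_derivative a ** Z s) (at s) \<and> (Zi has_vector_derivative - (Zi s ** a)) (at s)"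
    using Z by (auto simp: gpath_def)
  obtain G where G: "finite G" "\<And>s. s \<in> {0<..<1} - G \<Longrightarrow> \<exists>a\<in>g.
        (Y has_vector_derivative a ** Y s) (at s) \<and> (Yi has_vector_derivative - (Yi s ** a)) (at s)"
    using Y by (auto simp: gpath_def)
  define H where "H = insert (1/2) ((\<lambda>s. s / 2) ` F \<union> (\<lambda>s. (s + 1) / 2) ` G)"
  have cont: "continuous_on {0..1} Z" "continuous_on {0..1} Zi" "continuous_on {0..1} Y" "continuous_on {0..1} Yi"
    using Z Y by (auto simp: gpath_def)
  have init: "Z 0 = mat 1" "Zi 0 = mat 1" "Y 0 = mat 1" "Yi 0 = mat 1"
    using Z Y by (auto simp: gpath_def)
  have ad: "ad_stable (Z s) (Zi s)" "ad_stable (Y s) (Yi s)" if "s \<in> {0..1}" for s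
    using Z Y that by (auto simp: gpath_def)
  have half: "Z (2 * s) = Y (2 * s - 1) ** Z 1" "Zi (2 * s) = Zi 1 ** Yi (2 * s - 1)" if "s = 1/2" for s
  proof -
    have "2 * s = 1" using that by simp
    then show "Z (2 * s) = Y (2 * s - 1) ** Z 1" "Zi (2 * s) = Zi 1 ** Yi (2 * s - 1)" by (simp_all add: init)
  qed
  have "continuous_on {0..1} W"
    unfolding W_def
    by (rule continuous_on_cases_le)
      (auto intro!: continuous_intros mm.continuous_on continuous_on_compose2[OF cont(1)]
        continuous_on_compose2[OF cont(3)] intro: half)
  moreover have "continuous_on {0..1} Wi"
    unfolding Wi_def
    by (rule continuous_on_cases_le)
      (auto intro!: continuous_intros mm.continuous_on continuous_on_compose2[OF cont(2)]
        continuous_on_compose2[OF cont(4)] intro: half)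
  moreover have "ad_stable (W s) (Wi s)" if "s \<in> {0..1}" for s
    using that by (auto simp: W_def Wi_def intro!: ad ad_stable_mult)
  moreover have "\<exists>a\<in>g. (W has_vector_derivative a ** W s) (at s) \<and> (Wi has_vector_derivative - (Wi s ** a)) (at s)"
    if s: "s \<in> {0<..<1} - H" for s
  proof (cases "s < 1/2")
    case True
    have "2 * s \<notin> F"
    proof
      assume "2 * s \<in> F"
      then have "2 * s / 2 \<in> (\<lambda>s. s / 2) ` F" by (rule imageI)
      then show False using s unfolding H_def by simp
    qed
    then obtain a where a: "a \<in> g" "(Z has_vector_derivative a ** Z (2 * s)) (at (2 * s))"
        "(Zi has_vector_derivative - (Zi (2 * s) ** a)) (at (2 * s))"
      using F(2)[of "2 * s"] True s by auto
    have d2: "((\<lambda>s. 2 * s) has_vector_derivative 2) (at s)"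
      by (auto intro!: derivative_eq_intros simp: has_real_derivative_iff_has_vector_derivative[symmetric])
    have "(W has_vector_derivative 2 *\<^sub>R (a ** Z (2 * s))) (at s)"
      by (rule has_vector_derivative_transform_within_open[where S = "{..<1/2}",
            OF vector_diff_chain_at[OF d2 a(2), unfolded o_def]])
        (use True in \<open>auto simp: W_def\<close>)
    moreover have "(Wi has_vector_derivative 2 *\<^sub>R (- (Zi (2 * s) ** a))) (at s)"
      by (rule has_vector_derivative_transform_within_open[where S = "{..<1/2}",
            OF vector_diff_chain_at[OF d2 a(3), unfolded o_def]])
        (use True in \<open>auto simp: Wi_def\<close>)
    ultimately show ?thesis
      using True subspace_scale[OF sub a(1), of 2]
      by (intro bexI[of _ "2 *\<^sub>R a"]) (auto simp: W_def Wi_def mm.scaleR_left mm.scaleR_right)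
  next
    case False
    then have s2: "s > 1/2" using s by (auto simp: H_def)
    have "2 * s - 1 \<notin> G"
    proof
      assume "2 * s - 1 \<in> G"
      then have "(2 * s - 1 + 1) / 2 \<in> (\<lambda>s. (s + 1) / 2) ` G" by (rule imageI)
      then show False using s unfolding H_def by simp
    qed
    then obtain a where a: "a \<in> g" "(Y has_vector_derivative a ** Y (2 * s - 1)) (at (2 * s - 1))"
        "(Yi has_vector_derivative - (Yi (2 * s - 1) ** a)) (at (2 * s - 1))"
      using G(2)[of "2 * s - 1"] s2 s by auto
    have d2: "((\<lambda>s. 2 * s - 1) has_vector_derivative 2) (at s)"
      by (auto intro!: derivative_eq_intros simp: has_real_derivative_iff_has_vector_derivative[symmetric])
    have Yd: "((\<lambda>s. Y (2 * s - 1) ** Z 1) has_vector_derivative Y (2 * s - 1) ** 0 + (2 *\<^sub>R (a ** Y (2 * s - 1))) ** Z 1) (at s)"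
      by (intro mm.has_vector_derivative has_vector_derivative_const)
        (rule vector_diff_chain_at[OF d2 a(2), unfolded o_def])
    have Yid: "((\<lambda>s. Zi 1 ** Yi (2 * s - 1)) has_vector_derivative Zi 1 ** (2 *\<^sub>R (- (Yi (2 * s - 1) ** a))) + 0 ** Yi (2 * s - 1)) (at s)"
      by (intro mm.has_vector_derivative has_vector_derivative_const)
        (rule vector_diff_chain_at[OF d2 a(3), unfolded o_def])
    have "(W has_vector_derivative Y (2 * s - 1) ** 0 + (2 *\<^sub>R (a ** Y (2 * s - 1))) ** Z 1) (at s)"
      by (rule has_vector_derivative_transform_within_open[where S = "{1/2<..}", OF Yd])
        (use s2 in \<open>auto simp: W_def\<close>)
    moreover have "(Wi has_vector_derivative Zi 1 ** (2 *\<^sub>R (- (Yi (2 * s - 1) ** a))) + 0 ** Yi (2 * s - 1)) (at s)"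
      by (rule has_vector_derivative_transform_within_open[where S = "{1/2<..}", OF Yid])
        (use s2 in \<open>auto simp: Wi_def\<close>)
    ultimately show ?thesis
      using s2 subspace_scale[OF sub a(1), of 2]
      by (intro bexI[of _ "2 *\<^sub>R a"])
        (auto simp: W_def Wi_def mm.scaleR_left mm.scaleR_right matrix_mul_assoc mm.minus_right)
  qed
  moreover have "finite H" using F G by (simp add: H_def)
  ultimately have "gpath W Wi"
    unfolding gpath_def using init by (intro conjI ballI exI[of _ H]) (simp_all add: W_def Wi_def)
  moreover have "W 1 = Y 1 ** Z 1" by (simp add: W_def)
  ultimately show ?thesis using that by blast
qed

end

section \<open>Local coordinates adapted to the Lie algebra\<close>

context matrix_lie_algebra
begin

text \<open>\<open>E x\<close> is the product of the exponentials of
  \<open>(x \<bullet> b) *\<^sub>R b\<close> over the list, and \<open>D x y\<close> is its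
  logarithmic derivative in direction \<open>y\<close>. A further factor \<open>e\<close> on the
  left conjugates the old derivative by \<open>e\<close> and adds a multiple of \<open>b\<close>;
  both operations stay in \<open>g\<close>.\<close>

lemma exp_product:
  assumes "set bs \<subseteq> g"
  shows "\<exists>E Ei D. (\<forall>x. ad_stable (E x) (Ei x)) \<and> (\<forall>x y. D x y \<in> g) \<and>
    (\<forall>x. (E has_derivative (\<lambda>y. D x y ** E x)) (at x)) \<and> (\<forall>y. continuous_on UNIV (\<lambda>x. D x y)) \<and>
    (\<forall>y. D 0 y = (\<Sum>b\<leftarrow>bs. (y \<bullet> b) *\<^sub>R b)) \<and> E (0 :: real ^ 'k ^ 'k) = mat 1"
  using assms
proof (induction bs)
  case Nil
  then show ?case
    using subspace_0[OF sub] ad_stable_1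
    by (intro exI[of _ "\<lambda>_. mat 1"] exI[of _ "\<lambda>_ _. 0"]) auto
next
  case (Cons b bs)
  then obtain E Ei D where E: "\<And>x. ad_stable (E x) (Ei x)" "\<And>x y. D x y \<in> g"
    "\<And>x. (E has_derivative (\<lambda>y. D x y ** E x)) (at x)" "\<And>y. continuous_on UNIV (\<lambda>x. D x y)"
    "\<And>y. D 0 y = (\<Sum>b\<leftarrow>bs. (y \<bullet> b) *\<^sub>R b)" "E 0 = mat 1"
    by auto
  have b: "b \<in> g" using Cons by auto
  define e where "e x = mexp ((x \<bullet> b) *\<^sub>R b)" for x
  define ei where "ei x = mexp ((x \<bullet> b) *\<^sub>R - b)" for x
  have e_ad: "ad_stable (e x) (ei x)" for x
    using ad_stable_mexp[OF subspace_scale[OF sub b, of "x \<bullet> b"]] by (simp add: e_def ei_def)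
  have inner_d: "((\<lambda>x. x \<bullet> b) has_derivative (\<lambda>y. y \<bullet> b)) (at x)" for x
    by (auto intro!: derivative_eq_intros)
  have e_d: "(e has_derivative (\<lambda>y. (y \<bullet> b) *\<^sub>R (b ** e x))) (at x)" for x
    using has_derivative_compose[OF inner_d
        mexp_scaleR_has_vector_derivative[of b "x \<bullet> b" UNIV, unfolded has_vector_derivative_def]]
    by (simp add: e_def[abs_def])
  have ei_d: "(ei has_derivative (\<lambda>y. (y \<bullet> b) *\<^sub>R (- b ** ei x))) (at x)" for x
    using has_derivative_compose[OF inner_d
        mexp_scaleR_has_vector_derivative[of "- b" "x \<bullet> b" UNIV, unfolded has_vector_derivative_def]]
    by (simp add: ei_def[abs_def])
  have cont: "continuous_on UNIV e" "continuous_on UNIV ei"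
    using e_d ei_d by (auto intro!: continuous_at_imp_continuous_on has_derivative_continuous)
  define E' where "E' x = e x ** E x" for x
  define Ei' where "Ei' x = Ei x ** ei x" for x
  define D' where "D' x y = (y \<bullet> b) *\<^sub>R b + e x ** D x y ** ei x" for x y
  have "ad_stable (E' x) (Ei' x)" for x
    unfolding E'_def Ei'_def by (rule ad_stable_mult[OF E(1) e_ad])
  moreover have "D' x y \<in> g" for x y
    unfolding D'_def using e_ad E(2) b
    by (auto simp: ad_stable_def intro!: subspace_add[OF sub] subspace_scale[OF sub])
  moreover have "(E' has_derivative (\<lambda>y. D' x y ** E' x)) (at x)" for x
  proof -
    have "(E' has_derivative (\<lambda>y. e x ** (D x y ** E x) + (y \<bullet> b) *\<^sub>R (b ** e x) ** E x)) (at x)"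
      unfolding E'_def[abs_def] by (rule mm.FDERIV[OF e_d E(3)])
    moreover have "e x ** (D x y ** E x) + (y \<bullet> b) *\<^sub>R (b ** e x) ** E x = D' x y ** E' x" for y
    proof -
      have "e x ** D x y ** ei x ** (e x ** E x) = e x ** D x y ** (ei x ** e x) ** E x"
        by (simp only: matrix_mul_assoc)
      also have "\<dots> = e x ** (D x y ** E x)" using e_ad[of x] by (simp add: ad_stable_def matrix_mul_assoc)
      finally show ?thesis
        by (simp add: D'_def E'_def mm.add_left mm.scaleR_left matrix_mul_assoc)
    qed
    ultimately show ?thesis by simp
  qed
  moreover have "continuous_on UNIV (\<lambda>x. D' x y)" for y
    unfolding D'_def by (intro continuous_intros mm.continuous_on cont E(4))
  moreover have "D' 0 y = (\<Sum>b\<leftarrow>b # bs. (y \<bullet> b) *\<^sub>R b)" for y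
    by (simp add: D'_def e_def ei_def E(5))
  moreover have "E' 0 = mat 1" by (simp add: E'_def e_def E(6))
  ultimately show ?case by blast
qed

text \<open>In the coordinates \<open>x \<mapsto> E x ** (mat 1 + pr x)\<close>, where \<open>E\<close> is a product of one-parameter groups
  of \<open>g\<close> and \<open>pr\<close> is the projection along \<open>g\<close>, a path with \<open>W' = b ** W\<close> and \<open>b \<in> g\<close> has constant
  component \<open>pr x\<close>.\<close>

lemma plaque:
  obtains \<rho> \<psi> where "\<rho> > 0" "(\<psi> has_derivative (\<lambda>y. y)) (at (mat 1))" "\<psi> (mat 1) = (0 :: real ^ 'k ^ 'k)"
    "\<And>W F. \<lbrakk>continuous_on {0..1} W; W 0 = mat 1; \<And>s. s \<in> {0..1} \<Longrightarrow> norm (W s - mat 1) < \<rho>; finite F;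
       \<And>s. s \<in> {0<..<1} - F \<Longrightarrow> \<exists>b\<in>g. (W has_vector_derivative b ** W s) (at s)\<rbrakk> \<Longrightarrow> \<psi> (W (1::real)) \<in> g"
proof -
  obtain E Ei D where E: "\<And>x. ad_stable (E x) (Ei x)" "\<And>x y. D x y \<in> g"
    "\<And>x. (E has_derivative (\<lambda>y. D x y ** E x)) (at x)" "\<And>y. continuous_on UNIV (\<lambda>x. D x y)"
    "\<And>y. D 0 y = (\<Sum>b\<leftarrow>onb. (y \<bullet> b) *\<^sub>R b)" "E 0 = mat 1"
    using exp_product[OF onb(2)] by auto
  define f where "f x = E x ** (mat 1 + pr x)" for x
  define f1 where "f1 x y = D x y ** f x + E x ** pr y" for x y
  have pr0: "pr 0 = 0" using linear_0[OF linear_pr] .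
  have fd: "(f has_derivative f1 x) (at x)" for x
  proof -
    have "((\<lambda>x. mat 1 + pr x) has_derivative pr) (at x)"
      using bounded_linear_imp_has_derivative[OF bounded_linear_pr] by (auto intro!: derivative_eq_intros)
    then have "(f has_derivative (\<lambda>y. E x ** pr y + D x y ** E x ** (mat 1 + pr x))) (at x)"
      unfolding f_def[abs_def] by (rule mm.FDERIV[OF E(3)])
    moreover have "E x ** pr y + D x y ** E x ** (mat 1 + pr x) = f1 x y" for y
      by (simp add: f1_def f_def matrix_mul_assoc)
    ultimately show ?thesis by (simp add: f1_def[abs_def])
  qed
  have f0: "f 0 = mat 1" by (simp add: f_def E(6) pr0)
  \<comment> \<open>At 0 the factor \<open>E\<close> contributes the projection onto
    \<open>g\<close> and the other factor the complementary projection \<open>pr\<close>. They add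
    up to the identity, so the inverse function theorem applies.\<close>
  have f10: "f1 0 y = y" for y
    by (simp add: f1_def f0 E(5) E(6) pr_def)
  define f' where "f' x = Blinfun (f1 x)" for x
  have f'_apply: "blinfun_apply (f' x) = f1 x" for x
    unfolding f'_def using has_derivative_bounded_linear[OF fd] by (rule bounded_linear_Blinfun_apply)
  have contE: "continuous_on UNIV E" and contf: "continuous_on UNIV f"
    using E(3) fd by (auto intro!: continuous_at_imp_continuous_on has_derivative_continuous)
  have contf': "continuous_on UNIV f'"
    by (rule continuous_on_blinfun_componentwise)
      (auto simp: f'_apply f1_def intro!: continuous_intros mm.continuous_on contE contf E(4))
  have id0: "id_blinfun o\<^sub>L f' 0 = id_blinfun"
    by (rule blinfun_eqI) (simp add: f'_apply f10)
  obtain U' V \<psi> \<psi>' where inv: "open U'" "0 \<in> U'" "open V" "mat 1 \<in> V" "homeomorphism U' V f \<psi>"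
    "\<And>y. y \<in> V \<Longrightarrow> (\<psi> has_derivative (\<psi>' y)) (at y)"
    "\<And>y. y \<in> V \<Longrightarrow> \<psi>' y = inv (f1 (\<psi> y))" "\<And>y. y \<in> V \<Longrightarrow> bij (f1 (\<psi> y))"
  proof (rule inverse_function_theorem[of UNIV f f' 0 id_blinfun])
    show "(f has_derivative blinfun_apply (f' x)) (at x)" for x using fd by (simp add: f'_apply)
  qed (use contf' id0 f0 f'_apply in auto)
  have \<psi>1: "\<psi> (mat 1) = 0" using inv(2,5) f0 by (metis homeomorphism_apply1)
  have "\<psi>' (mat 1) = (\<lambda>y. y)"
    using inv(7)[OF inv(4)] by (simp add: \<psi>1 f10[abs_def] inv_id[unfolded id_def])
  then have \<psi>d: "(\<psi> has_derivative (\<lambda>y. y)) (at (mat 1))" using inv(6)[OF inv(4)] by simp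
  obtain K where K: "K > 0" "\<And>(x :: real ^ 'k ^ 'k) (y :: real ^ 'k ^ 'k). norm (x ** y) \<le> norm x * norm y * K"
    using mm.pos_bounded by blast
  have "isCont (\<lambda>y. pr (\<psi> y)) (mat 1)"
    using bounded_linear.isCont[OF bounded_linear_pr has_derivative_continuous[OF \<psi>d]] .
  \<comment> \<open>The bound \<open>1 / (4 * K)\<close> keeps the norm of \<open>c ** pr x\<close>
    at most a quarter of the norm of \<open>c\<close> in the estimate below.\<close>
  then obtain \<rho>1 where \<rho>1: "\<rho>1 > 0" "\<And>y. dist y (mat 1) < \<rho>1 \<Longrightarrow> dist (pr (\<psi> y)) 0 < 1 / (4 * K)"
    unfolding continuous_at_eps_delta
    using K by (metis \<psi>1 pr0 divide_pos_pos mult_pos_pos zero_less_numeral zero_less_one)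
  obtain \<rho>2 where \<rho>2: "\<rho>2 > 0" "ball (mat 1) \<rho>2 \<subseteq> V" using inv(3,4) open_contains_ball by blast
  define \<rho> where "\<rho> = min \<rho>1 \<rho>2"
  show ?thesis
  proof (rule that[OF _ \<psi>d \<psi>1])
    show "\<rho> > 0" using \<rho>1 \<rho>2 by (simp add: \<rho>_def)
    fix W :: "real \<Rightarrow> real ^ 'k ^ 'k" and F
    assume W: "continuous_on {0..1} W" "W 0 = mat 1" "\<And>s. s \<in> {0..1} \<Longrightarrow> norm (W s - mat 1) < \<rho>" "finite F"
      "\<And>s. s \<in> {0<..<1} - F \<Longrightarrow> \<exists>b\<in>g. (W has_vector_derivative b ** W s) (at s)"
    have WV: "W s \<in> V" if "s \<in> {0..1}" for s
      using W(3)[OF that] \<rho>2(2) by (auto simp: \<rho>_def dist_norm norm_minus_commute)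
    have small: "norm (pr (\<psi> (W s))) * K < 1/4" if "s \<in> {0..1}" for s
      using \<rho>1(2)[of "W s"] W(3)[OF that] K(1) by (simp add: \<rho>_def dist_norm field_simps)
    have "pr (\<psi> (W 1)) = 0"
    proof (rule has_derivative_zero_unique_strong_interval[of "insert 0 (insert 1 F)" 0 1 "\<lambda>s. pr (\<psi> (W s))"])
      show "finite (insert 0 (insert 1 F))" using W(4) by simp
      have "continuous_on V \<psi>" using inv(6) by (intro continuous_at_imp_continuous_on ballI has_derivative_continuous)
      then show "continuous_on {0..1} (\<lambda>s. pr (\<psi> (W s)))"
        by (intro bounded_linear.continuous_on[OF bounded_linear_pr])
          (rule continuous_on_compose2[OF _ W(1)], use WV in auto)
      show "pr (\<psi> (W 0)) = 0" by (simp add: W(2) \<psi>1 pr0)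
      fix s :: real assume s: "s \<in> {0..1} - insert 0 (insert 1 F)"
      then have s': "s \<in> {0<..<1} - F" "s \<in> {0..1}" by auto
      obtain b where b: "b \<in> g" "(W has_vector_derivative b ** W s) (at s)" using W(5)[OF s'(1)] by blast
      define x where "x = \<psi> (W s)"
      define y where "y = \<psi>' (W s) (b ** W s)"
      have fx: "f x = W s" unfolding x_def using inv(5) WV[OF s'(2)] by (meson homeomorphism_apply2)
      have y: "f1 x y = b ** W s"
        unfolding y_def x_def inv(7)[OF WV[OF s'(2)]] using inv(8)[OF WV[OF s'(2)]] by (simp add: bij_is_surj surj_f_inv_f)
      have xd: "((\<lambda>s. \<psi> (W s)) has_derivative (\<lambda>h. \<psi>' (W s) (h *\<^sub>R (b ** W s)))) (at s)"
        by (rule has_derivative_compose[OF b(2)[unfolded has_vector_derivative_def] inv(6)[OF WV[OF s'(2)]]])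
      have lin': "linear (\<psi>' (W s))" using inv(6)[OF WV[OF s'(2)]] has_derivative_linear by blast
      \<comment> \<open>The discrepancy between the generator \<open>b\<close> of the path and the
        logarithmic derivative of \<open>E\<close>, conjugated back by \<open>E x\<close>; by
        stability it remains in \<open>g\<close>.\<close>
      define c where "c = Ei x ** (b - D x y) ** E x"
      have c: "c \<in> g"
        unfolding c_def using E(1)[of x] E(2) b(1) by (auto simp: ad_stable_def intro!: subspace_diff[OF sub])
      have "E x ** pr y = (b - D x y) ** (E x ** (mat 1 + pr x))"
        using y by (simp add: f1_def fx[symmetric] f_def mm.diff_left algebra_simps)
      then have "Ei x ** (E x ** pr y) = c ** (mat 1 + pr x)"
        by (simp add: c_def matrix_mul_assoc)
      then have eq: "pr y = c + c ** pr x"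
        using E(1)[of x] by (simp add: ad_stable_def matrix_mul_assoc mm.add_right)
      have n1: "norm (c ** pr x) \<le> norm c * (1/4)"
        using K(2)[of c "pr x"] mult_left_mono[OF less_imp_le[OF small[OF s'(2)]] norm_ge_zero[of c]]
        by (simp add: x_def mult.assoc)
      have "norm c \<le> norm (pr y) + norm (c ** pr x)"
        using norm_triangle_ineq4[of "pr y" "c ** pr x"] by (simp add: eq)
      with n1 have n2: "norm c \<le> 4/3 * norm (pr y)" by simp
      \<comment> \<open>In \<open>pr y = c + c ** pr x\<close> the term \<open>c\<close> lies in
        \<open>g\<close> and is orthogonal to \<open>pr y\<close>. Only the small term remains,
        which is at most a third of \<open>pr y\<close> in norm; hence
        \<open>pr y = 0\<close>.\<close>
      have "pr y \<bullet> pr y = pr y \<bullet> (c ** pr x)"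
        by (subst (2) eq) (simp add: inner_add_right pr_orthogonal[OF c])
      also have "\<dots> \<le> norm (pr y) * norm (c ** pr x)" by (rule norm_cauchy_schwarz)
      also have "\<dots> \<le> norm (pr y) * (1/3 * norm (pr y))"
        using n1 n2 by (intro mult_left_mono) auto
      finally have "norm (pr y) * norm (pr y) \<le> 1/3 * (norm (pr y) * norm (pr y))"
        by (simp add: dot_square_norm power2_eq_square)
      then have "norm (pr y) * norm (pr y) \<le> 0" by simp
      then have pry: "pr y = 0" by (metis mult_eq_0_iff norm_eq_zero norm_ge_zero order_antisym mult_nonneg_nonneg)
      have "((\<lambda>s. pr (\<psi> (W s))) has_derivative (\<lambda>h. pr (\<psi>' (W s) (h *\<^sub>R (b ** W s))))) (at s)"
        by (rule bounded_linear.has_derivative[OF bounded_linear_pr xd])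
      moreover have "pr (\<psi>' (W s) (h *\<^sub>R (b ** W s))) = 0" for h
        by (simp add: linear_scale[OF lin'] linear_scale[OF linear_pr] y_def[symmetric] pry)
      ultimately have "((\<lambda>s. pr (\<psi> (W s))) has_derivative (\<lambda>h. 0)) (at s)" by simp
      then show "((\<lambda>s. pr (\<psi> (W s))) has_derivative (\<lambda>h. 0)) (at s within {0..1})"
        by (rule has_derivative_at_withinI)
    qed simp
    then show "\<psi> (W 1) \<in> g" by (simp add: pr_eq_0_iff)
  qed
qed

end

section \<open>Countability and the velocity of a curve in the subgroup\<close>

lemma uncountable_limit_point:
  fixes S :: "'a::second_countable_topology set"
  assumes "uncountable S"
  obtains x where "x \<in> S" "x islimpt S"
proof (rule ccontr)
  assume "\<not> thesis"
  then have no: "\<forall>x\<in>S. \<not> x islimpt S" using that by blast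
  obtain B :: "'a set set" where B: "countable B" "topological_basis B"
    using ex_countable_basis by blast
  \<comment> \<open>If no point of \<open>S\<close> is a limit point of \<open>S\<close>, basic open
    sets isolate the points, and this injects \<open>S\<close> into a countable basis.\<close>
  have "\<exists>b\<in>B. S \<inter> b = {x}" if x: "x \<in> S" for x
  proof -
    obtain T where T: "open T" "x \<in> T" "\<And>y. y \<in> S \<Longrightarrow> y \<in> T \<Longrightarrow> y = x"
      using no x unfolding islimpt_def by metis
    obtain b where b: "b \<in> B" "x \<in> b" "b \<subseteq> T" by (rule topological_basisE[OF B(2) T(1,2)])
    then have "S \<inter> b = {x}" using T(3) x by auto
    with b(1) show ?thesis by blast
  qed
  then obtain \<beta> where \<beta>: "\<And>x. x \<in> S \<Longrightarrow> \<beta> x \<in> B \<and> S \<inter> \<beta> x = {x}" by metis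
  then have "inj_on \<beta> S" by (metis inj_onI the_elem_eq)
  moreover have "\<beta> ` S \<subseteq> B" using \<beta> by auto
  ultimately have "countable S" using B(1) countable_image_inj_on countable_subset by metis
  then show False using assms by simp
qed

text \<open>Needed along an arbitrary set \<open>S\<close> accumulating at \<open>u\<close>, since
  only there are the quotients known to lie in the Lie algebra.\<close>

lemma has_vector_derivative_within_quotient:
  assumes "(f has_vector_derivative D) (at u within S)"
  shows "((\<lambda>t. (f t - f u) /\<^sub>R (t - u)) \<longlongrightarrow> D) (at u within S)"
proof -
  let ?e = "\<lambda>t. (f t - f u - (t - u) *\<^sub>R D) /\<^sub>R norm (t - u)"
  have "((\<lambda>t. norm (?e t)) \<longlongrightarrow> 0) (at u within S)"
    using assms unfolding has_vector_derivative_def has_derivative_at_within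
    by (intro tendsto_norm_zero) simp
  moreover have "eventually (\<lambda>t. norm (?e t) = norm ((f t - f u) /\<^sub>R (t - u) - D)) (at u within S)"
    unfolding eventually_at_filter
  proof (intro always_eventually allI impI)
    fix t assume "t \<noteq> u"
    then have "(f t - f u) /\<^sub>R (t - u) - D = (f t - f u - (t - u) *\<^sub>R D) /\<^sub>R (t - u)"
      by (simp add: scaleR_diff_right)
    then show "norm (?e t) = norm ((f t - f u) /\<^sub>R (t - u) - D)" by simp
  qed
  ultimately have "((\<lambda>t. norm ((f t - f u) /\<^sub>R (t - u) - D)) \<longlongrightarrow> 0) (at u within S)"
    by (rule Lim_transform_eventually)
  then show ?thesis by (rule LIM_zero_cancel[OF tendsto_norm_zero_cancel])
qed

text \<open>Every path is approximated by a step function with values in a countable dense set, and there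
  are only countably many such step functions.\<close>

lemma uncountable_close_paths:
  fixes Z :: "'t \<Rightarrow> real \<Rightarrow> 'a::{metric_space, second_countable_topology}" and N :: "'t \<Rightarrow> nat"
  assumes unc: "uncountable T" and cont: "\<And>t. t \<in> T \<Longrightarrow> continuous_on {0..1} (Z t)" and \<epsilon>: "\<And>n. \<epsilon> n > (0::real)"
  obtains S n where "S \<subseteq> T" "uncountable S" "\<And>t. t \<in> S \<Longrightarrow> N t = n"
    "\<And>t t' s. \<lbrakk>t \<in> S; t' \<in> S; s \<in> {0..1}\<rbrakk> \<Longrightarrow> dist (Z t s) (Z t' s) < \<epsilon> n"
proof -
  obtain D :: "'a set" where D: "countable D" "\<And>X. open X \<Longrightarrow> X \<noteq> {} \<Longrightarrow> \<exists>d\<in>D. d \<in> X"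
    using countable_dense_setE by blast
  have "\<exists>m q. q \<in> lists D \<and> (\<forall>s\<in>{0..1}. dist (Z t s) (q ! nat \<lfloor>real m * s\<rfloor>) < \<epsilon> (N t) / 2)" if t: "t \<in> T" for t
  proof -
    \<comment> \<open>Two errors of size \<open>e\<close> separate a path from its step function,
      and two such distances separate two paths with the same step function.\<close>
    define e where "e = \<epsilon> (N t) / 4"
    have e: "e > 0" using \<epsilon>[of "N t"] by (simp add: e_def)
    have "uniformly_continuous_on {0..1} (Z t)"
      by (rule compact_uniformly_continuous[OF cont[OF t]]) simp
    then obtain \<delta> where \<delta>: "\<delta> > 0"
      "\<And>x x'. \<lbrakk>x \<in> {0..1}; x' \<in> {0..1}; dist x' x < \<delta>\<rbrakk> \<Longrightarrow> dist (Z t x') (Z t x) < e"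
      unfolding uniformly_continuous_on_def using e by metis
    obtain m where m: "m > 0" "1 / real m < \<delta>"
      using \<delta>(1) real_arch_inverse by (metis inverse_eq_divide neq0_conv)
    have "\<exists>d\<in>D. dist (Z t (real i / real m)) d < e" for i
      using D(2)[of "ball (Z t (real i / real m)) e"] e by auto
    then obtain d where d: "\<And>i. d i \<in> D" "\<And>i. dist (Z t (real i / real m)) (d i) < e" by metis
    \<comment> \<open>The parameter \<open>s = 1\<close> has index \<open>m\<close>, so the list
      needs \<open>m + 1\<close> entries.\<close>
    define q where "q = map d [0..<Suc m]"
    have "dist (Z t s) (q ! nat \<lfloor>real m * s\<rfloor>) < \<epsilon> (N t) / 2" if s: "s \<in> {0..1}" for s
    proof -
      define i where "i = nat \<lfloor>real m * s\<rfloor>"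
      have i: "real i \<le> real m * s" "real m * s < real i + 1"
        using s unfolding i_def by (simp_all add: of_nat_floor)
      have "real m * s \<le> real m" using s m by (simp add: mult_left_le)
      with i have im: "i \<le> m" by linarith
      have "dist s (real i / real m) < \<delta>"
      proof -
        have "real i / real m \<le> s" "s < real i / real m + 1 / real m"
          using i m by (simp_all add: field_simps)
        then show ?thesis using m by (simp add: dist_real_def)
      qed
      then have "dist (Z t s) (Z t (real i / real m)) < e"
        using s im m by (intro \<delta>(2)) (auto simp: divide_simps)
      moreover have "q ! i = d i" unfolding q_def using im by (simp del: upt_Suc)
      ultimately show ?thesis
        using d(2)[of i] dist_triangle_less_add[of "Z t s" "Z t (real i / real m)" e "d i" e]
        by (simp add: e_def i_def[symmetric] dist_commute)
    qed
    moreover have "q \<in> lists D" using d(1) by (auto simp: q_def)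
    ultimately show ?thesis by blast
  qed
  then obtain m q where mq: "\<And>t. t \<in> T \<Longrightarrow> q t \<in> lists D"
    "\<And>t s. t \<in> T \<Longrightarrow> s \<in> {0..1} \<Longrightarrow> dist (Z t s) (q t ! nat \<lfloor>real (m t) * s\<rfloor>) < \<epsilon> (N t) / 2" by metis
  \<comment> \<open>The value \<open>N t\<close> belongs to the code, so that one tolerance is valid
    for all paths sharing a code.\<close>
  define c where "c t = (N t, m t, q t)" for t
  define C where "C = (UNIV :: nat set) \<times> (UNIV :: nat set) \<times> lists D"
  have "countable C" unfolding C_def using D(1) by (intro countable_SIGMA) auto
  have cC: "c t \<in> C" if "t \<in> T" for t using mq(1)[OF that] by (simp add: c_def C_def)
  have "\<exists>k\<in>C. uncountable {t \<in> T. c t = k}"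
  proof (rule ccontr)
    assume "\<not> ?thesis"
    then have "countable (\<Union>k\<in>C. {t \<in> T. c t = k})" using \<open>countable C\<close> by (intro countable_UN) auto
    moreover have "T \<subseteq> (\<Union>k\<in>C. {t \<in> T. c t = k})" using cC by auto
    ultimately show False using unc countable_subset by blast
  qed
  then obtain n m' q' where S: "uncountable {t \<in> T. c t = (n, m', q')}" by (metis prod_cases3)
  show ?thesis
  proof (rule that[OF _ S])
    fix t t' and s :: real assume *: "t \<in> {t \<in> T. c t = (n, m', q')}" "t' \<in> {t \<in> T. c t = (n, m', q')}" "s \<in> {0..1}"
    then have "dist (Z t s) (q' ! nat \<lfloor>real m' * s\<rfloor>) < \<epsilon> n / 2" "dist (Z t' s) (q' ! nat \<lfloor>real m' * s\<rfloor>) < \<epsilon> n / 2"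
      using mq(2)[of t s] mq(2)[of t' s] by (auto simp: c_def)
    then show "dist (Z t s) (Z t' s) < \<epsilon> n" by (rule dist_triangle_half_l)
  qed (auto simp: c_def)
qed

text \<open>The subgroup with Lie algebra \<open>g\<close> need not be closed. Near each of its points it consists of
  countably many plaques, so uncountably many points of the curve \<open>M\<close> lie in a common plaque.\<close>

theorem (in matrix_lie_algebra) velocity_in_lie_algebra:
  fixes M M' :: "real \<Rightarrow> real ^ 'k ^ 'k"
  assumes der: "\<And>t. (M has_vector_derivative M' t) (at t)" and cont: "isCont M' 0" and M0: "M 0 = mat 1"
    and ex: "\<And>t. \<exists>Z Zi. gpath Z Zi \<and> Z 1 = M t"
  shows "M' 0 \<in> g"
proof -
  obtain K where K: "K > 0" "\<And>(x :: real ^ 'k ^ 'k) (y :: real ^ 'k ^ 'k). norm (x ** y) \<le> norm x * norm y * K"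
    using mm.pos_bounded by blast
  obtain \<rho> \<psi> where \<psi>: "\<rho> > 0" "(\<psi> has_derivative (\<lambda>y. y)) (at (mat 1))" "\<psi> (mat 1) = (0 :: real ^ 'k ^ 'k)"
    "\<And>W F. \<lbrakk>continuous_on {0..1} W; W 0 = mat 1; \<And>s. s \<in> {0..1} \<Longrightarrow> norm (W s - mat 1) < \<rho>; finite F;
       \<And>s. s \<in> {0<..<1} - F \<Longrightarrow> \<exists>b\<in>g. (W has_vector_derivative b ** W s) (at s)\<rbrakk> \<Longrightarrow> \<psi> (W 1) \<in> g"
    using plaque by blast
  obtain Z Zi where Z: "\<And>t. gpath (Z t) (Zi t)" "\<And>t. Z t 1 = M t" using ex by metis
  have contZ: "continuous_on {0..1} (Z t)" "continuous_on {0..1} (Zi t)" for t using Z by (auto simp: gpath_def)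
  have adZ: "ad_stable (Z t s) (Zi t s)" if "s \<in> {0..1}" for t s using Z that by (auto simp: gpath_def)
  \<comment> \<open>Choosing the bound among the natural numbers leaves countably many
    cases.\<close>
  have "\<exists>n. \<forall>s\<in>{0..1}. norm (Zi t s) \<le> real n" for t
  proof -
    have "bounded (Zi t ` {0..1})"
      using compact_continuous_image[OF contZ(2)] compact_imp_bounded by blast
    then obtain B where "\<forall>s\<in>{0..1}. norm (Zi t s) \<le> B" by (auto simp: bounded_iff)
    then show ?thesis by (meson order_trans real_arch_simple)
  qed
  then obtain N where N: "\<And>t s. s \<in> {0..1} \<Longrightarrow> norm (Zi t s) \<le> real (N t)" by metis
  \<comment> \<open>Arbitrarily close to 0 there is a parameter at which the logarithmic derivative
    of \<open>M\<close> lies in \<open>g\<close>. Continuity of \<open>M\<close> and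
    \<open>M'\<close> carries this to 0, where \<open>M\<close> is the identity.\<close>
  have key: "\<exists>t\<in>{-\<delta><..<\<delta>}. \<exists>b\<in>g. M' t = M t ** b" if "\<delta> > 0" for \<delta>
  proof -
    have "uncountable {-\<delta><..<\<delta>}" using that by (simp add: uncountable_open_interval)
    \<comment> \<open>The tolerance is chosen so that \<open>Zi u s ** Z t s\<close> stays within
      \<rho> of the identity when \<open>Zi u\<close> is bounded by \<open>n\<close>;
      \<open>n + 1\<close> avoids division by zero.\<close>
    then obtain S n where S: "S \<subseteq> {-\<delta><..<\<delta>}" "uncountable S" "\<And>t. t \<in> S \<Longrightarrow> N t = n"
      "\<And>t t' s. \<lbrakk>t \<in> S; t' \<in> S; s \<in> {0..1}\<rbrakk> \<Longrightarrow> dist (Z t s) (Z t' s) < \<rho> / (K * (real n + 1))"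
      using uncountable_close_paths[of "{-\<delta><..<\<delta>}" Z "\<lambda>n. \<rho> / (K * (real n + 1))" N] contZ(1) K(1) \<psi>(1)
      by (auto simp: add_nonneg_pos)
    obtain u where u: "u \<in> S" "u islimpt S" using uncountable_limit_point[OF S(2)] by blast
    define \<phi> where "\<phi> t = \<psi> (Zi u 1 ** M t)" for t
    have \<phi>_in: "\<phi> t \<in> g" if t: "t \<in> S" for t
    proof -
      \<comment> \<open>This quotient starts at the identity and is again tangent to
        \<open>g\<close>: its generator is the difference of the two generators, conjugated back
        along \<open>Z u\<close>.\<close>
      define W where "W s = Zi u s ** Z t s" for s
      obtain F1 where F1: "finite F1" "\<And>s. s \<in> {0<..<1} - F1 \<Longrightarrow> \<exists>a\<in>g. (Zi u has_vector_derivative - (Zi u s ** a)) (at s)"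
        using Z(1)[of u] unfolding gpath_def by metis
      obtain F2 where F2: "finite F2" "\<And>s. s \<in> {0<..<1} - F2 \<Longrightarrow> \<exists>a\<in>g. (Z t has_vector_derivative a ** Z t s) (at s)"
        using Z(1)[of t] unfolding gpath_def by metis
      have "\<psi> (W 1) \<in> g"
      proof (rule \<psi>(4))
        show "continuous_on {0..1} W" unfolding W_def by (intro mm.continuous_on contZ)
        show "W 0 = mat 1" using Z(1) by (simp add: W_def gpath_def)
        show "finite (F1 \<union> F2)" using F1 F2 by simp
        fix s :: real assume s: "s \<in> {0..1}"
        have "W s - mat 1 = Zi u s ** (Z t s - Z u s)"
          using adZ[OF s, of u] by (simp add: W_def ad_stable_def mm.diff_right)
        then have "norm (W s - mat 1) \<le> norm (Zi u s) * norm (Z t s - Z u s) * K" using K(2) by metis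
        also have "\<dots> \<le> real n * norm (Z t s - Z u s) * K"
          using N[OF s, of u] S(3)[OF u(1)] K(1) by (intro mult_right_mono) auto
        also have "\<dots> \<le> (real n + 1) * norm (Z t s - Z u s) * K"
          using K(1) by (intro mult_right_mono) auto
        also have "\<dots> < \<rho>"
        proof -
          have "norm (Z t s - Z u s) * (K * (real n + 1)) < \<rho>"
            using S(4)[OF t u(1) s] K(1) by (subst (asm) pos_less_divide_eq) (auto simp: dist_norm)
          then show ?thesis by (simp add: ac_simps)
        qed
        finally show "norm (W s - mat 1) < \<rho>" .
      next
        fix s :: real assume s: "s \<in> {0<..<1} - (F1 \<union> F2)"
        then have s01: "s \<in> {0..1}" by auto
        obtain a where a: "a \<in> g" "(Zi u has_vector_derivative - (Zi u s ** a)) (at s)" using F1(2)[of s] s by auto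
        obtain a' where a': "a' \<in> g" "(Z t has_vector_derivative a' ** Z t s) (at s)" using F2(2)[of s] s by auto
        have "(W has_vector_derivative (Zi u s ** (a' ** Z t s) + - (Zi u s ** a) ** Z t s)) (at s)"
          unfolding W_def[abs_def] by (rule mm.has_vector_derivative[OF a(2) a'(2)])
        moreover have "Zi u s ** (a' ** Z t s) + - (Zi u s ** a) ** Z t s = (Zi u s ** (a' - a) ** Z u s) ** W s"
        proof -
          have "(Zi u s ** (a' - a) ** Z u s) ** W s = Zi u s ** (a' - a) ** (Z u s ** Zi u s) ** Z t s"
            by (simp add: W_def matrix_mul_assoc)
          also have "\<dots> = Zi u s ** (a' - a) ** Z t s" using adZ[OF s01, of u] by (simp add: ad_stable_def)
          finally show ?thesis by (simp add: mm.diff_left mm.diff_right mm.minus_left matrix_mul_assoc)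
        qed
        moreover have "Zi u s ** (a' - a) ** Z u s \<in> g"
          using adZ[OF s01, of u] subspace_diff[OF sub a'(1) a(1)] by (simp add: ad_stable_def)
        ultimately show "\<exists>b\<in>g. (W has_vector_derivative b ** W s) (at s)" by metis
      qed
      then show ?thesis by (simp add: W_def \<phi>_def Z(2))
    qed
    have inv1: "Zi u 1 ** M u = mat 1" "M u ** Zi u 1 = mat 1"
      using adZ[of 1 u] by (simp_all add: ad_stable_def Z(2))
    have \<phi>u: "\<phi> u = 0" by (simp add: \<phi>_def inv1 \<psi>(3))
    have "((\<lambda>t. Zi u 1 ** M t) has_vector_derivative Zi u 1 ** M' u) (at u)"
      using mm.has_vector_derivative[OF has_vector_derivative_const der[of u]] by simp
    then have "(\<phi> has_derivative (\<lambda>h. h *\<^sub>R (Zi u 1 ** M' u))) (at u)"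
      unfolding \<phi>_def[abs_def] has_vector_derivative_def
      by (rule has_derivative_compose) (simp add: inv1 \<psi>(2))
    then have "(\<phi> has_derivative (\<lambda>h. h *\<^sub>R (Zi u 1 ** M' u))) (at u within S)"
      by (rule has_derivative_at_withinI)
    then have "((\<lambda>t. (\<phi> t - \<phi> u) /\<^sub>R (t - u)) \<longlongrightarrow> Zi u 1 ** M' u) (at u within S)"
      by (intro has_vector_derivative_within_quotient) (simp add: has_vector_derivative_def)
    moreover have "eventually (\<lambda>t. (\<phi> t - \<phi> u) /\<^sub>R (t - u) \<in> g) (at u within S)"
      using \<phi>_in unfolding eventually_at_filter
      by (intro always_eventually) (auto simp: \<phi>u intro!: subspace_scale[OF sub])
    ultimately have "Zi u 1 ** M' u \<in> g"
      using Lim_in_closed_set[OF closed_subspace[OF sub], of "\<lambda>t. (\<phi> t - \<phi> u) /\<^sub>R (t - u)" "at u within S"] u(2)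
      by (simp add: trivial_limit_within)
    moreover have "M' u = M u ** (Zi u 1 ** M' u)" by (simp add: matrix_mul_assoc inv1)
    ultimately show ?thesis using u(1) S(1) by blast
  qed
  have "M' 0 \<in> closure g"
    unfolding closure_approachable
  proof (intro allI impI)
    fix e :: real assume "e > 0"
    define m where "m = norm (M' 0) + 1"
    have m: "m > 0" by (simp add: m_def add_nonneg_pos)
    \<comment> \<open>The cap 1/2 lets \<open>e1 * norm b\<close> be absorbed, which gives
      \<open>norm b \<le> 2 * m\<close>; the second bound then pays for the total error.\<close>
    define e1 where "e1 = min (1/2) (e / (2 * (1 + 2 * m)))"
    have e1: "e1 > 0" "e1 \<le> 1/2" "e1 * (1 + 2 * m) < e"
    proof -
      show "e1 > 0" using \<open>e > 0\<close> m by (auto simp: e1_def)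
      show "e1 \<le> 1/2" unfolding e1_def by (rule min.cobounded1)
      have "e1 * (1 + 2 * m) \<le> e / (2 * (1 + 2 * m)) * (1 + 2 * m)"
        using m by (intro mult_right_mono) (auto simp: e1_def)
      also have "\<dots> = e / 2" using m by (simp add: field_simps)
      finally show "e1 * (1 + 2 * m) < e" using \<open>e > 0\<close> by simp
    qed
    obtain \<delta>1 where \<delta>1: "\<delta>1 > 0" "\<And>t. dist t 0 < \<delta>1 \<Longrightarrow> dist (M' t) (M' 0) < e1"
      using cont e1(1) unfolding continuous_at_eps_delta by blast
    have "isCont M 0" using der has_vector_derivative_continuous by blast
    then obtain \<delta>2 where \<delta>2: "\<delta>2 > 0" "\<And>t. dist t 0 < \<delta>2 \<Longrightarrow> dist (M t) (mat 1) < e1 / K"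
      using e1(1) K(1) unfolding continuous_at_eps_delta M0 by (meson divide_pos_pos)
    obtain t b where tb: "t \<in> {-min \<delta>1 \<delta>2<..<min \<delta>1 \<delta>2}" "b \<in> g" "M' t = M t ** b"
      using key[of "min \<delta>1 \<delta>2"] \<delta>1(1) \<delta>2(1) by auto
    have t1: "norm (M' t - M' 0) < e1" and t2: "norm (M t - mat 1) < e1 / K"
      using tb(1) \<delta>1(2)[of t] \<delta>2(2)[of t] by (auto simp: dist_norm)
    have "M' t - b = (M t - mat 1) ** b" by (simp add: tb(3) mm.diff_left)
    then have "norm (M' t - b) \<le> norm (M t - mat 1) * norm b * K" using K(2) by metis
    also have "\<dots> \<le> e1 / K * norm b * K" using t2 K(1) by (intro mult_right_mono) auto
    finally have d1: "norm (M' t - b) \<le> e1 * norm b" using K(1) by simp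
    have "norm (M' t) \<le> m"
      using t1 e1(2) norm_triangle_ineq2[of "M' t" "M' 0"] by (simp add: m_def)
    moreover have "norm b \<le> norm (M' t) + norm (M' t - b)"
      using norm_triangle_ineq4[of "M' t" "M' t - b"] by simp
    moreover have "e1 * norm b \<le> 1/2 * norm b" using e1(2) by (intro mult_right_mono) auto
    ultimately have "norm b \<le> 2 * m" using d1 by linarith
    then have "norm (M' t - b) \<le> e1 * (2 * m)"
      using d1 e1(1) by (meson mult_left_mono less_imp_le order_trans)
    then have "norm (b - M' 0) < e1 * (2 * m) + e1"
      using t1 norm_triangle_ineq[of "b - M' t" "M' t - M' 0"] by (simp add: norm_minus_commute)
    also have "\<dots> < e" using e1(3) by (simp add: algebra_simps)
    finally show "\<exists>y\<in>g. dist y (M' 0) < e" using tb(2) by (auto simp: dist_norm)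
  qed
  then show ?thesis using closed_subspace[OF sub] by simp
qed

section \<open>Smooth maps and manifolds with a single chart\<close>

lemma Ck_on_UNIV_SucI:
  assumes "\<And>x. (f has_derivative f' x) (at x)" "\<And>v. Ck_on k UNIV (\<lambda>x. f' x v)"
  shows "Ck_on (Suc k) UNIV f"
proof -
  have "frechet_derivative f (at x) = f' x" for x
    using frechet_derivative_at[OF assms(1)] by simp
  then show ?thesis using assms by (auto simp: differentiable_def)
qed

lemma Ck_on_UNIV_SucD:
  assumes "Ck_on (Suc k) UNIV f"
  shows "(f has_derivative frechet_derivative f (at x)) (at x)" "Ck_on k UNIV (\<lambda>x. frechet_derivative f (at x) v)"
  using assms frechet_derivative_works by auto

lemma Ck_on_Suc_imp: "Ck_on (Suc k) S f \<Longrightarrow> Ck_on k S f"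
proof (induction k arbitrary: f)
  case 0
  then show ?case
    by (auto intro!: continuous_at_imp_continuous_on differentiable_imp_continuous_within)
next
  case (Suc k)
  then show ?case by (subst Ck_on.simps(2)) auto
qed

lemma Ck_on_const: "Ck_on k UNIV (\<lambda>x. c)"
proof (induction k arbitrary: c)
  case (Suc k)
  show ?case by (rule Ck_on_UNIV_SucI[where f' = "\<lambda>x v. 0"]) (auto intro: Suc)
qed simp

lemma Ck_on_bounded_linear: "bounded_linear L \<Longrightarrow> Ck_on k UNIV f \<Longrightarrow> Ck_on k UNIV (\<lambda>x. L (f x))"
proof (induction k arbitrary: f)
  case 0
  then show ?case by (auto intro: bounded_linear.continuous_on)
next
  case (Suc k)
  show ?case
  proof (rule Ck_on_UNIV_SucI)
    show "((\<lambda>x. L (f x)) has_derivative (\<lambda>v. L (frechet_derivative f (at x) v))) (at x)" for x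
      using Ck_on_UNIV_SucD(1)[OF Suc.prems(2)] by (rule bounded_linear.has_derivative[OF Suc.prems(1)])
  qed (use Suc Ck_on_UNIV_SucD(2) in blast)
qed

lemma Ck_on_add: "Ck_on k UNIV f \<Longrightarrow> Ck_on k UNIV g \<Longrightarrow> Ck_on k UNIV (\<lambda>x. f x + g x)"
proof (induction k arbitrary: f g)
  case 0
  then show ?case by (auto intro: continuous_intros)
next
  case (Suc k)
  show ?case
  proof (rule Ck_on_UNIV_SucI)
    show "((\<lambda>x. f x + g x) has_derivative (\<lambda>v. frechet_derivative f (at x) v + frechet_derivative g (at x) v)) (at x)" for x
      using Suc.prems by (intro has_derivative_add Ck_on_UNIV_SucD(1))
  qed (use Suc Ck_on_UNIV_SucD(2) in blast)
qed

lemma Ck_on_bilinear: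
  assumes "bounded_bilinear h"
  shows "Ck_on k UNIV f \<Longrightarrow> Ck_on k UNIV g \<Longrightarrow> Ck_on k UNIV (\<lambda>x. h (f x) (g x))"
proof (induction k arbitrary: f g)
  case 0
  then show ?case by (auto intro: bounded_bilinear.continuous_on[OF assms])
next
  case (Suc k)
  show ?case
  proof (rule Ck_on_UNIV_SucI)
    show "((\<lambda>x. h (f x) (g x)) has_derivative
        (\<lambda>v. h (f x) (frechet_derivative g (at x) v) + h (frechet_derivative f (at x) v) (g x))) (at x)" for x
      using Suc.prems by (intro bounded_bilinear.FDERIV[OF assms] Ck_on_UNIV_SucD(1))
    show "Ck_on k UNIV (\<lambda>x. h (f x) (frechet_derivative g (at x) v) + h (frechet_derivative f (at x) v) (g x))" for v
      by (intro Ck_on_add Suc.IH Ck_on_UNIV_SucD(2) Suc.prems Ck_on_Suc_imp)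
  qed
qed

lemma Ck_on_real_polynomial_function:
  fixes p :: "'a::euclidean_space \<Rightarrow> real"
  assumes "real_polynomial_function p"
  shows "Ck_on k UNIV p"
  using assms
proof induction
  case (linear f)
  have "Ck_on k UNIV (\<lambda>x::'a. x)"
  proof (induction k)
    case (Suc k)
    show ?case
      by (rule Ck_on_UNIV_SucI[where f' = "\<lambda>x v. v"]) (auto intro: Ck_on_const)
  qed simp
  then show ?case using Ck_on_bounded_linear[OF linear] by blast
qed (auto intro: Ck_on_const Ck_on_add Ck_on_bilinear[OF bounded_bilinear_mult])

lemma Ck_on_polynomial_function:
  fixes p :: "real \<Rightarrow> 'a::euclidean_space"
  assumes "polynomial_function p"
  shows "Ck_on k UNIV p"
  using assms
proof (induction k arbitrary: p)
  case 0
  then show ?case by (simp add: continuous_on_polymonial_function)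
next
  case (Suc k)
  obtain p' where p': "polynomial_function p'" "\<And>x. (p has_vector_derivative p' x) (at x)"
    using has_vector_derivative_polynomial_function[OF Suc.prems] by blast
  show ?case
    by (rule Ck_on_UNIV_SucI[where f' = "\<lambda>x v. v *\<^sub>R p' x"])
      (auto intro!: Ck_on_bounded_linear[OF bounded_linear_scaleR_right] Suc.IH p' simp: p'(2)[unfolded has_vector_derivative_def])
qed

text \<open>The derivative is a bounded linear image of the function itself, which closes the
  induction.\<close>

lemma Ck_on_mexp: "Ck_on k UNIV (\<lambda>t. mexp (t *\<^sub>R b))"
proof (induction k)
  case 0
  show ?case
    unfolding Ck_on.simps continuous_on_eq_continuous_within
    using has_vector_derivative_continuous[OF mexp_scaleR_has_vector_derivative] by blast
next
  case (Suc k)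
  show ?case
    by (rule Ck_on_UNIV_SucI[where f' = "\<lambda>x v. v *\<^sub>R (b ** mexp (x *\<^sub>R b))"])
      (auto intro!: Ck_on_bounded_linear[OF bounded_linear_scaleR_right] Ck_on_bounded_linear[OF mm.bounded_linear_right] Suc
        simp: mexp_scaleR_has_vector_derivative[unfolded has_vector_derivative_def])
qed

lemma Ck_on_scale_arg: "Ck_on k UNIV f \<Longrightarrow> Ck_on k UNIV (\<lambda>t. f (a * t))" for f :: "real \<Rightarrow> 'a::real_normed_vector"
proof (induction k arbitrary: f)
  case 0
  then show ?case by (auto intro!: continuous_on_compose2[of UNIV f] continuous_intros)
next
  case (Suc k)
  show ?case
  proof (rule Ck_on_UNIV_SucI)
    show "((\<lambda>t. f (a * t)) has_derivative (\<lambda>v. frechet_derivative f (at (a * t)) (a * v))) (at t)" for t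
      by (rule has_derivative_compose[OF _ Ck_on_UNIV_SucD(1)[OF Suc.prems]]) (auto intro!: derivative_eq_intros)
    show "Ck_on k UNIV (\<lambda>x. frechet_derivative f (at (a * x)) (a * v))" for v
      using Suc.IH[OF Ck_on_UNIV_SucD(2)[OF Suc.prems]] .
  qed
qed

lemma smooth_on_UNIV_vector_derivative:
  fixes f :: "real \<Rightarrow> 'a::real_normed_vector"
  assumes "smooth_on UNIV f"
  shows "(f has_vector_derivative vector_derivative f (at t)) (at t)"
    "continuous_on UNIV (\<lambda>t. vector_derivative f (at t))"
proof -
  have C: "Ck_on (Suc 0) UNIV f" using assms by (simp only: smooth_on_def)
  then have d: "f differentiable (at t)" for t by simp
  then show fd: "(f has_vector_derivative vector_derivative f (at t)) (at t)" for t
    using vector_derivative_works by blast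
  have "frechet_derivative f (at t) 1 = vector_derivative f (at t)" for t
    using frechet_derivative_at[OF fd[of t, unfolded has_vector_derivative_def]] by (metis scaleR_one)
  then show "continuous_on UNIV (\<lambda>t. vector_derivative f (at t))"
    using spec[OF conjunct2[OF C[unfolded Ck_on.simps]], of 1] by simp
qed

section \<open>Euclidean space as a manifold with a single chart\<close>

definition std_chart :: "(real ^ 'k, 'k::finite) chart" where
  "std_chart = (UNIV, id)"

text \<open>The value 0 at all other charts is the default that \<open>tangent_space\<close>
  prescribes outside the atlas.\<close>

definition tvec :: "real ^ 'k \<Rightarrow> (real ^ 'k, 'k::finite) tvec" where
  "tvec v = (\<lambda>c. if c = std_chart then v else 0)"

lemma tvec_std_chart [simp]: "tvec v std_chart = v"
  by (simp add: tvec_def)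

lemma std_chart_simps [simp]: "fst std_chart = UNIV" "snd std_chart = id" "chart_inv std_chart = id"
  "transition std_chart std_chart = id"
  by (simp_all add: std_chart_def chart_inv_def transition_def inv_id)

lemma tangent_space_std_chart: "tangent_space {std_chart} (x :: real ^ 'k::finite) = range tvec"
proof
  show "tangent_space {std_chart} x \<subseteq> range tvec"
  proof
    fix v :: "(real ^ 'k, 'k) tvec" assume "v \<in> tangent_space {std_chart} x"
    then have "v = tvec (v std_chart)" by (auto simp: tangent_space_def tvec_def fun_eq_iff)
    then show "v \<in> range tvec" by blast
  qed
  show "range tvec \<subseteq> tangent_space {std_chart} x"
    by (auto simp: tangent_space_def tvec_def frechet_derivative_id id_def)
qed

lemma coord_vector_std_chart [simp]: "coord_vector {std_chart} std_chart x u = tvec u"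
proof
  fix c :: "(real ^ 'a, 'a) chart"
  show "coord_vector {std_chart} std_chart x u c = tvec u c"
    by (cases "c = std_chart") (simp_all add: coord_vector_def tvec_def frechet_derivative_id id_def)
qed

lemma second_countable_euclidean: "second_countable (euclidean :: 'a::second_countable_topology topology)"
proof -
  obtain B :: "'a set set" where B: "countable B" "topological_basis B"
    using ex_countable_basis by blast
  show ?thesis
    unfolding second_countable_def
  proof (intro exI[of _ B] conjI allI impI ballI)
    show "openin euclidean V" if "V \<in> B" for V using B(2) that topological_basis_open by auto
    show "\<exists>V\<in>B. x \<in> V \<and> V \<subseteq> U" if "openin euclidean U \<and> x \<in> U" for U x
      using topological_basisE[OF B(2), of U x] that by (metis open_openin)
  qed (rule B)
qed

lemma smooth_manifold_std_chart: "smooth_manifold euclidean {std_chart :: (real ^ 'k, 'k::finite) chart}"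
proof -
  have "Ck_on k UNIV (id :: real ^ 'k \<Rightarrow> _)" for k
  proof (cases k)
    case (Suc n)
    then show ?thesis
      using Ck_on_UNIV_SucI[of id "\<lambda>x v. v" n] by (auto intro: Ck_on_const simp: id_def)
  qed (simp add: id_def)
  then have "smooth_on UNIV (id :: real ^ 'k \<Rightarrow> _)" by (simp add: smooth_on_def)
  moreover have "is_chart euclidean (std_chart :: (real ^ 'k, 'k) chart)"
    by (simp add: is_chart_def)
  ultimately show ?thesis
    by (simp add: smooth_manifold_def second_countable_euclidean)
qed

lemma smooth_segment_polynomial_function:
  assumes "polynomial_function \<gamma>"
  shows "smooth_segment euclidean {std_chart} \<gamma>"
  unfolding smooth_segment_def
  using Ck_on_polynomial_function[OF assms] continuous_on_polymonial_function[OF assms]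
  by (auto intro!: exI[of _ UNIV] simp: smooth_on_def)

lemma smooth_segment_std_chartD:
  assumes "smooth_segment euclidean {std_chart} \<gamma>"
  shows "\<And>t. t \<in> {0..1} \<Longrightarrow> (\<gamma> has_vector_derivative vector_derivative \<gamma> (at t)) (at t)"
    and "continuous_on {0..1} (\<lambda>t. vector_derivative \<gamma> (at t))" and "continuous_on {0..1} \<gamma>"
proof -
  obtain J where J: "open J" "{0..1} \<subseteq> J" "smooth_on J \<gamma>"
    using assms by (auto simp: smooth_segment_def)
  have C: "Ck_on (Suc 0) J \<gamma>" using J(3) by (simp only: smooth_on_def)
  then have d: "(\<gamma> has_vector_derivative vector_derivative \<gamma> (at t)) (at t)" if "t \<in> J" for t
    using that vector_derivative_works by auto
  then show 1: "(\<gamma> has_vector_derivative vector_derivative \<gamma> (at t)) (at t)" if "t \<in> {0..1}" for t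
    using J that by blast
  have "frechet_derivative \<gamma> (at t) 1 = vector_derivative \<gamma> (at t)" if "t \<in> J" for t
    using frechet_derivative_at[OF d[OF that, unfolded has_vector_derivative_def]] by (metis scaleR_one)
  moreover have "continuous_on J (\<lambda>t. frechet_derivative \<gamma> (at t) 1)" using C by simp
  ultimately show "continuous_on {0..1} (\<lambda>t. vector_derivative \<gamma> (at t))"
    using J(2) continuous_on_cong continuous_on_subset by (metis (no_types, lifting))
  show "continuous_on {0..1} \<gamma>"
    using 1 by (meson continuous_at_imp_continuous_on has_vector_derivative_continuous)
qed

section \<open>The metric and its Levi-Civita connection\<close>

lemma sum_idx: "(\<Sum>i\<in>(UNIV :: 'n::finite idx set). f i) = f P1 + f P2 + (\<Sum>i\<in>UNIV. f (E i)) + f Q1 + (f Q2 :: 'a::comm_monoid_add)"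
proof -
  have U: "(UNIV :: 'n idx set) = {P1, P2, Q1, Q2} \<union> range E"
  proof -
    have "i \<in> {P1, P2, Q1, Q2} \<union> range E" for i :: "'n idx" by (cases i) auto
    then show ?thesis by blast
  qed
  have "sum f (range E) = (\<Sum>i\<in>UNIV. f (E i))"
    by (subst sum.reindex) (auto simp: inj_on_def)
  moreover have "sum f ({P1, P2, Q1, Q2} \<union> range E) = sum f {P1, P2, Q1, Q2} + sum f (range E)"
    by (rule sum.union_disjoint) auto
  ultimately show ?thesis
    by (subst U) (simp add: ac_simps)
qed

text \<open>The arguments follow the basis
  \<open>p\<^sub>1, p\<^sub>2, e, q\<^sub>1, q\<^sub>2\<close>; for points of the manifold they are
  the coordinates \<open>v\<^sub>1, v\<^sub>2, x, u\<^sub>1, u\<^sub>2\<close>.\<close>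

definition idx_vec :: "real \<Rightarrow> real \<Rightarrow> real ^ 'n \<Rightarrow> real \<Rightarrow> real \<Rightarrow> real ^ 'n::finite idx" where
  "idx_vec a b x p q = (\<chi> i. case i of P1 \<Rightarrow> a | P2 \<Rightarrow> b | E i \<Rightarrow> x $ i | Q1 \<Rightarrow> p | Q2 \<Rightarrow> q)"

definition xE :: "real ^ 'n idx \<Rightarrow> real ^ 'n::finite" where
  "xE v = (\<chi> i. v $ E i)"

lemma idx_vec_nth [simp]: "idx_vec a b x p q $ P1 = a" "idx_vec a b x p q $ P2 = b" "idx_vec a b x p q $ E i = x $ i"
  "idx_vec a b x p q $ Q1 = p" "idx_vec a b x p q $ Q2 = q" "xE (idx_vec a b x p q) = x"
  by (simp_all add: idx_vec_def xE_def vec_eq_iff)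

lemma xE_nth [simp]: "xE v $ i = v $ E i"
  by (simp add: xE_def)

lemma vec_idx_eq_iff: "u = v \<longleftrightarrow> u $ P1 = v $ P1 \<and> u $ P2 = v $ P2 \<and> xE u = xE v \<and> u $ Q1 = v $ Q1 \<and> u $ Q2 = v $ Q2"
proof
  assume *: "u $ P1 = v $ P1 \<and> u $ P2 = v $ P2 \<and> xE u = xE v \<and> u $ Q1 = v $ Q1 \<and> u $ Q2 = v $ Q2"
  have "u $ i = v $ i" for i
    using * by (cases i) (auto simp: vec_eq_iff)
  then show "u = v" by (simp add: vec_eq_iff)
qed auto

lemma idx_vec_eq_iff: "idx_vec a b x p q = idx_vec a' b' x' p' q' \<longleftrightarrow> a = a' \<and> b = b' \<and> x = x' \<and> p = p' \<and> q = q'"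
  by (simp add: vec_idx_eq_iff)

lemma idx_vec_cases: obtains a b x p q where "v = idx_vec a b x p q"
  using that[of "v $ P1" "v $ P2" "xE v" "v $ Q1" "v $ Q2"] by (simp add: vec_idx_eq_iff)

lemma xE_linear [simp]: "xE (u + v) = xE u + xE v" "xE (u - v) = xE u - xE v" "xE (c *\<^sub>R u) = c *\<^sub>R xE u" "xE (- u) = - xE u"
  "xE 0 = 0"
  by (simp_all add: vec_eq_iff)

lemma bounded_linear_xE: "bounded_linear xE"
  by (simp add: linear_conv_bounded_linear[symmetric] linearI)

lemma idx_vec_linear: "idx_vec a b x p q + idx_vec a' b' x' p' q' = idx_vec (a + a') (b + b') (x + x') (p + p') (q + q')"
  "idx_vec a b x p q - idx_vec a' b' x' p' q' = idx_vec (a - a') (b - b') (x - x') (p - p') (q - q')"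
  "c *\<^sub>R idx_vec a b x p q = idx_vec (c * a) (c * b) (c *\<^sub>R x) (c * p) (c * q)"
  "- idx_vec a b x p q = idx_vec (- a) (- b) (- x) (- p) (- q)" "idx_vec 0 0 0 0 0 = 0"
  by (simp_all add: vec_idx_eq_iff)

lemma has_derivative_idx_vec:
  fixes x :: "'b::real_normed_vector \<Rightarrow> real ^ 'n::finite"
  assumes "(a has_derivative a') F" "(b has_derivative b') F" "(x has_derivative x') F"
  shows "((\<lambda>y. idx_vec (a y) (b y) (x y) 0 0) has_derivative (\<lambda>w. idx_vec (a' w) (b' w) (x' w) 0 0)) F"
proof -
  have lin: "bounded_linear (\<lambda>x :: real ^ 'n. idx_vec 0 0 x 0 0)"
    by (simp add: linear_conv_bounded_linear[symmetric] linearI idx_vec_linear)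
  have eq: "idx_vec a b x 0 0 = a *\<^sub>R idx_vec 1 0 0 0 0 + b *\<^sub>R idx_vec 0 1 0 0 0 + idx_vec 0 0 x 0 0" for a b and x :: "real ^ 'n"
    by (simp add: idx_vec_linear)
  show ?thesis
    unfolding eq[of "a _"] eq[of "a' _"]
    by (intro has_derivative_add has_derivative_scaleR_left assms bounded_linear.has_derivative[OF lin])
qed

lemma eta0_linear:
  "eta0 \<epsilon> (u + u') v = eta0 \<epsilon> u v + eta0 \<epsilon> u' v" "eta0 \<epsilon> u (v + v') = eta0 \<epsilon> u v + eta0 \<epsilon> u v'"
  "eta0 \<epsilon> (u - u') v = eta0 \<epsilon> u v - eta0 \<epsilon> u' v" "eta0 \<epsilon> u (v - v') = eta0 \<epsilon> u v - eta0 \<epsilon> u v'"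
  "eta0 \<epsilon> (c *\<^sub>R u) v = c * eta0 \<epsilon> u v" "eta0 \<epsilon> u (c *\<^sub>R v) = c * eta0 \<epsilon> u v"
  "eta0 \<epsilon> (- u) v = - eta0 \<epsilon> u v" "eta0 \<epsilon> u (- v) = - eta0 \<epsilon> u v" "eta0 \<epsilon> 0 v = 0" "eta0 \<epsilon> u 0 = 0"
  by (simp_all add: eta0_def algebra_simps sum.distrib sum_subtractf sum_distrib_left sum_negf)

lemma eta0_commute: "eta0 \<epsilon> u v = eta0 \<epsilon> v u"
  by (simp add: eta0_def ac_simps)

lemma bounded_bilinear_eta0: "bounded_bilinear (eta0 \<epsilon>)"
  by (subst bilinear_conv_bounded_bilinear[symmetric]) (auto simp: bilinear_def eta0_linear intro!: linearI)

lemma eta_idx_vec: "eta \<epsilon> (idx_vec a b x p q) (idx_vec a' b' x' p' q') = a * p' + p * a' + b * q' + q * b' + eta0 \<epsilon> x x'"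
  by (simp add: eta_def eta0_def)

lemma eta_eq: "eta \<epsilon> u v = u $ P1 * v $ Q1 + u $ Q1 * v $ P1 + u $ P2 * v $ Q2 + u $ Q2 * v $ P2 + eta0 \<epsilon> (xE u) (xE v)"
  by (simp add: eta_def eta0_def)

lemma bounded_bilinear_eta: "bounded_bilinear (eta \<epsilon>)"
  by (subst bilinear_conv_bounded_bilinear[symmetric])
    (auto simp: bilinear_def eta_eq eta0_linear algebra_simps intro!: linearI)

lemma eta_commute: "eta \<epsilon> u v = eta \<epsilon> v u"
  using eta0_commute[of \<epsilon> "xE u" "xE v"] by (simp add: eta_eq)

text \<open>Together with \<open>matrix_eq_idx_vecI\<close> this reduces matrix identities to
  computations with blocks.\<close>

lemma g_matrix_mult_idx_vec:
  "g_matrix \<epsilon> A X Y c *v idx_vec a b x p q =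
     idx_vec (- eta0 \<epsilon> X x - c * q) (- eta0 \<epsilon> Y x + c * p) (A *v x + p *\<^sub>R X + q *\<^sub>R Y) 0 0"
  by (simp add: vec_idx_eq_iff vec_eq_iff matrix_vector_mult_def sum_idx g_matrix_def eta0_def sum_negf ac_simps)

lemma g_matrix_linear:
  "g_matrix \<epsilon> A X Y c + g_matrix \<epsilon> A' X' Y' c' = g_matrix \<epsilon> (A + A') (X + X') (Y + Y') (c + c')"
  "r *\<^sub>R g_matrix \<epsilon> A X Y c = g_matrix \<epsilon> (r *\<^sub>R A) (r *\<^sub>R X) (r *\<^sub>R Y) (r * c)"
  "- g_matrix \<epsilon> A X Y c = g_matrix \<epsilon> (- A) (- X) (- Y) (- c)"
  "g_matrix \<epsilon> 0 0 0 0 = 0"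
  by (auto simp: vec_eq_iff g_matrix_def algebra_simps split: idx.splits)

lemma matrix_eq_idx_vecI:
  assumes "\<And>a b x p q. M *v idx_vec a b x p q = M' *v idx_vec a b x p q"
  shows "M = M'"
  unfolding matrix_eq using assms idx_vec_cases by metis

lemma so_form_eta0_skew:
  assumes "A \<in> so_form (eta0 \<epsilon>)"
  shows "eta0 \<epsilon> u (A *v v) = - eta0 \<epsilon> (A *v u) v" "eta0 \<epsilon> (A *v u) u = 0" "eta0 \<epsilon> u (A *v u) = 0"
proof -
  have *: "eta0 \<epsilon> (A *v u) v + eta0 \<epsilon> u (A *v v) = 0" for u v
    using assms by (simp add: so_form_def)
  show "eta0 \<epsilon> u (A *v v) = - eta0 \<epsilon> (A *v u) v" using *[of u v] by simp
  show "eta0 \<epsilon> (A *v u) u = 0" "eta0 \<epsilon> u (A *v u) = 0"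
    using *[of u u] eta0_commute[of \<epsilon> u "A *v u"] by simp_all
qed

lemma eta_g_matrix:
  assumes "A \<in> so_form (eta0 \<epsilon>)"
  shows "eta \<epsilon> (g_matrix \<epsilon> A X Y c *v u) v + eta \<epsilon> u (g_matrix \<epsilon> A X Y c *v v) = 0"
proof -
  obtain a b x p q where u: "u = idx_vec a b x p q" by (rule idx_vec_cases)
  obtain a' b' x' p' q' where v: "v = idx_vec a' b' x' p' q'" by (rule idx_vec_cases)
  show ?thesis
    unfolding u v g_matrix_mult_idx_vec eta_idx_vec
    by (simp add: eta0_linear so_form_eta0_skew(1)[OF assms] eta0_commute[of \<epsilon> _ X] eta0_commute[of \<epsilon> _ Y] algebra_simps)
qed

section \<open>The metric, its connection form and its signature\<close>

locale walker =
  fixes \<epsilon> :: "'n::finite \<Rightarrow> real" and \<hh> :: "(real ^ 'n ^ 'n) set"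
  assumes eps: "\<And>i. \<epsilon> i = 1 \<or> \<epsilon> i = -1"
    and lie_h: "lie_subalgebra \<hh> (so_form (eta0 \<epsilon>))"
begin

lemma sub_h: "subspace \<hh>" and h_so: "a \<in> \<hh> \<Longrightarrow> a \<in> so_form (eta0 \<epsilon>)"
  and h_bracket: "a \<in> \<hh> \<Longrightarrow> b \<in> \<hh> \<Longrightarrow> a ** b - b ** a \<in> \<hh>"
  using lie_h by (auto simp: lie_subalgebra_def)

lemma subspace_g_alg: "subspace (g_alg \<epsilon> \<hh>)"
  unfolding subspace_def
proof (intro conjI ballI allI)
  show "0 \<in> g_alg \<epsilon> \<hh>"
    using subspace_0[OF sub_h] g_matrix_linear(4)[of \<epsilon>] unfolding g_alg_def mem_Collect_eq by metis
  fix M r assume "M \<in> g_alg \<epsilon> \<hh>"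
  then obtain A X Y c where M: "M = g_matrix \<epsilon> A X Y c" "A \<in> \<hh>" by (auto simp: g_alg_def)
  show "r *\<^sub>R M \<in> g_alg \<epsilon> \<hh>"
    unfolding M(1) g_matrix_linear g_alg_def using subspace_scale[OF sub_h M(2)] by blast
  fix M' assume "M' \<in> g_alg \<epsilon> \<hh>"
  then obtain A' X' Y' c' where M': "M' = g_matrix \<epsilon> A' X' Y' c'" "A' \<in> \<hh>" by (auto simp: g_alg_def)
  show "M + M' \<in> g_alg \<epsilon> \<hh>"
    unfolding M(1) M'(1) g_matrix_linear g_alg_def using subspace_add[OF sub_h M(2) M'(2)] by blast
qed

text \<open>Besides closure under brackets, this shows the source of the \<open>c\<close> entry: the
  pairing of an \<open>X\<close> part with a \<open>Y\<close> part.\<close>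

lemma g_matrix_bracket:
  assumes "A \<in> \<hh>" "A' \<in> \<hh>"
  shows "g_matrix \<epsilon> A X Y c ** g_matrix \<epsilon> A' X' Y' c' - g_matrix \<epsilon> A' X' Y' c' ** g_matrix \<epsilon> A X Y c =
    g_matrix \<epsilon> (A ** A' - A' ** A) (A *v X' - A' *v X) (A *v Y' - A' *v Y) (eta0 \<epsilon> X Y' - eta0 \<epsilon> Y X')"
  by (rule matrix_eq_idx_vecI)
    (simp add: mv.diff_left mv.diff_right mv.add_right mv.scaleR_right matrix_vector_mul_assoc[symmetric]
      g_matrix_mult_idx_vec idx_vec_linear idx_vec_eq_iff eta0_linear so_form_eta0_skew(1)[OF h_so] assms
      eta0_commute[of \<epsilon> X' X] eta0_commute[of \<epsilon> Y' Y] eta0_commute[of \<epsilon> X' Y] eta0_commute[of \<epsilon> Y' X] algebra_simps)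

lemma lie_g_alg: "lie_subalgebra (g_alg \<epsilon> \<hh>) UNIV"
  unfolding lie_subalgebra_def
proof (intro conjI ballI subspace_g_alg)
  fix M M' assume "M \<in> g_alg \<epsilon> \<hh>" "M' \<in> g_alg \<epsilon> \<hh>"
  then obtain A X Y c A' X' Y' c' where "M = g_matrix \<epsilon> A X Y c" "A \<in> \<hh>" "M' = g_matrix \<epsilon> A' X' Y' c'" "A' \<in> \<hh>"
    by (auto simp: g_alg_def)
  then show "M ** M' - M' ** M \<in> g_alg \<epsilon> \<hh>"
    using g_matrix_bracket h_bracket unfolding g_alg_def by blast
qed simp

sublocale matrix_lie_algebra "g_alg \<epsilon> \<hh>"
  by standard (rule lie_g_alg)

lemma ex_spanning: "\<exists>bs. set bs \<subseteq> \<hh> \<and> span (set bs) = \<hh>"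
proof -
  obtain B where B: "B \<subseteq> \<hh>" "independent B" "\<hh> \<subseteq> span B" using basis_exists[of \<hh>] by metis
  obtain bs where "set bs = B" using finite_list independent_imp_finite B(2) by blast
  then show ?thesis using B span_minimal[OF B(1) sub_h] by auto
qed

definition bs :: "(real ^ 'n ^ 'n) list" where
  "bs = (SOME bs. set bs \<subseteq> \<hh> \<and> span (set bs) = \<hh>)"

lemma bs: "set bs \<subseteq> \<hh>" "span (set bs) = \<hh>"
  using someI_ex[OF ex_spanning] by (auto simp: bs_def)

text \<open>The exponents start at \<open>2\<close> so that \<open>A\<close> and \<open>A'\<close> vanish at \<open>0\<close>, which makes parallel transport
  in the hyperplane \<open>u\<^sub>1 = 0\<close> explicit.\<close>

definition A :: "real \<Rightarrow> real ^ 'n ^ 'n" where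
  "A s = (\<Sum>k<length bs. s ^ (k + 2) *\<^sub>R bs ! k)"

definition A' :: "real \<Rightarrow> real ^ 'n ^ 'n" where
  "A' s = (\<Sum>k<length bs. (real (k + 2) * s ^ (k + 1)) *\<^sub>R bs ! k)"

lemma A_in: "A s \<in> \<hh>" and A'_in: "A' s \<in> \<hh>"
  unfolding A_def A'_def using bs(1) by (auto intro!: subspace_sum[OF sub_h] subspace_scale[OF sub_h])

lemma A_0 [simp]: "A 0 = 0" "A' 0 = 0"
  by (simp_all add: A_def A'_def)

lemma A_deriv: "(A has_vector_derivative A' s) (at s within S)"
proof -
  have "((\<lambda>s. s ^ (k + 2)) has_real_derivative real (k + 2) * s ^ (k + 1)) (at s within S)" for k
    using DERIV_subset[OF DERIV_pow[of "k + 2" s UNIV]] by simp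
  then have "((\<lambda>s. s ^ (k + 2) *\<^sub>R bs ! k) has_vector_derivative (real (k + 2) * s ^ (k + 1)) *\<^sub>R bs ! k) (at s within S)" for k
    using has_vector_derivative_scaleR[OF _ has_vector_derivative_const, of "\<lambda>s. s ^ (k + 2)"] by fastforce
  then show ?thesis
    unfolding A_def[abs_def] A'_def by (intro has_vector_derivative_sum)
qed

text \<open>At \<open>y\<close> the coframe is \<open>u \<mapsto> u + N y u\<close>, with inverse \<open>u \<mapsto> u - N y u\<close>; \<open>conn\<close> is the connection
  form, found by solving the first structure equation, and \<open>G\<close> is the metric.\<close>

definition N :: "real ^ 'n idx \<Rightarrow> real ^ 'n idx \<Rightarrow> real ^ 'n idx" where
  "N y u = idx_vec (- (1/2) * eta0 \<epsilon> (xE y) (xE y) * u $ Q1) (- (1/2) * eta0 \<epsilon> (xE y) (xE y) * u $ Q2)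
     (u $ Q2 *\<^sub>R (A (y $ Q1) *v xE y)) 0 0"

definition DN :: "real ^ 'n idx \<Rightarrow> real ^ 'n idx \<Rightarrow> real ^ 'n idx \<Rightarrow> real ^ 'n idx" where
  "DN y w u = idx_vec (- eta0 \<epsilon> (xE y) (xE w) * u $ Q1) (- eta0 \<epsilon> (xE y) (xE w) * u $ Q2)
     (u $ Q2 *\<^sub>R (A (y $ Q1) *v xE w + w $ Q1 *\<^sub>R (A' (y $ Q1) *v xE y))) 0 0"

definition conn :: "real ^ 'n idx \<Rightarrow> real ^ 'n idx \<Rightarrow> real ^ 'n idx ^ 'n idx" where
  "conn y w = g_matrix \<epsilon> (w $ Q2 *\<^sub>R A (y $ Q1))
     ((w $ Q2 / 2) *\<^sub>R (A' (y $ Q1) *v xE y) + w $ Q1 *\<^sub>R xE y)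
     (- (w $ Q1 / 2) *\<^sub>R (A' (y $ Q1) *v xE y) + w $ Q2 *\<^sub>R xE y)
     (eta0 \<epsilon> (A' (y $ Q1) *v xE y) (xE w + w $ Q2 *\<^sub>R (A (y $ Q1) *v xE y)) / 2)"

text \<open>The coframe components of a field with constant coordinates \<open>v\<close> are
  \<open>v + N y v\<close>; their derivative is \<open>DN y w v\<close>, and \<open>conn\<close>
  adds the connection term. Returning to coordinates would subtract \<open>N y\<close> of the
  result, which is 0 by \<open>N_nilpotent\<close>.\<close>

definition christoffel :: "real ^ 'n idx \<Rightarrow> real ^ 'n idx \<Rightarrow> real ^ 'n idx \<Rightarrow> real ^ 'n idx" where
  "christoffel y w v = conn y w *v (v + N y v) + DN y w v"

definition G :: "real ^ 'n idx \<Rightarrow> real ^ 'n idx \<Rightarrow> real ^ 'n idx \<Rightarrow> real" where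
  "G y u v = eta \<epsilon> (u + N y u) (v + N y v)"

lemma conn_in: "conn y w \<in> g_alg \<epsilon> \<hh>"
  unfolding conn_def g_alg_def using A_in subspace_scale[OF sub_h] by blast

lemma conn_skew: "eta \<epsilon> (conn y w *v u) v + eta \<epsilon> u (conn y w *v v) = 0"
  unfolding conn_def by (intro eta_g_matrix h_so subspace_scale[OF sub_h] A_in)

lemma N_deriv: "((\<lambda>y. N y u) has_derivative (\<lambda>w. DN y w u)) (at y within S)"
proof -
  have x: "(xE has_derivative xE) (at y within S)"
    by (rule bounded_linear_imp_has_derivative[OF bounded_linear_xE])
  have q: "((\<lambda>y. y $ Q1) has_derivative (\<lambda>w. w $ Q1)) (at y within S)"
    by (rule bounded_linear_imp_has_derivative[OF bounded_linear_vec_nth])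
  have a: "((\<lambda>y. A (y $ Q1)) has_derivative (\<lambda>w. w $ Q1 *\<^sub>R A' (y $ Q1))) (at y within S)"
    using has_derivative_compose[OF q A_deriv[unfolded has_vector_derivative_def, of _ UNIV]] by simp
  have e: "((\<lambda>y. eta0 \<epsilon> (xE y) (xE y)) has_derivative (\<lambda>w. 2 * eta0 \<epsilon> (xE y) (xE w))) (at y within S)"
    using bounded_bilinear.FDERIV[OF bounded_bilinear_eta0 x x, of \<epsilon>]
    by (simp add: eta0_commute[of \<epsilon> "xE _" "xE y"])
  have h1: "((\<lambda>y. u $ Q2 *\<^sub>R (A (y $ Q1) *v xE y)) has_derivative
      (\<lambda>w. u $ Q2 *\<^sub>R (A (y $ Q1) *v xE w + (w $ Q1 *\<^sub>R A' (y $ Q1)) *v xE y))) (at y within S)"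
    by (intro has_derivative_scaleR_right mv.FDERIV a x)
  have h2: "((\<lambda>y. - (1/2) * eta0 \<epsilon> (xE y) (xE y) * c) has_derivative (\<lambda>w. - (1/2) * (2 * eta0 \<epsilon> (xE y) (xE w)) * c)) (at y within S)" for c
    by (intro has_derivative_mult_left has_derivative_mult_right e)
  show ?thesis
    using has_derivative_idx_vec[OF h2[of "u $ Q1"] h2[of "u $ Q2"] h1]
    by (simp add: N_def DN_def mv.scaleR_left)
qed

lemma linear_N: "linear (N y)"
  by (auto simp: N_def idx_vec_linear idx_vec_eq_iff algebra_simps intro!: linearI)

text \<open>\<open>N\<close> and \<open>DN\<close> read only the \<open>Q1\<close> and
  \<open>Q2\<close> components of their last argument, and none of \<open>N\<close>,
  \<open>DN\<close> and the matrices of the algebra produces such components.\<close>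

lemma N_nilpotent [simp]: "N y (N y u) = 0" "N y (conn y' w *v u) = 0" "N y (DN y' w u) = 0" "DN y w (N y' u) = 0"
proof -
  obtain a' b x p q where u: "u = idx_vec a' b x p q" by (rule idx_vec_cases)
  show "N y (N y u) = 0" "N y (DN y' w u) = 0" "DN y w (N y' u) = 0"
    "N y (conn y' w *v u) = 0"
    by (simp_all add: N_def DN_def conn_def u g_matrix_mult_idx_vec idx_vec_linear)
qed

lemma N_linear: "N y (u + v) = N y u + N y v" "N y (u - v) = N y u - N y v" "N y (c *\<^sub>R u) = c *\<^sub>R N y u"
  using linear_N by (simp_all add: linear_add linear_diff linear_scale)

lemma DN_linear: "DN y w (u + v) = DN y w u + DN y w v" "DN y w (c *\<^sub>R u) = c *\<^sub>R DN y w u"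
  "DN y w (u - v) = DN y w u - DN y w v"
  by (simp_all add: DN_def idx_vec_linear idx_vec_eq_iff algebra_simps)

text \<open>This is the first structure equation. The halves in \<open>conn\<close> are what
  balances the derivative of \<open>A\<close>; the terms pairing \<open>A x\<close> or
  \<open>A' x\<close> with \<open>x\<close> vanish because both matrices are skew.\<close>

lemma christoffel_commute: "christoffel y w v = christoffel y v w"
proof -
  obtain a b x p q where w: "w = idx_vec a b x p q" by (rule idx_vec_cases)
  obtain a' b' x' p' q' where v: "v = idx_vec a' b' x' p' q'" by (rule idx_vec_cases)
  let ?A = "A (y $ Q1)" and ?F = "A' (y $ Q1)" and ?x = "xE y"
  note so = so_form_eta0_skew(2,3)[OF h_so[OF A_in]] so_form_eta0_skew(2,3)[OF h_so[OF A'_in]]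
  show ?thesis
    unfolding christoffel_def conn_def DN_def N_def w v
    by (simp add: idx_vec_linear g_matrix_mult_idx_vec idx_vec_eq_iff eta0_linear so mv.add_right mv.scaleR_right mv.scaleR_left
        eta0_commute[of \<epsilon> "?F *v ?x"])
      (simp add: vec_eq_iff algebra_simps add_divide_distrib eta0_commute)
qed

lemma bilinear_christoffel: "bilinear (christoffel y)"
proof -
  have "linear (christoffel y w)" for w
    by (intro linearI) (simp_all add: christoffel_def N_linear DN_linear mv.add_right mv.scaleR_right algebra_simps)
  then show ?thesis unfolding bilinear_def using christoffel_commute[of y] by (simp add: fun_eq_iff flip: christoffel_commute[of y _ ])
qed

text \<open>The derivatives of the coframe account for the \<open>DN\<close> terms, and the
  \<open>conn\<close> terms cancel because \<open>conn\<close> is skew for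
  \<open>eta\<close>.\<close>

lemma G_deriv: "((\<lambda>y. G y u v) has_derivative (\<lambda>w. G y (christoffel y w u) v + G y u (christoffel y w v))) (at y)"
proof -
  have "((\<lambda>y. G y u v) has_derivative (\<lambda>w. eta \<epsilon> (u + N y u) (DN y w v) + eta \<epsilon> (DN y w u) (v + N y v))) (at y)"
    unfolding G_def
    by (rule bounded_bilinear.FDERIV[OF bounded_bilinear_eta]) (auto intro!: derivative_eq_intros N_deriv)
  moreover have "eta \<epsilon> (u + N y u) (DN y w v) + eta \<epsilon> (DN y w u) (v + N y v) = G y (christoffel y w u) v + G y u (christoffel y w v)" for w
    using conn_skew[of y w "u + N y u" "v + N y v"]
    by (simp add: G_def christoffel_def N_linear bounded_bilinear.add_left[OF bounded_bilinear_eta]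
        bounded_bilinear.add_right[OF bounded_bilinear_eta])
  ultimately show ?thesis by simp
qed

lemma eta_nondegenerate: assumes "\<And>v. eta \<epsilon> u v = 0" shows "u = 0"
proof -
  have "u $ E i = 0" for i
  proof -
    have "eta \<epsilon> u (idx_vec 0 0 (axis i 1) 0 0) = \<epsilon> i * u $ E i"
      by (simp add: eta_eq eta0_def axis_def if_distrib cong: if_cong)
    then show ?thesis using assms eps[of i] by auto
  qed
  moreover have "u $ P1 = 0" using assms[of "idx_vec 0 0 0 1 0"] by (simp add: eta_eq eta0_linear)
  moreover have "u $ P2 = 0" using assms[of "idx_vec 0 0 0 0 1"] by (simp add: eta_eq eta0_linear)
  moreover have "u $ Q1 = 0" using assms[of "idx_vec 1 0 0 0 0"] by (simp add: eta_eq eta0_linear)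
  moreover have "u $ Q2 = 0" using assms[of "idx_vec 0 1 0 0 0"] by (simp add: eta_eq eta0_linear)
  ultimately show ?thesis by (simp add: vec_idx_eq_iff vec_eq_iff)
qed

lemma G_nondegenerate: assumes "\<And>v. G y u v = 0" shows "u = 0"
proof -
  have "eta \<epsilon> (u + N y u) v = 0" for v
    using assms[of "v - N y v"] by (simp add: G_def N_linear)
  then have *: "u + N y u = 0" by (rule eta_nondegenerate)
  then have "N y (u + N y u) = 0" by (simp add: linear_0[OF linear_N])
  then have "N y u = 0" by (simp add: N_linear)
  then show ?thesis using * by simp
qed

lemma bilinear_G: "bilinear (G y)"
  by (auto simp: bilinear_def G_def N_linear bounded_bilinear.add_left[OF bounded_bilinear_eta]
      bounded_bilinear.add_right[OF bounded_bilinear_eta] bounded_bilinear.scaleR_left[OF bounded_bilinear_eta]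
      bounded_bilinear.scaleR_right[OF bounded_bilinear_eta] algebra_simps intro!: linearI)

lemma G_commute: "G y u v = G y v u"
  by (simp add: G_def eta_commute)

definition gm :: "(real ^ 'n idx, 'n idx) metric_tensor" where
  "gm x u v = G x (u std_chart) (v std_chart)"

lemma metric_coords_gm [simp]: "metric_coords {std_chart} gm std_chart = G"
  by (simp add: metric_coords_def gm_def fun_eq_iff)

text \<open>Uniqueness is the Koszul argument: the difference tensor \<open>T\<close> is symmetric
  in its first two slots and skew in its last two, and alternating both symmetries yields
  \<open>T = - T\<close>.\<close>

lemma levi_civita_gm: "levi_civita {std_chart} gm std_chart y = christoffel y"
  unfolding levi_civita_def metric_coords_gm
proof (rule the_equality)
  have fd: "frechet_derivative (\<lambda>z. G z u v) (at y) = (\<lambda>w. G y (christoffel y w u) v + G y u (christoffel y w v))" for u v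
    using frechet_derivative_at[OF G_deriv] by metis
  show "bilinear (christoffel y) \<and> (\<forall>u v. christoffel y u v = christoffel y v u) \<and>
    (\<forall>w u v. frechet_derivative (\<lambda>z. G z u v) (at y) w = G y (christoffel y w u) v + G y u (christoffel y w v))"
    by (intro conjI allI bilinear_christoffel christoffel_commute) (simp add: fd)
  fix \<Gamma> assume \<Gamma>: "bilinear \<Gamma> \<and> (\<forall>u v. \<Gamma> u v = \<Gamma> v u) \<and>
    (\<forall>w u v. frechet_derivative (\<lambda>z. G z u v) (at y) w = G y (\<Gamma> w u) v + G y u (\<Gamma> w v))"
  define T where "T w u v = G y (\<Gamma> w u - christoffel y w u) v" for w u v
  have sym: "T w u v = T u w v" for w u v using \<Gamma> christoffel_commute by (simp add: T_def)
  have skew: "T w u v = - T w v u" for w u v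
  proof -
    have "G y (\<Gamma> w u) v + G y u (\<Gamma> w v) = G y (christoffel y w u) v + G y u (christoffel y w v)"
      using \<Gamma>[THEN conjunct2, THEN conjunct2, rule_format, of u v w] by (simp add: fd)
    then show ?thesis
      by (simp add: T_def bilinear_lsub[OF bilinear_G] G_commute[of y u])
  qed
  have "T w u v = 0" for w u v
  proof -
    have "T w u v = - T w v u" by (rule skew)
    also have "\<dots> = - T v w u" by (simp add: sym)
    also have "\<dots> = T v u w" using skew[of v w u] by simp
    also have "\<dots> = T u v w" by (rule sym)
    also have "\<dots> = - T u w v" by (rule skew)
    also have "\<dots> = - T w u v" by (simp add: sym)
    finally show ?thesis by simp
  qed
  then have "\<Gamma> w u - christoffel y w u = 0" for w u
    using G_nondegenerate[of y "\<Gamma> w u - christoffel y w u"] by (simp add: T_def)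
  then show "\<Gamma> = christoffel y" by (simp add: fun_eq_iff)
qed

lemma real_polynomial_function_nth: "real_polynomial_function (\<lambda>y::real ^ 'm::finite. y $ i)"
  by (rule real_polynomial_function.intros(1)[OF bounded_linear_vec_nth])

text \<open>The coefficients are polynomials in the coordinates, since \<open>A\<close> is a
  polynomial curve.\<close>

lemma smooth_G: "smooth_on UNIV (\<lambda>y. G y u v)"
proof -
  have e: "real_polynomial_function (\<lambda>y::real ^ 'n idx. eta0 \<epsilon> (xE y) (xE y))"
    unfolding eta0_def
    by (intro real_polynomial_function_sum real_polynomial_function.intros(4) real_polynomial_function.intros(2))
      (auto intro: real_polynomial_function_nth)
  have a: "real_polynomial_function (\<lambda>y. (A (y $ Q1) *v xE y) $ i)" for i
    unfolding A_def matrix_vector_mult_def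
    by (auto simp: sum_component intro!: real_polynomial_function_sum real_polynomial_function.intros(4)
        real_polynomial_function.intros(2) real_polynomial_function_nth real_polynomial_function_power)
  have nth: "real_polynomial_function (\<lambda>y. (u + N y u) $ i)" for u i
    by (cases i)
      (auto simp: N_def intro!: real_polynomial_function.intros(3) real_polynomial_function.intros(4)
        real_polynomial_function.intros(2) a e real_polynomial_function_minus)
  have "real_polynomial_function (\<lambda>y. G y u v)"
    unfolding G_def eta_def
    by (intro real_polynomial_function.intros(3) real_polynomial_function_sum real_polynomial_function.intros(4)
        real_polynomial_function.intros(2) nth) auto
  then show ?thesis by (simp add: smooth_on_def Ck_on_real_polynomial_function)
qed

text \<open>The inverse coframe carries an orthonormal basis of \<open>eta\<close> to one of
  \<open>G y\<close>. Each hyperbolic plane spanned by \<open>p\<^sub>a\<close> and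
  \<open>q\<^sub>a\<close> adds one sign of each kind, through the sum and the difference divided by
  \<open>sqrt 2\<close>.\<close>

lemma pseudo_riemannian_gm:
  assumes "card {i. \<epsilon> i = -1} = r" "card {i. \<epsilon> i = 1} = s"
  shows "pseudo_riemannian_manifold euclidean {std_chart} gm (r + 2) (s + 2)"
proof -
  define B :: "'n idx \<Rightarrow> real ^ 'n idx" where
    "B i = (case i of P1 \<Rightarrow> idx_vec (1 / sqrt 2) 0 0 (1 / sqrt 2) 0 | Q1 \<Rightarrow> idx_vec (1 / sqrt 2) 0 0 (- 1 / sqrt 2) 0
      | P2 \<Rightarrow> idx_vec 0 (1 / sqrt 2) 0 0 (1 / sqrt 2) | Q2 \<Rightarrow> idx_vec 0 (1 / sqrt 2) 0 0 (- 1 / sqrt 2)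
      | E i \<Rightarrow> idx_vec 0 0 (axis i 1) 0 0)" for i
  define \<sigma> where "\<sigma> i = (case i of P1 \<Rightarrow> 1 | P2 \<Rightarrow> 1 | Q1 \<Rightarrow> -1 | Q2 \<Rightarrow> -1 | E i \<Rightarrow> \<epsilon> i)" for i :: "'n idx"
  have ax: "eta0 \<epsilon> (axis i 1) (axis j 1) = (if i = j then \<epsilon> i else 0)" for i j
  proof -
    have "eta0 \<epsilon> (axis i 1) (axis j 1) = (\<Sum>k\<in>UNIV. if k = i then (if i = j then \<epsilon> i else 0) else 0)"
      unfolding eta0_def by (rule sum.cong) (auto simp: axis_def)
    then show ?thesis by simp
  qed
  have BB: "eta \<epsilon> (B i) (B j) = (if i = j then \<sigma> i else 0)" for i j
    by (cases i; cases j) (simp_all add: B_def \<sigma>_def eta_idx_vec ax eta0_linear)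
  have GB: "G y (B i - N y (B i)) (B j - N y (B j)) = (if i = j then \<sigma> i else 0)" for y i j
    by (simp add: G_def N_linear BB)
  have \<sigma>_set: "{i. \<sigma> i = -1} = {Q1, Q2} \<union> E ` {i. \<epsilon> i = -1}" "{i. \<sigma> i = 1} = {P1, P2} \<union> E ` {i. \<epsilon> i = 1}"
    by (auto simp: \<sigma>_def image_iff split: idx.splits) (metis idx.exhaust)+
  have cE: "card (E ` S) = card S" for S :: "'n set" by (rule card_image) (auto simp: inj_on_def)
  have "card {i. \<sigma> i = -1} = r + 2" "card {i. \<sigma> i = 1} = s + 2"
    unfolding \<sigma>_set by (subst card_Un_disjoint; force simp: cE assms)+
  then have "has_signature (G y) (r + 2) (s + 2)" for y
    unfolding has_signature_def
    by (intro exI[of _ "\<lambda>i. B i - N y (B i)"]) (use eps in \<open>auto simp: GB \<sigma>_def split: idx.splits\<close>)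
  then show ?thesis
    unfolding pseudo_riemannian_manifold_def
    using smooth_manifold_std_chart bilinear_G smooth_G G_commute by simp
qed

end

section \<open>Parallel transport and the upper bound\<close>

text \<open>Solutions of a vector equation become the columns of a matrix solution; as a sum of
  bounded linear images the matrix inherits derivatives and continuity from its columns.\<close>

definition col :: "'k \<Rightarrow> real ^ 'k \<Rightarrow> real ^ 'k ^ 'k::finite" where
  "col j u = (\<chi> i j'. if j' = j then u $ i else 0)"

lemma bounded_linear_col: "bounded_linear (col j)"
  by (auto simp: linear_conv_bounded_linear[symmetric] col_def vec_eq_iff intro!: linearI)

lemma matrix_mult_col: "a ** col j u = col j (a *v u)"
  by (simp add: vec_eq_iff col_def matrix_matrix_mult_def matrix_vector_mult_def if_distrib cong: if_cong)

lemma matrix_eq_sum_col: "matrix f = (\<Sum>j\<in>UNIV. col j (f (axis j 1)))"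
proof -
  have "(\<Sum>j\<in>UNIV. col j (f (axis j 1)) $ i $ k) = (\<Sum>j\<in>UNIV. if j = k then f (axis k 1) $ i else 0)" for i k
    by (rule sum.cong) (auto simp: col_def)
  then show ?thesis by (simp add: vec_eq_iff matrix_def sum_component)
qed

lemma bounded_linear_transpose: "bounded_linear (transpose :: real ^ 'n ^ 'm \<Rightarrow> _)"
  by (auto simp: linear_conv_bounded_linear[symmetric] transpose_def vec_eq_iff intro!: linearI)

lemma endo_matrix_std_chart: 
  "endo_matrix (range tvec) (\<lambda>v :: (real ^ 'k, 'k::finite) tvec. v std_chart) B = matrix (\<lambda>w. B (tvec w) std_chart)"
proof -
  have "inv_into (range tvec) (\<lambda>v. v std_chart) w = tvec w" for w :: "real ^ 'k"
    by (rule inv_into_f_eq) (auto intro: inj_onI)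
  then show ?thesis by (simp add: endo_matrix_def)
qed

context walker
begin

text \<open>The Gram matrix of \<open>eta\<close> in the standard basis, an involution because all
  signs are 1 or -1.\<close>

definition J :: "real ^ 'n idx ^ 'n idx" where
  "J = matrix (\<lambda>v. idx_vec (v $ Q1) (v $ Q2) (\<chi> i. \<epsilon> i * v $ E i) (v $ P1) (v $ P2))"

lemma J_mult: "J *v v = idx_vec (v $ Q1) (v $ Q2) (\<chi> i. \<epsilon> i * v $ E i) (v $ P1) (v $ P2)"
  unfolding J_def
  by (rule fun_cong[OF matrix_vector_mul(2)], rule linearI)
    (simp_all add: vec_idx_eq_iff algebra_simps, simp_all add: vec_eq_iff algebra_simps)

lemma J_J: "J ** J = mat 1"
proof -
  have "J *v (J *v v) = v" for v
    using eps by (auto simp: J_mult vec_idx_eq_iff vec_eq_iff) (metis (no_types) mult.assoc mult.left_neutral mult_minus_left minus_minus)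
  then show ?thesis by (simp add: matrix_eq matrix_vector_mul_assoc[symmetric])
qed

lemma eta_J: "eta \<epsilon> u v = u \<bullet> (J *v v)"
  by (simp add: J_mult inner_vec_def sum_idx eta_def ac_simps)

text \<open>Solutions with skew generators are isometries, whose inverse is the adjoint with respect
  to \<open>eta\<close>. This provides the inverse curve without solving a second equation.\<close>

lemma flow_skew:
  assumes "Z 0 = mat 1"
    and der: "\<And>s. s \<in> {0..1} \<Longrightarrow> (Z has_vector_derivative a s ** Z s) (at s within {0..1})"
    and skew: "\<And>s u v. s \<in> {0..1} \<Longrightarrow> eta \<epsilon> (a s *v u) v + eta \<epsilon> u (a s *v v) = 0"
  shows "flow a Z (\<lambda>s. J ** transpose (Z s) ** J)"
  unfolding flow_def
proof (intro conjI ballI)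
  show "J ** transpose (Z 0) ** J = mat 1" using assms(1) J_J by simp
  fix s :: real assume s: "s \<in> {0..1}"
  show "(Z has_vector_derivative a s ** Z s) (at s within {0..1})" by (rule der[OF s])
  have "x \<bullet> ((transpose (a s) ** J + J ** a s) *v y) = 0" for x y
  proof -
    have "x \<bullet> (transpose (a s) *v (J *v y)) = (a s *v x) \<bullet> (J *v y)"
      by (metis dot_lmul_matrix inner_commute transpose_matrix_vector)
    then show ?thesis
      using skew[OF s, of x y]
      by (simp add: eta_J mv.add_left inner_add_right matrix_vector_mul_assoc[symmetric])
  qed
  then have "(transpose (a s) ** J + J ** a s) *v y = 0" for y by (metis inner_eq_zero_iff)
  then have aJ: "transpose (a s) ** J = - (J ** a s)"
    by (metis add_eq_0_iff2 matrix_eq mv.zero_left)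
  have "((\<lambda>s. J ** transpose (Z s) ** J) has_vector_derivative (J ** transpose (a s ** Z s)) ** J) (at s within {0..1})"
    using mm.has_vector_derivative[OF mm.has_vector_derivative[OF has_vector_derivative_const
          bounded_linear.has_vector_derivative[OF bounded_linear_transpose der[OF s]]] has_vector_derivative_const, of J J]
    by simp
  moreover have "(J ** transpose (a s ** Z s)) ** J = J ** transpose (Z s) ** (transpose (a s) ** J)"
    by (simp add: matrix_transpose_mul matrix_mul_assoc)
  ultimately show "((\<lambda>s. J ** transpose (Z s) ** J) has_vector_derivative - (J ** transpose (Z s) ** J ** a s)) (at s within {0..1})"
    by (simp add: aJ mm.minus_right matrix_mul_assoc)
qed (use assms in auto)

text \<open>\<open>N y u\<close> depends on \<open>u\<close> only through two components, so
  differentiating it with a moving argument reduces to \<open>N_deriv\<close> at two fixed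
  vectors.\<close>

lemma N_split: "N y u = u $ Q1 *\<^sub>R N y (idx_vec 0 0 0 1 0) + u $ Q2 *\<^sub>R N y (idx_vec 0 0 0 0 1)"
  and DN_split: "DN y w u = u $ Q1 *\<^sub>R DN y w (idx_vec 0 0 0 1 0) + u $ Q2 *\<^sub>R DN y w (idx_vec 0 0 0 0 1)"
  by (simp_all add: N_def DN_def idx_vec_linear idx_vec_eq_iff)

lemma N_along_deriv:
  assumes "(\<gamma> has_vector_derivative \<gamma>') (at t within S)" "(U has_vector_derivative U') (at t within S)"
  shows "((\<lambda>s. N (\<gamma> s) (U s)) has_vector_derivative (N (\<gamma> t) U' + DN (\<gamma> t) \<gamma>' (U t))) (at t within S)"
proof -
  have n: "((\<lambda>s. N (\<gamma> s) u) has_vector_derivative DN (\<gamma> t) \<gamma>' u) (at t within S)" for u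
  proof -
    have "((\<lambda>s. N (\<gamma> s) u) has_derivative (\<lambda>h. DN (\<gamma> t) (h *\<^sub>R \<gamma>') u)) (at t within S)"
      using has_derivative_compose[OF assms(1)[unfolded has_vector_derivative_def] N_deriv[of u "\<gamma> t" UNIV]] by simp
    moreover have "DN (\<gamma> t) (h *\<^sub>R \<gamma>') u = h *\<^sub>R DN (\<gamma> t) \<gamma>' u" for h
      by (simp add: DN_def idx_vec_linear idx_vec_eq_iff eta0_linear mv.scaleR_right algebra_simps)
    ultimately show ?thesis by (simp add: has_vector_derivative_def)
  qed
  have c: "((\<lambda>s. U s $ i) has_vector_derivative U' $ i) (at t within S)" for i
    by (rule bounded_linear.has_vector_derivative[OF bounded_linear_vec_nth assms(2)])
  have "((\<lambda>s. U s $ Q1 *\<^sub>R N (\<gamma> s) (idx_vec 0 0 0 1 0) + U s $ Q2 *\<^sub>R N (\<gamma> s) (idx_vec 0 0 0 0 1)) has_vector_derivative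
     ((U t $ Q1 *\<^sub>R DN (\<gamma> t) \<gamma>' (idx_vec 0 0 0 1 0) + U' $ Q1 *\<^sub>R N (\<gamma> t) (idx_vec 0 0 0 1 0)) +
      (U t $ Q2 *\<^sub>R DN (\<gamma> t) \<gamma>' (idx_vec 0 0 0 0 1) + U' $ Q2 *\<^sub>R N (\<gamma> t) (idx_vec 0 0 0 0 1)))) (at t within S)"
    by (intro has_vector_derivative_add bounded_bilinear.has_vector_derivative[OF bounded_bilinear_scaleR] n c)
  then show ?thesis
    by (simp add: N_split[of "\<gamma> _" "U _"] N_split[of "\<gamma> t" U'] DN_split[of "\<gamma> t" \<gamma>' "U t"] add_ac)
qed

text \<open>\<open>U\<close> holds the frame components of the field. The derivative of the frame
  along \<gamma> cancels the \<open>DN\<close> term of \<open>christoffel\<close>, which leaves an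
  equation with values of \<open>conn\<close> alone.\<close>

lemma parallel_alongI:
  assumes \<gamma>: "\<And>t. t \<in> {0..1} \<Longrightarrow> (\<gamma> has_vector_derivative vector_derivative \<gamma> (at t)) (at t)"
    and U: "\<And>t. t \<in> {0..1} \<Longrightarrow>
      (U has_vector_derivative - (conn (\<gamma> t) (vector_derivative \<gamma> (at t)) *v U t)) (at t within {0..1})"
  shows "parallel_along {std_chart} gm \<gamma> (\<lambda>s. tvec (U s - N (\<gamma> s) (U s)))"
proof -
  have "((\<lambda>s. U s - N (\<gamma> s) (U s)) has_vector_derivative
     - christoffel (\<gamma> t) (vector_derivative \<gamma> (at t)) (U t - N (\<gamma> t) (U t))) (at t within {0..1})" if t: "t \<in> {0..1}" for t
  proof -
    have "((\<lambda>s. U s - N (\<gamma> s) (U s)) has_vector_derivative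
       (- (conn (\<gamma> t) (vector_derivative \<gamma> (at t)) *v U t) -
        (N (\<gamma> t) (- (conn (\<gamma> t) (vector_derivative \<gamma> (at t)) *v U t)) + DN (\<gamma> t) (vector_derivative \<gamma> (at t)) (U t))))
       (at t within {0..1})"
      by (intro has_vector_derivative_diff N_along_deriv has_vector_derivative_at_within[OF \<gamma>[OF t]] U[OF t])
    moreover have "- (conn (\<gamma> t) (vector_derivative \<gamma> (at t)) *v U t) -
        (N (\<gamma> t) (- (conn (\<gamma> t) (vector_derivative \<gamma> (at t)) *v U t)) + DN (\<gamma> t) (vector_derivative \<gamma> (at t)) (U t)) =
        - christoffel (\<gamma> t) (vector_derivative \<gamma> (at t)) (U t - N (\<gamma> t) (U t))"
      by (simp add: christoffel_def N_linear DN_linear linear_neg[OF linear_N])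
    ultimately show ?thesis by simp
  qed
  then show ?thesis
    by (auto simp: parallel_along_def tangent_space_std_chart levi_civita_gm)
qed

lemma parallel_alongD:
  assumes \<gamma>: "\<And>t. t \<in> {0..1} \<Longrightarrow> (\<gamma> has_vector_derivative vector_derivative \<gamma> (at t)) (at t)"
    and par: "parallel_along {std_chart} gm \<gamma> V"
  shows "\<And>t. t \<in> {0..1} \<Longrightarrow> ((\<lambda>s. V s std_chart + N (\<gamma> s) (V s std_chart)) has_vector_derivative
      - (conn (\<gamma> t) (vector_derivative \<gamma> (at t)) *v (V t std_chart + N (\<gamma> t) (V t std_chart)))) (at t within {0..1})"
    and "\<And>t. t \<in> {0..1} \<Longrightarrow> V t = tvec (V t std_chart)"
proof -
  fix t :: real assume t: "t \<in> {0..1}"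
  let ?w = "vector_derivative \<gamma> (at t)" and ?v = "V t std_chart"
  have "((\<lambda>s. V s std_chart) has_vector_derivative - christoffel (\<gamma> t) ?w ?v) (at t within {0..1})"
    using par t by (auto simp: parallel_along_def levi_civita_gm)
  then have "((\<lambda>s. V s std_chart + N (\<gamma> s) (V s std_chart)) has_vector_derivative
     (- christoffel (\<gamma> t) ?w ?v + (N (\<gamma> t) (- christoffel (\<gamma> t) ?w ?v) + DN (\<gamma> t) ?w ?v))) (at t within {0..1})"
    by (intro has_vector_derivative_add N_along_deriv has_vector_derivative_at_within[OF \<gamma>[OF t]])
  then show "((\<lambda>s. V s std_chart + N (\<gamma> s) (V s std_chart)) has_vector_derivative
      - (conn (\<gamma> t) ?w *v (?v + N (\<gamma> t) ?v))) (at t within {0..1})"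
    by (simp add: linear_neg[OF linear_N] christoffel_def N_linear)
  have "V t \<in> range tvec" using par t by (auto simp: parallel_along_def tangent_space_std_chart)
  then show "V t = tvec (V t std_chart)" by auto
qed

text \<open>In the frame \<open>u \<mapsto> u - N y u\<close> at \<open>y\<close>, which is the standard basis at \<open>0\<close>, the Levi-Civita
  connection has its values \<open>conn\<close> in the Lie algebra.\<close>

definition frame_map :: "real ^ 'n idx \<Rightarrow> real ^ 'n idx ^ 'n idx \<Rightarrow>
    (real ^ 'n idx, 'n idx) tvec \<Rightarrow> (real ^ 'n idx, 'n idx) tvec" where
  "frame_map y P = restrict (\<lambda>v. tvec (P *v v std_chart - N y (P *v v std_chart))) (range tvec)"

lemma N_0 [simp]: "N 0 u = 0"
  by (simp add: N_def eta0_linear idx_vec_linear)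

lemma frame_map_0_1: "restrict id (range tvec) = frame_map 0 (mat 1)"
  by (auto simp: frame_map_def fun_eq_iff restrict_def)

text \<open>Supplies the bounded generator that \<open>gpath_flow\<close> requires along a smooth
  segment.\<close>

lemma continuous_on_conn:
  fixes y w :: "real \<Rightarrow> real ^ 'n idx"
  assumes "continuous_on S y" "continuous_on S w"
  shows "continuous_on S (\<lambda>s. conn (y s) (w s))"
proof -
  have lin: "bounded_linear (\<lambda>a. g_matrix \<epsilon> a 0 0 0)" "bounded_linear (\<lambda>X. g_matrix \<epsilon> 0 X 0 0)"
    "bounded_linear (\<lambda>Y. g_matrix \<epsilon> 0 0 Y 0)" "bounded_linear (\<lambda>c. g_matrix \<epsilon> 0 0 0 c)"
    by (auto simp: linear_conv_bounded_linear[symmetric] g_matrix_linear intro!: linearI)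
  have split: "g_matrix \<epsilon> a X Y c = g_matrix \<epsilon> a 0 0 0 + g_matrix \<epsilon> 0 X 0 0 + g_matrix \<epsilon> 0 0 Y 0 + g_matrix \<epsilon> 0 0 0 c" for a X Y c
    by (simp add: g_matrix_linear)
  have cx: "continuous_on S (\<lambda>s. xE (y s))" "continuous_on S (\<lambda>s. xE (w s))"
    by (intro bounded_linear.continuous_on[OF bounded_linear_xE] assms)+
  have cq: "continuous_on S (\<lambda>s. y s $ i)" "continuous_on S (\<lambda>s. w s $ i)" for i
    by (intro bounded_linear.continuous_on[OF bounded_linear_vec_nth] assms)+
  have "continuous_on UNIV A" "continuous_on UNIV A'"
    unfolding A_def[abs_def] A'_def[abs_def] by (intro continuous_intros)+
  then have cA: "continuous_on S (\<lambda>s. A (y s $ Q1))" "continuous_on S (\<lambda>s. A' (y s $ Q1))"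
    using continuous_on_compose2[OF _ cq(1)] by blast+
  have gc: "continuous_on S (\<lambda>s. g_matrix \<epsilon> (a s) (X s) (Y s) (c s))"
    if "continuous_on S a" "continuous_on S X" "continuous_on S Y" "continuous_on S c" for a X Y c
    unfolding split[of "a _" "X _" "Y _" "c _"]
    by (intro continuous_on_add lin[THEN bounded_linear.continuous_on] that)
  show ?thesis
    unfolding conn_def
    by (intro gc continuous_on_add continuous_on_scaleR continuous_on_divide
        mv.continuous_on bounded_bilinear.continuous_on[OF bounded_bilinear_eta0] continuous_on_minus cx cq cA
        continuous_on_const) auto
qed

text \<open>On each segment the parallel fields starting at the frame vectors are the columns of a
  matrix flow \<open>Y\<close> generated by \<open>- conn\<close>. Their existence is part of
  \<open>transports\<close>. Uniqueness shows that \<open>P\<close> acts as \<open>Y 1\<close> in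
  the frames at the two ends.\<close>

theorem transports_gpath:
  assumes "transports euclidean {std_chart} gm 0 y \<tau>"
  shows "\<exists>Z Zi. gpath Z Zi \<and> \<tau> = frame_map y (Z 1)"
  using assms
proof induction
  case refl
  show ?case using gpath_const frame_map_0_1 by (auto simp: tangent_space_std_chart)
next
  case (step \<gamma> \<tau> P)
  then obtain Z Zi where Z: "gpath Z Zi" "\<tau> = frame_map (\<gamma> 0) (Z 1)" by blast
  note \<gamma> = smooth_segment_std_chartD[OF step.hyps(2)]
  define a where "a s = - conn (\<gamma> s) (vector_derivative \<gamma> (at s))" for s
  have ex: "\<exists>V. parallel_along {std_chart} gm \<gamma> V \<and> V 0 = v \<and> V 1 = P v" if "v \<in> range tvec" for v
    using step.hyps(3) that by (simp add: tangent_space_std_chart)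
  \<comment> \<open>The coordinates of the frame vectors at the start of the segment; their frame
    components are the standard basis.\<close>
  define v0 where "v0 j = (tvec (axis j 1 - N (\<gamma> 0) (axis j 1)) :: (real ^ 'n idx, 'n idx) tvec)" for j
  obtain V where V: "\<And>j. parallel_along {std_chart} gm \<gamma> (V j)" "\<And>j. V j 0 = v0 j"
    using ex[of "v0 _"] unfolding v0_def by (metis rangeI)
  define U where "U j s = V j s std_chart + N (\<gamma> s) (V j s std_chart)" for j s
  have U: "(U j has_vector_derivative a t *v U j t) (at t within {0..1})" if "t \<in> {0..1}" for j t
    using parallel_alongD(1)[OF \<gamma>(1) V(1)[of j] that] by (simp add: U_def[abs_def] a_def mv.minus_left)
  define Y where "Y s = (\<Sum>j\<in>UNIV. col j (U j s))" for s
  have Yd: "(Y has_vector_derivative a s ** Y s) (at s within {0..1})" if s: "s \<in> {0..1}" for s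
  proof -
    have "(Y has_vector_derivative (\<Sum>j\<in>UNIV. col j (a s *v U j s))) (at s within {0..1})"
      unfolding Y_def[abs_def]
      by (intro has_vector_derivative_sum bounded_linear.has_vector_derivative[OF bounded_linear_col] U s)
    then show ?thesis by (simp add: Y_def mm.sum_right matrix_mult_col)
  qed
  have "U j 0 = axis j 1" for j by (simp add: U_def V(2) v0_def N_linear)
  then have Y0: "Y 0 = mat 1"
    using matrix_eq_sum_col[of "id :: real ^ 'n idx \<Rightarrow> _"] by (simp add: Y_def matrix_id_mat_1)
  have skew: "eta \<epsilon> (a s *v u) v + eta \<epsilon> u (a s *v v) = 0" for s u v
    using conn_skew[of "\<gamma> s" "vector_derivative \<gamma> (at s)" u v]
    by (simp add: a_def mv.minus_left bounded_bilinear.minus_left[OF bounded_bilinear_eta]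
        bounded_bilinear.minus_right[OF bounded_bilinear_eta])
  define Yi where "Yi s = J ** transpose (Y s) ** J" for s
  have fl: "flow a Y Yi"
    unfolding Yi_def[abs_def] by (rule flow_skew[OF Y0 Yd skew])
  have "gpath Y Yi"
  proof (rule gpath_flow[OF fl])
    show "a s \<in> g_alg \<epsilon> \<hh>" for s unfolding a_def by (rule subspace_neg[OF sub conn_in])
    have "continuous_on {0..1} a"
      unfolding a_def by (intro continuous_on_minus continuous_on_conn \<gamma>)
    then show "bounded (a ` {0..1})" by (intro compact_imp_bounded compact_continuous_image) auto
  qed
  then obtain W Wi where W: "gpath W Wi" "W 1 = Y 1 ** Z 1" using gpath_join[OF Z(1)] by blast
  have "compose (tangent_space {std_chart} 0) P \<tau> = frame_map (\<gamma> 1) (W 1)"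
  proof
    fix v :: "(real ^ 'n idx, 'n idx) tvec"
    show "compose (tangent_space {std_chart} 0) P \<tau> v = frame_map (\<gamma> 1) (W 1) v"
    proof (cases "v \<in> range tvec")
      case True
      define u where "u = Z 1 *v v std_chart"
      have \<tau>v: "\<tau> v = tvec (u - N (\<gamma> 0) u)" using True by (simp add: Z(2) frame_map_def u_def)
      obtain X where X: "parallel_along {std_chart} gm \<gamma> X" "X 0 = \<tau> v" "X 1 = P (\<tau> v)"
        using ex[of "\<tau> v"] by (auto simp: \<tau>v)
      define x where "x s = X s std_chart + N (\<gamma> s) (X s std_chart)" for s
      have xd: "(x has_vector_derivative a t *v x t) (at t within {0..1})" if "t \<in> {0..1}" for t
        using parallel_alongD(1)[OF \<gamma>(1) X(1) that] by (simp add: x_def[abs_def] a_def mv.minus_left)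
      \<comment> \<open>Variation of constants: \<open>Yi s *v x s\<close> has zero derivative, so
        every parallel field is \<open>Y\<close> applied to its initial value.\<close>
      have "Yi 1 *v x 1 - u = 0"
      proof (rule gronwall_zero[where f = "\<lambda>s. Yi s *v x s - u" and f' = "\<lambda>_. 0" and K = 0])
        fix s :: real assume s: "s \<in> {0..1}"
        have "((\<lambda>s. Yi s *v x s) has_vector_derivative (Yi s *v (a s *v x s) + (- (Yi s ** a s)) *v x s)) (at s within {0..1})"
          using fl s by (intro mv.has_vector_derivative xd) (auto simp: flow_def)
        then show "((\<lambda>s. Yi s *v x s - u) has_vector_derivative 0) (at s within {0..1})"
          by (simp add: has_vector_derivative_diff_const mv.minus_left matrix_vector_mul_assoc)
      next
        have "x 0 = u" by (simp add: x_def X(2) \<tau>v N_linear)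
        then show "Yi 0 *v x 0 - u = 0" using fl by (simp add: flow_def)
      qed auto
      then have "Y 1 *v (Yi 1 *v x 1) = Y 1 *v u" by simp
      then have x1: "x 1 = Y 1 *v u"
        using flow_inverse(2)[OF fl, of 1] by (simp add: matrix_vector_mul_assoc)
      have "X 1 = tvec (X 1 std_chart)" by (rule parallel_alongD(2)[OF \<gamma>(1) X(1)]) auto
      moreover have "X 1 std_chart = x 1 - N (\<gamma> 1) (x 1)" by (simp add: x_def N_linear)
      ultimately have "P (\<tau> v) = tvec (Y 1 *v u - N (\<gamma> 1) (Y 1 *v u))" by (simp add: X(3) x1)
      then show ?thesis
        using True by (simp add: compose_def tangent_space_std_chart frame_map_def W(2) u_def matrix_vector_mul_assoc)
    next
      case False
      then show ?thesis by (simp add: compose_def tangent_space_std_chart frame_map_def)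
    qed
  qed
  then show ?case using W(1) by blast
qed

text \<open>The frame at 0 is the standard basis, so the matrices of a curve in the holonomy group
  are themselves end points of paths tangent to the algebra, and
  \<open>velocity_in_lie_algebra\<close> applies.\<close>

theorem holonomy_algebra_subset:
  assumes "B \<in> holonomy_algebra euclidean {std_chart} gm 0"
  shows "endo_matrix (range tvec) (\<lambda>v. v std_chart) B \<in> g_alg \<epsilon> \<hh>"
proof -
  obtain C where C: "\<And>t. C t \<in> holonomy_group euclidean {std_chart} gm 0" "C 0 = restrict id (range tvec)"
    "\<And>v. v \<in> range tvec \<Longrightarrow> smooth_on UNIV (\<lambda>t::real. C t v std_chart)"
    "\<And>v. v \<in> range tvec \<Longrightarrow> ((\<lambda>t. C t v std_chart) has_vector_derivative B v std_chart) (at 0)"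
    using assms unfolding holonomy_algebra_def tangent_space_std_chart mem_Collect_eq by metis
  define c where "c j t = C t (tvec (axis j 1)) std_chart" for j t
  define M where "M t = (\<Sum>j\<in>UNIV. col j (c j t))" for t
  define M' where "M' t = (\<Sum>j\<in>UNIV. col j (vector_derivative (c j) (at t)))" for t
  have sm: "smooth_on UNIV (c j)" for j unfolding c_def[abs_def] by (rule C(3)) simp
  have M_eq: "M t = matrix (\<lambda>w. C t (tvec w) std_chart)" for t
    by (simp add: M_def c_def matrix_eq_sum_col)
  have "M' 0 \<in> g_alg \<epsilon> \<hh>"
  proof (rule velocity_in_lie_algebra)
    show "(M has_vector_derivative M' t) (at t)" for t
      unfolding M_def[abs_def] M'_def
      by (intro has_vector_derivative_sum bounded_linear.has_vector_derivative[OF bounded_linear_col]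
          smooth_on_UNIV_vector_derivative(1) sm)
    have "continuous_on UNIV M'"
      unfolding M'_def
      by (intro continuous_on_sum bounded_linear.continuous_on[OF bounded_linear_col]
          smooth_on_UNIV_vector_derivative(2) sm)
    then show "isCont M' 0" by (simp add: continuous_on_eq_continuous_at)
    show "M 0 = mat 1"
      by (simp add: M_eq C(2) flip: matrix_id_mat_1 id_def)
    show "\<exists>Z Zi. gpath Z Zi \<and> Z 1 = M t" for t
    proof -
      obtain Z Zi where Z: "gpath Z Zi" "C t = frame_map 0 (Z 1)"
        using transports_gpath[of 0 "C t"] C(1)[of t] by (auto simp: holonomy_group_def)
      have "M t = Z 1" by (simp add: M_eq Z(2) frame_map_def)
      then show ?thesis using Z(1) by metis
    qed
  qed
  moreover have "vector_derivative (c j) (at 0) = B (tvec (axis j 1)) std_chart" for j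
    unfolding c_def[abs_def] by (rule vector_derivative_at[OF C(4)]) simp
  ultimately show ?thesis
    by (simp add: endo_matrix_std_chart matrix_eq_sum_col M'_def)
qed

end

section \<open>Loops and the lower bound\<close>

context walker
begin

text \<open>\<open>P\<close> is the matrix of the transport along some path from 0 to
  \<open>y\<close>, with respect to the frames at both ends.\<close>

definition ftrans :: "real ^ 'n idx \<Rightarrow> real ^ 'n idx ^ 'n idx \<Rightarrow> bool" where
  "ftrans y P \<longleftrightarrow> transports euclidean {std_chart} gm 0 y (frame_map y P)"

lemma ftrans_0_1: "ftrans 0 (mat 1)"
  unfolding ftrans_def frame_map_0_1[symmetric]
  using transports.refl[of 0 euclidean "{std_chart}" gm] by (simp add: tangent_space_std_chart)

text \<open>The solution \<open>Z\<close> is an argument; along the straight sides used below it is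
  known in closed form.\<close>

lemma ftrans_line:
  assumes P: "ftrans y P" and Z0: "Z 0 = mat 1"
    and der: "\<And>s. s \<in> {0..1} \<Longrightarrow> (Z has_vector_derivative - conn (y + s *\<^sub>R w) w ** Z s) (at s within {0..1})"
  shows "ftrans (y + w) (Z 1 ** P)"
proof -
  define \<gamma> where "\<gamma> s = y + s *\<^sub>R w" for s
  have \<gamma>d: "(\<gamma> has_vector_derivative w) (at s)" for s
    unfolding \<gamma>_def by (auto intro!: derivative_eq_intros)
  then have vd: "vector_derivative \<gamma> (at s) = w" for s by (rule vector_derivative_at)
  have "polynomial_function \<gamma>"
    unfolding \<gamma>_def[abs_def]
    by (intro polynomial_function_add polynomial_function_const polynomial_function_mult)
      (simp add: real_polynomial_function_eq[symmetric] real_polynomial_function.intros(1))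
  then have seg: "smooth_segment euclidean {std_chart} \<gamma>" by (rule smooth_segment_polynomial_function)
  \<comment> \<open>Pass to frame components at \<open>y\<close>, apply \<open>Z 1\<close>, and
    return to coordinates at \<open>y + w\<close>.\<close>
  define R where "R v = tvec (Z 1 *v (v std_chart + N y (v std_chart)) - N (y + w) (Z 1 *v (v std_chart + N y (v std_chart))))" for v :: "(real ^ 'n idx, 'n idx) tvec"
  have ends: "\<gamma> 0 = y" "\<gamma> 1 = y + w" by (simp_all add: \<gamma>_def)
  have "transports euclidean {std_chart} gm 0 (\<gamma> 1) (compose (tangent_space {std_chart} 0) R (frame_map y P))"
  proof (rule transports.step[OF _ seg])
    show "transports euclidean {std_chart} gm 0 (\<gamma> 0) (frame_map y P)" using P by (simp add: ftrans_def ends)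
    fix v assume "v \<in> tangent_space {std_chart} (\<gamma> 0)"
    then obtain v' where v': "v = tvec v'" by (auto simp: tangent_space_std_chart)
    define u where "u = v' + N y v'"
    have "parallel_along {std_chart} gm \<gamma> (\<lambda>s. tvec (Z s *v u - N (\<gamma> s) (Z s *v u)))"
    proof (rule parallel_alongI)
      show "(\<gamma> has_vector_derivative vector_derivative \<gamma> (at t)) (at t)" for t using \<gamma>d by (simp add: vd)
      show "((\<lambda>s. Z s *v u) has_vector_derivative - (conn (\<gamma> t) (vector_derivative \<gamma> (at t)) *v (Z t *v u))) (at t within {0..1})"
        if "t \<in> {0..1}" for t
        using mv.has_vector_derivative[OF der[OF that] has_vector_derivative_const[of u]]
        by (simp add: vd \<gamma>_def matrix_vector_mul_assoc mv.minus_left mm.minus_left)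
    qed
    moreover have "tvec (Z 0 *v u - N (\<gamma> 0) (Z 0 *v u)) = v"
      by (simp add: Z0 ends u_def v' N_linear)
    moreover have "tvec (Z 1 *v u - N (\<gamma> 1) (Z 1 *v u)) = R v"
      by (simp add: R_def ends u_def v')
    ultimately show "\<exists>V. parallel_along {std_chart} gm \<gamma> V \<and> V 0 = v \<and> V 1 = R v" by blast
  qed
  moreover have "compose (tangent_space {std_chart} 0) R (frame_map y P) = frame_map (y + w) (Z 1 ** P)"
    by (auto simp: fun_eq_iff compose_def tangent_space_std_chart frame_map_def R_def N_linear
        matrix_vector_mul_assoc[symmetric])
  ultimately show ?thesis by (simp add: ftrans_def ends)
qed

lemma ftrans_line_const:
  assumes "ftrans y P" "\<And>s. s \<in> {0..1} \<Longrightarrow> conn (y + s *\<^sub>R w) w = b" "y + w = z"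
  shows "ftrans z (mexp (- b) ** P)"
  using ftrans_line[OF assms(1), of "\<lambda>s. mexp (s *\<^sub>R - b)" w] assms(2,3)
    mexp_scaleR_has_vector_derivative[of "- b"] by simp

lemma ftrans_line_trivial:
  assumes "ftrans y P" "\<And>s. s \<in> {0..1} \<Longrightarrow> conn (y + s *\<^sub>R w) w = 0" "y + w = z"
  shows "ftrans z P"
  using ftrans_line_const[OF assms] by simp

text \<open>Formulated as an action on all transports back to 0, so that closure under products is
  immediate; \<open>P = mat 1\<close> recovers elements of the holonomy group.\<close>

definition loops :: "(real ^ 'n idx ^ 'n idx) set" where
  "loops = {M. \<forall>P. ftrans 0 P \<longrightarrow> ftrans 0 (M ** P)}"

lemma loops_1: "mat 1 \<in> loops" and loops_mult: "M \<in> loops \<Longrightarrow> M' \<in> loops \<Longrightarrow> M ** M' \<in> loops"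
  by (auto simp: loops_def matrix_mul_assoc[symmetric])

text \<open>A rectangle in the plane of the two \<open>u\<close> coordinates at
  \<open>x = 0\<close>. There \<open>conn\<close> vanishes in the direction of
  \<open>u\<^sub>1\<close>, and also on the line \<open>u\<^sub>1 = 0\<close> because
  \<open>A 0 = 0\<close>; only the side \<open>u\<^sub>1 = s\<close> contributes.\<close>

lemma loop_rotation: "mexp (t *\<^sub>R - g_matrix \<epsilon> (A s) 0 0 0) \<in> loops"
  unfolding loops_def
proof (intro CollectI allI impI)
  fix P assume "ftrans 0 P"
  then have "ftrans (idx_vec 0 0 0 s 0) P"
    by (rule ftrans_line_trivial[where w = "idx_vec 0 0 0 s 0"])
      (simp_all add: conn_def idx_vec_linear g_matrix_linear eta0_linear)
  then have "ftrans (idx_vec 0 0 0 s t) (mexp (- (t *\<^sub>R g_matrix \<epsilon> (A s) 0 0 0)) ** P)"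
    by (rule ftrans_line_const[where w = "idx_vec 0 0 0 0 t"])
      (simp_all add: conn_def idx_vec_linear g_matrix_linear eta0_linear)
  then have "ftrans (idx_vec 0 0 0 0 t) (mexp (- (t *\<^sub>R g_matrix \<epsilon> (A s) 0 0 0)) ** P)"
    by (rule ftrans_line_trivial[where w = "idx_vec 0 0 0 (- s) 0"])
      (simp_all add: conn_def idx_vec_linear g_matrix_linear eta0_linear)
  then have "ftrans 0 (mexp (- (t *\<^sub>R g_matrix \<epsilon> (A s) 0 0 0)) ** P)"
    by (rule ftrans_line_trivial[where w = "idx_vec 0 0 0 0 (- t)"])
      (simp_all add: conn_def idx_vec_linear g_matrix_linear eta0_linear)
  then show "ftrans 0 (mexp (t *\<^sub>R - g_matrix \<epsilon> (A s) 0 0 0) ** P)" by simp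
qed

text \<open>A rectangle in the directions \<xi> and \<open>u\<^sub>2\<close> inside
  \<open>u\<^sub>1 = 0\<close>, where \<open>A\<close> and \<open>A'\<close> vanish; only the side
  at \<open>x = \<xi>\<close> contributes.\<close>

lemma loop_Y: "mexp (t *\<^sub>R - g_matrix \<epsilon> 0 0 \<xi> 0) \<in> loops"
  unfolding loops_def
proof (intro CollectI allI impI)
  fix P assume "ftrans 0 P"
  then have "ftrans (idx_vec 0 0 \<xi> 0 0) P"
    by (rule ftrans_line_trivial[where w = "idx_vec 0 0 \<xi> 0 0"])
      (simp_all add: conn_def idx_vec_linear g_matrix_linear eta0_linear)
  then have "ftrans (idx_vec 0 0 \<xi> 0 t) (mexp (- (t *\<^sub>R g_matrix \<epsilon> 0 0 \<xi> 0)) ** P)"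
    by (rule ftrans_line_const[where w = "idx_vec 0 0 0 0 t"])
      (simp_all add: conn_def idx_vec_linear g_matrix_linear eta0_linear)
  then have "ftrans (idx_vec 0 0 0 0 t) (mexp (- (t *\<^sub>R g_matrix \<epsilon> 0 0 \<xi> 0)) ** P)"
    by (rule ftrans_line_trivial[where w = "idx_vec 0 0 (- \<xi>) 0 0"])
      (simp_all add: conn_def idx_vec_linear g_matrix_linear eta0_linear)
  then have "ftrans 0 (mexp (- (t *\<^sub>R g_matrix \<epsilon> 0 0 \<xi> 0)) ** P)"
    by (rule ftrans_line_trivial[where w = "idx_vec 0 0 0 0 (- t)"])
      (simp_all add: conn_def idx_vec_linear g_matrix_linear eta0_linear)
  then show "ftrans 0 (mexp (t *\<^sub>R - g_matrix \<epsilon> 0 0 \<xi> 0) ** P)" by simp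
qed

text \<open>The integral of \<open>conn\<close> along the segment at \<open>x = \<xi>\<close> on
  which \<open>u\<^sub>1\<close> runs from 0 to \<open>t\<close>.\<close>

definition SX :: "real ^ 'n \<Rightarrow> real \<Rightarrow> real ^ 'n idx ^ 'n idx" where
  "SX \<xi> t = g_matrix \<epsilon> 0 (t *\<^sub>R \<xi>) (- (1/2) *\<^sub>R (A t *v \<xi>)) 0"

text \<open>An exponential series that stops after the quadratic term, since triple products of
  matrices with zero \<open>\<hh>\<close> part vanish.\<close>

definition CX :: "real ^ 'n \<Rightarrow> real \<Rightarrow> real ^ 'n idx ^ 'n idx" where
  "CX \<xi> t = mat 1 - SX \<xi> t + (1/2) *\<^sub>R (SX \<xi> t ** SX \<xi> t)"

lemma bounded_linear_g_matrix_XY: "bounded_linear (\<lambda>(X, Y). g_matrix \<epsilon> 0 X Y 0)"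
  by (auto simp: linear_conv_bounded_linear[symmetric] g_matrix_linear intro!: linearI)

lemma SX_deriv: "(SX \<xi> has_vector_derivative g_matrix \<epsilon> 0 \<xi> (- (1/2) *\<^sub>R (A' t *v \<xi>)) 0) (at t)"
proof -
  have a: "((\<lambda>t. A t *v \<xi>) has_vector_derivative A' t *v \<xi>) (at t)"
    using mv.has_vector_derivative[OF A_deriv has_vector_derivative_const] by simp
  have "((\<lambda>t. (t *\<^sub>R \<xi>, - (1/2) *\<^sub>R (A t *v \<xi>))) has_vector_derivative (\<xi>, - (1/2) *\<^sub>R (A' t *v \<xi>))) (at t)"
    by (intro has_vector_derivative_Pair bounded_linear.has_vector_derivative[OF bounded_linear_scaleR_right a])
      (auto intro!: derivative_eq_intros)
  from bounded_linear.has_vector_derivative[OF bounded_linear_g_matrix_XY this]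
  show ?thesis by (simp add: SX_def[abs_def])
qed

text \<open>The values of \<open>SX \<xi>\<close> commute with its derivatives because \<open>A t *v \<xi>\<close> and \<open>A' t *v \<xi>\<close> are
  orthogonal to \<open>\<xi>\<close>; hence \<open>CX \<xi>\<close> is the exponential of \<open>- SX \<xi>\<close>.\<close>

lemma CX_deriv: "(CX \<xi> has_vector_derivative - g_matrix \<epsilon> 0 \<xi> (- (1/2) *\<^sub>R (A' t *v \<xi>)) 0 ** CX \<xi> t) (at t)"
proof -
  define S' where "S' = g_matrix \<epsilon> 0 \<xi> (- (1/2) *\<^sub>R (A' t *v \<xi>)) 0"
  note so = so_form_eta0_skew(2,3)[OF h_so[OF A_in]] so_form_eta0_skew(2,3)[OF h_so[OF A'_in]]
  have comm: "SX \<xi> t ** S' = S' ** SX \<xi> t"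
    unfolding S'_def SX_def
    by (rule matrix_eq_idx_vecI)
      (simp add: matrix_vector_mul_assoc[symmetric] g_matrix_mult_idx_vec idx_vec_eq_iff eta0_linear so eta0_commute)
  have nil: "S' ** SX \<xi> t ** SX \<xi> t = 0"
    unfolding S'_def SX_def
    by (rule matrix_eq_idx_vecI)
      (simp add: matrix_vector_mul_assoc[symmetric] g_matrix_mult_idx_vec idx_vec_linear eta0_linear)
  have S: "(SX \<xi> has_vector_derivative S') (at t)" unfolding S'_def by (rule SX_deriv)
  have "(CX \<xi> has_vector_derivative (0 - S' + (1/2) *\<^sub>R (SX \<xi> t ** S' + S' ** SX \<xi> t))) (at t)"
    unfolding CX_def[abs_def]
    by (intro has_vector_derivative_add has_vector_derivative_diff has_vector_derivative_const S
        bounded_linear.has_vector_derivative[OF bounded_linear_scaleR_right] mm.has_vector_derivative)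
  moreover have "0 - S' + (1/2) *\<^sub>R (SX \<xi> t ** S' + S' ** SX \<xi> t) = - S' ** CX \<xi> t"
  proof -
    have "(1/2) *\<^sub>R (SX \<xi> t ** S' + S' ** SX \<xi> t) = S' ** SX \<xi> t"
      by (simp add: comm scaleR_add_right[symmetric] scaleR_2[symmetric])
    moreover have "- S' ** CX \<xi> t = - S' + S' ** SX \<xi> t"
      by (simp add: CX_def mm.minus_left mm.add_right mm.diff_right mm.scaleR_right matrix_mul_assoc nil)
    ultimately show ?thesis by simp
  qed
  ultimately show ?thesis by (simp add: S'_def)
qed

lemma CX_0: "CX \<xi> 0 = mat 1"
  by (simp add: CX_def SX_def g_matrix_linear)

text \<open>A rectangle in the directions \<xi> and \<open>u\<^sub>1\<close>. On the way back from
  \<open>x = \<xi>\<close> to \<open>x = 0\<close> only the \<open>c\<close> entry of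
  \<open>conn\<close> could survive; it pairs a multiple of \<open>A' t *v \<xi>\<close> with \<xi>
  and vanishes because \<open>A' t\<close> is skew.\<close>

lemma loop_X: "CX \<xi> t \<in> loops"
  unfolding loops_def
proof (intro CollectI allI impI)
  note so = so_form_eta0_skew(2,3)[OF h_so[OF A'_in]]
  fix P assume "ftrans 0 P"
  then have 1: "ftrans (idx_vec 0 0 \<xi> 0 0) P"
    by (rule ftrans_line_trivial[where w = "idx_vec 0 0 \<xi> 0 0"])
      (simp_all add: conn_def idx_vec_linear g_matrix_linear eta0_linear)
  have "((\<lambda>s. CX \<xi> (t * s)) has_vector_derivative
      - conn (idx_vec 0 0 \<xi> 0 0 + s *\<^sub>R idx_vec 0 0 0 t 0) (idx_vec 0 0 0 t 0) ** CX \<xi> (t * s)) (at s within {0..1})" for s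
  proof -
    have "((\<lambda>s. t * s) has_vector_derivative t) (at s)"
      by (auto intro!: derivative_eq_intros simp: has_real_derivative_iff_has_vector_derivative[symmetric])
    from vector_diff_chain_at[OF this CX_deriv]
    have "((\<lambda>s. CX \<xi> (t * s)) has_vector_derivative
      t *\<^sub>R (- g_matrix \<epsilon> 0 \<xi> (- (1/2) *\<^sub>R (A' (t * s) *v \<xi>)) 0 ** CX \<xi> (t * s))) (at s within {0..1})"
      by (simp add: o_def has_vector_derivative_at_within)
    moreover have "conn (idx_vec 0 0 \<xi> 0 0 + s *\<^sub>R idx_vec 0 0 0 t 0) (idx_vec 0 0 0 t 0) =
        t *\<^sub>R g_matrix \<epsilon> 0 \<xi> (- (1/2) *\<^sub>R (A' (t * s) *v \<xi>)) 0"
      by (simp add: conn_def idx_vec_linear g_matrix_linear eta0_linear mult.commute)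
    ultimately show ?thesis by (simp add: mm.scaleR_left mm.minus_left)
  qed
  from ftrans_line[OF 1, of "\<lambda>s. CX \<xi> (t * s)", OF _ this]
  have "ftrans (idx_vec 0 0 \<xi> t 0) (CX \<xi> t ** P)"
    by (simp add: CX_0 idx_vec_linear)
  then have "ftrans (idx_vec 0 0 0 t 0) (CX \<xi> t ** P)"
    by (rule ftrans_line_trivial[where w = "idx_vec 0 0 (- \<xi>) 0 0"])
      (simp_all add: conn_def idx_vec_linear g_matrix_linear eta0_linear mv.add_right mv.diff_right mv.minus_right mv.scaleR_right so)
  then show "ftrans 0 (CX \<xi> t ** P)"
    by (rule ftrans_line_trivial[where w = "idx_vec 0 0 0 (- t) 0"])
      (simp_all add: conn_def idx_vec_linear g_matrix_linear eta0_linear)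
qed

section \<open>Velocities of smooth curves of loops\<close>

definition vel :: "(real ^ 'n idx ^ 'n idx) set" where
  "vel = {B. \<exists>C. (\<forall>t. C t \<in> loops) \<and> C 0 = mat 1 \<and> smooth_on UNIV C \<and> (C has_vector_derivative B) (at 0)}"

lemma velI: "\<lbrakk>\<And>t. C t \<in> loops; C 0 = mat 1; \<And>k. Ck_on k UNIV C; (C has_vector_derivative B) (at 0)\<rbrakk> \<Longrightarrow> B \<in> vel"
  by (auto simp: vel_def smooth_on_def)

lemma velE:
  assumes "B \<in> vel"
  obtains C where "\<And>t. C t \<in> loops" "C 0 = mat 1" "\<And>k. Ck_on k UNIV C" "(C has_vector_derivative B) (at 0)"
  using assms by (auto simp: vel_def smooth_on_def)

text \<open>Sums are velocities of products of curves, and multiples come from rescaling the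
  parameter.\<close>

lemma subspace_vel: "subspace vel"
  unfolding subspace_def
proof (intro conjI ballI allI)
  show "0 \<in> vel" by (rule velI[of "\<lambda>_. mat 1"]) (auto intro: loops_1 Ck_on_const)
  fix B assume "B \<in> vel"
  then obtain C where C: "\<And>t. C t \<in> loops" "C 0 = mat 1" "\<And>k. Ck_on k UNIV C" "(C has_vector_derivative B) (at 0)"
    by (rule velE) blast
  show "r *\<^sub>R B \<in> vel" for r
  proof (rule velI[of "\<lambda>t. C (r * t)"])
    have "((\<lambda>t. r * t) has_vector_derivative r) (at 0)"
      by (auto intro!: derivative_eq_intros simp: has_real_derivative_iff_has_vector_derivative[symmetric])
    from vector_diff_chain_at[OF this, of C] show "((\<lambda>t. C (r * t)) has_vector_derivative r *\<^sub>R B) (at 0)"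
      using C(4) by (simp add: o_def)
  qed (use C in \<open>auto intro: Ck_on_scale_arg\<close>)
  fix B' assume "B' \<in> vel"
  then obtain C' where C': "\<And>t. C' t \<in> loops" "C' 0 = mat 1" "\<And>k. Ck_on k UNIV C'" "(C' has_vector_derivative B') (at 0)"
    by (rule velE) blast
  show "B + B' \<in> vel"
  proof (rule velI[of "\<lambda>t. C t ** C' t"])
    show "((\<lambda>t. C t ** C' t) has_vector_derivative B + B') (at 0)"
      using mm.has_vector_derivative[OF C(4) C'(4)] by (simp add: C(2) C'(2) add.commute)
  qed (use C C' in \<open>auto intro: loops_mult Ck_on_bilinear[OF bounded_bilinear_matrix_mult]\<close>)
qed

lemma vel_conj:
  assumes "Q \<in> loops" "Qi \<in> loops" "Q ** Qi = mat 1" "B \<in> vel"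
  shows "Q ** B ** Qi \<in> vel"
proof -
  obtain C where C: "\<And>t. C t \<in> loops" "C 0 = mat 1" "\<And>k. Ck_on k UNIV C" "(C has_vector_derivative B) (at 0)"
    using assms(4) by (rule velE) blast
  show ?thesis
  proof (rule velI[of "\<lambda>t. Q ** C t ** Qi"])
    show "((\<lambda>t. Q ** C t ** Qi) has_vector_derivative Q ** B ** Qi) (at 0)"
      using mm.has_vector_derivative[OF mm.has_vector_derivative[OF has_vector_derivative_const C(4)]
          has_vector_derivative_const, of Q Qi] by simp
    show "Ck_on k UNIV (\<lambda>t. Q ** C t ** Qi)" for k
      by (intro Ck_on_bilinear[OF bounded_bilinear_matrix_mult] Ck_on_const C(3))
  qed (use C assms in \<open>auto intro: loops_mult\<close>)
qed

lemma vel_mexp: assumes "\<And>t. mexp (t *\<^sub>R b) \<in> loops" shows "b \<in> vel"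
  using mexp_scaleR_has_vector_derivative[of b 0 UNIV] assms
  by (intro velI[of "\<lambda>t. mexp (t *\<^sub>R b)"]) (auto intro: Ck_on_mexp)

text \<open>Conjugating \<open>B\<close> by the one-parameter group of \<open>b\<close> gives a
  curve in \<open>vel\<close>. Its velocity at 0 is the bracket, a limit of difference quotients in
  a closed subspace.\<close>

lemma vel_bracket:
  assumes "\<And>t. mexp (t *\<^sub>R b) \<in> loops" "B \<in> vel"
  shows "b ** B - B ** b \<in> vel"
proof -
  define f where "f t = mexp (t *\<^sub>R b) ** B ** mexp (t *\<^sub>R - b)" for t
  have "f t \<in> vel" for t
    unfolding f_def
    using vel_conj[OF assms(1)[of t] assms(1)[of "- t"] _ assms(2)] mexp_minus_inverse(1)[of "t *\<^sub>R b"] by simp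
  moreover have "f 0 = B" by (simp add: f_def)
  ultimately have "(f t - f 0) /\<^sub>R (t - 0) \<in> vel" for t
    using assms(2) by (intro subspace_scale[OF subspace_vel] subspace_diff[OF subspace_vel]) auto
  moreover have "(f has_vector_derivative b ** B - B ** b) (at 0)"
  proof -
    have "((\<lambda>t. mexp (t *\<^sub>R b) ** B) has_vector_derivative b ** B) (at 0)"
      using mm.has_vector_derivative[OF mexp_scaleR_has_vector_derivative[of b 0 UNIV] has_vector_derivative_const[of B]]
      by simp
    from mm.has_vector_derivative[OF this mexp_scaleR_has_vector_derivative[of "- b" 0 UNIV]]
    show ?thesis by (simp add: f_def[abs_def] mm.minus_right)
  qed
  ultimately show ?thesis
    using has_vector_derivative_within_quotient[of f _ 0 UNIV]
    by (intro Lim_in_closed_set[OF closed_subspace[OF subspace_vel], of "\<lambda>t. (f t - f 0) /\<^sub>R (t - 0)" "at 0"]) auto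
qed

text \<open>Pairing with any \<open>z\<close> orthogonal to \<open>W\<close> gives a real polynomial
  that vanishes identically, so every coefficient is orthogonal to \<open>z\<close> and lies in the
  double complement of \<open>W\<close>.\<close>

lemma polynomial_coefficients_in_subspace:
  fixes b :: "nat \<Rightarrow> 'v::euclidean_space"
  assumes W: "subspace W" and mem: "\<And>s::real. (\<Sum>k<m. s ^ (k + 2) *\<^sub>R b k) \<in> W" and k: "k < m"
  shows "b k \<in> W"
proof -
  have "z \<bullet> b k = 0" if z: "z \<in> orthogonal_comp W" for z
  proof -
    \<comment> \<open>The coefficients of degree 0 and 1 are zero, because the exponents in the sum
      start at 2.\<close>
    define d where "d i = (if 2 \<le> i then z \<bullet> b (i - 2) else 0)" for i
    have "(\<Sum>i\<le>m + 1. d i * s ^ i) = 0" for s :: real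
    proof -
      have "(\<Sum>i\<le>m + 1. d i * s ^ i) = (\<Sum>i\<in>{2..<m + 2}. d i * s ^ i)"
        by (rule sum.mono_neutral_right) (auto simp: d_def)
      also have "\<dots> = (\<Sum>k<m. d (k + 2) * s ^ (k + 2))"
        by (rule sum.reindex_bij_witness[of _ "\<lambda>k. k + 2" "\<lambda>i. i - 2"])
          (auto simp del: power_Suc add_2_eq_Suc')
      also have "\<dots> = z \<bullet> (\<Sum>k<m. s ^ (k + 2) *\<^sub>R b k)"
        by (simp add: d_def inner_sum_right mult.commute)
      also have "\<dots> = 0"
        using z mem[of s] unfolding orthogonal_comp_def orthogonal_def by (auto simp: inner_commute[of z])
      finally show ?thesis .
    qed
    then have "\<forall>i\<le>m + 1. d i = 0" using polyfun_eq_0[of d "m + 1"] by blast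
    then have "d (k + 2) = 0" using k by simp
    then show ?thesis by (simp add: d_def)
  qed
  then have "b k \<in> orthogonal_comp (orthogonal_comp W)"
    by (simp add: orthogonal_comp_def orthogonal_def)
  then show ?thesis by (simp add: orthogonal_comp_self[OF W])
qed

text \<open>The matrices whose block embedding is a velocity form a subspace containing every
  \<open>A s\<close>, hence the coefficients of \<open>A\<close>, which span
  \<open>\<hh>\<close>.\<close>

lemma vel_rotation: assumes "a \<in> \<hh>" shows "g_matrix \<epsilon> a 0 0 0 \<in> vel"
proof -
  define W where "W = {a. g_matrix \<epsilon> a 0 0 0 \<in> vel}"
  have "linear (\<lambda>a. g_matrix \<epsilon> a 0 0 0)" by (auto simp: g_matrix_linear intro!: linearI)
  from linear_subspace_vimage[OF this subspace_vel] have W: "subspace W" by (simp add: W_def vimage_def)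
  have "A s \<in> W" for s
  proof -
    have "- g_matrix \<epsilon> (A s) 0 0 0 \<in> vel" by (rule vel_mexp[OF loop_rotation])
    from subspace_neg[OF subspace_vel this] show ?thesis by (simp add: W_def)
  qed
  then have "bs ! k \<in> W" if "k < length bs" for k
    using polynomial_coefficients_in_subspace[OF W _ that] by (simp add: A_def)
  then have "set bs \<subseteq> W" by (auto simp: in_set_conv_nth)
  then have "\<hh> \<subseteq> W" using span_minimal[OF _ W] bs(2) by blast
  then show ?thesis using assms by (auto simp: W_def)
qed

lemma vel_Y: "g_matrix \<epsilon> 0 0 \<xi> 0 \<in> vel"
  using subspace_neg[OF subspace_vel vel_mexp[OF loop_Y[of _ \<xi>]]] by simp

lemma Ck_on_SX: "Ck_on k UNIV (SX \<xi>)"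
proof -
  have "polynomial_function (\<lambda>t. A t)"
    unfolding A_def
    by (intro polynomial_function_sum polynomial_function_mult polynomial_function_const finite_lessThan
        real_polynomial_function_power[OF real_polynomial_function.intros(1)[OF bounded_linear_ident],
          unfolded real_polynomial_function_eq])
  then have "Ck_on k UNIV (\<lambda>t. A t *v \<xi>)"
    by (intro Ck_on_bounded_linear[OF mv.bounded_linear_left] Ck_on_polynomial_function)
  moreover have "Ck_on k UNIV (\<lambda>t. t *\<^sub>R \<xi>)"
    by (intro Ck_on_polynomial_function polynomial_function_mult polynomial_function_const)
      (simp add: real_polynomial_function_eq[symmetric] real_polynomial_function.intros(1))
  moreover have "SX \<xi> = (\<lambda>t. g_matrix \<epsilon> 0 (t *\<^sub>R \<xi>) 0 0 + g_matrix \<epsilon> 0 0 (- (1/2) *\<^sub>R (A t *v \<xi>)) 0)"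
    by (simp add: SX_def g_matrix_linear fun_eq_iff)
  moreover have "bounded_linear (\<lambda>X. g_matrix \<epsilon> 0 X 0 0)" "bounded_linear (\<lambda>Y. g_matrix \<epsilon> 0 0 (- (1/2) *\<^sub>R Y) 0)"
    by (auto simp: linear_conv_bounded_linear[symmetric] g_matrix_linear algebra_simps intro!: linearI)
  ultimately show ?thesis
    by (simp only:) (intro Ck_on_add Ck_on_bounded_linear[of "\<lambda>X. g_matrix \<epsilon> 0 X 0 0"]
      Ck_on_bounded_linear[of "\<lambda>Y. g_matrix \<epsilon> 0 0 (- (1/2) *\<^sub>R Y) 0"])
qed

text \<open>The curve \<open>CX \<xi>\<close> also has a \<open>Y\<close> part, but its velocity at
  0 has none because \<open>A' 0 = 0\<close>.\<close>

lemma vel_X: "g_matrix \<epsilon> 0 \<xi> 0 0 \<in> vel"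
proof -
  have "- g_matrix \<epsilon> 0 \<xi> 0 0 \<in> vel"
  proof (rule velI[of "CX \<xi>"])
    show "CX \<xi> t \<in> loops" for t by (rule loop_X)
    show "CX \<xi> 0 = mat 1" by (rule CX_0)
    show "(CX \<xi> has_vector_derivative - g_matrix \<epsilon> 0 \<xi> 0 0) (at 0)"
      using CX_deriv[of \<xi> 0] by (simp add: CX_0)
    have "Ck_on k UNIV (\<lambda>t. - SX \<xi> t)" for k
      by (rule Ck_on_bounded_linear[OF bounded_linear_minus[OF bounded_linear_ident] Ck_on_SX])
    moreover have "Ck_on k UNIV (\<lambda>t. (1/2) *\<^sub>R (SX \<xi> t ** SX \<xi> t))" for k
      by (intro Ck_on_bounded_linear[OF bounded_linear_scaleR_right]
          Ck_on_bilinear[OF bounded_bilinear_matrix_mult] Ck_on_SX)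
    ultimately have "Ck_on k UNIV (\<lambda>t. mat 1 + (- SX \<xi> t + (1/2) *\<^sub>R (SX \<xi> t ** SX \<xi> t)))" for k
      by (intro Ck_on_add Ck_on_const)
    moreover have "CX \<xi> = (\<lambda>t. mat 1 + (- SX \<xi> t + (1/2) *\<^sub>R (SX \<xi> t ** SX \<xi> t)))"
      by (simp add: CX_def fun_eq_iff)
    ultimately show "Ck_on k UNIV (CX \<xi>)" for k by simp
  qed
  from subspace_neg[OF subspace_vel this] show ?thesis by simp
qed

text \<open>The bracket of a \<open>Y\<close> matrix and an \<open>X\<close> matrix along the same
  basis vector is a pure \<open>c\<close> matrix with nonzero entry. The \<open>Y\<close> matrix
  takes the place of \<open>b\<close> in \<open>vel_bracket\<close>, since its one-parameter group
  consists of loops.\<close>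

lemma vel_c: "g_matrix \<epsilon> 0 0 0 c \<in> vel"
proof -
  obtain i :: 'n where True by blast
  have "- g_matrix \<epsilon> 0 0 (axis i 1) 0 ** g_matrix \<epsilon> 0 (axis i 1) 0 0 - g_matrix \<epsilon> 0 (axis i 1) 0 0 ** - g_matrix \<epsilon> 0 0 (axis i 1) 0 \<in> vel"
    by (rule vel_bracket[OF loop_Y vel_X])
  also have "- g_matrix \<epsilon> 0 0 (axis i 1) 0 ** g_matrix \<epsilon> 0 (axis i 1) 0 0 - g_matrix \<epsilon> 0 (axis i 1) 0 0 ** - g_matrix \<epsilon> 0 0 (axis i 1) 0
      = - (g_matrix \<epsilon> 0 0 (axis i 1) 0 ** g_matrix \<epsilon> 0 (axis i 1) 0 0 - g_matrix \<epsilon> 0 (axis i 1) 0 0 ** g_matrix \<epsilon> 0 0 (axis i 1) 0)"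
    by (simp add: mm.minus_left mm.minus_right)
  also have "\<dots> = g_matrix \<epsilon> 0 0 0 (eta0 \<epsilon> (axis i 1) (axis i 1))"
    using subspace_0[OF sub_h] by (simp add: g_matrix_bracket g_matrix_linear eta0_linear)
  finally have *: "g_matrix \<epsilon> 0 0 0 (eta0 \<epsilon> (axis i 1) (axis i 1)) \<in> vel" .
  have "eta0 \<epsilon> (axis i 1) (axis i 1) = \<epsilon> i"
    by (simp add: eta0_def axis_def if_distrib cong: if_cong)
  then have "eta0 \<epsilon> (axis i 1) (axis i 1) \<noteq> 0" using eps[of i] by auto
  with subspace_scale[OF subspace_vel *, of "c / eta0 \<epsilon> (axis i 1) (axis i 1)"]
  show ?thesis by (simp add: g_matrix_linear)
qed

lemma g_alg_subset_vel: "g_alg \<epsilon> \<hh> \<subseteq> vel"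
proof
  fix M assume "M \<in> g_alg \<epsilon> \<hh>"
  then obtain a X Y c where M: "M = g_matrix \<epsilon> a X Y c" "a \<in> \<hh>" by (auto simp: g_alg_def)
  have "g_matrix \<epsilon> a 0 0 0 + g_matrix \<epsilon> 0 X 0 0 + g_matrix \<epsilon> 0 0 Y 0 + g_matrix \<epsilon> 0 0 0 c \<in> vel"
    by (intro subspace_add[OF subspace_vel] vel_rotation vel_X vel_Y vel_c M(2))
  then show "M \<in> vel" by (simp add: M(1) g_matrix_linear)
qed

theorem g_alg_subset_holonomy_algebra:
  assumes "M \<in> g_alg \<epsilon> \<hh>"
  shows "M \<in> endo_matrix (range tvec) (\<lambda>v. v std_chart) ` holonomy_algebra euclidean {std_chart} gm 0"
proof -
  obtain C where C: "\<And>t. C t \<in> loops" "C 0 = mat 1" "\<And>k. Ck_on k UNIV C" "(C has_vector_derivative M) (at 0)"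
    using g_alg_subset_vel assms velE by blast
  define B where "B = frame_map 0 M"
  have fm: "frame_map 0 P (tvec w) = tvec (P *v w)" for P w by (simp add: frame_map_def)
  have "B \<in> holonomy_algebra euclidean {std_chart} gm 0"
    unfolding holonomy_algebra_def tangent_space_std_chart
  proof (intro CollectI conjI exI[of _ "\<lambda>t. frame_map 0 (C t)"] allI ballI)
    show "B \<in> extensional (range tvec)" by (simp add: B_def frame_map_def)
    show "frame_map 0 (C 0) = restrict id (range tvec)" by (simp add: C(2) frame_map_0_1)
    \<comment> \<open>Applying the loop \<open>C t\<close> to the trivial transport
      \<open>mat 1\<close> yields an element of the holonomy group.\<close>
    show "frame_map 0 (C t) \<in> holonomy_group euclidean {std_chart} gm 0" for t
      using C(1)[of t] ftrans_0_1 by (simp add: loops_def holonomy_group_def ftrans_def) (metis matrix_mul_rid)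
    fix v :: "(real ^ 'n idx, 'n idx) tvec" and c :: "(real ^ 'n idx, 'n idx) chart"
    assume "v \<in> range tvec"
    then obtain w where w: "v = tvec w" by blast
    show "smooth_on UNIV (\<lambda>t. frame_map 0 (C t) v c)"
    proof (cases "c = std_chart")
      case True
      have "Ck_on k UNIV (\<lambda>t. C t *v w)" for k
        by (rule Ck_on_bounded_linear[OF mv.bounded_linear_left C(3)])
      then show ?thesis by (simp add: True w fm smooth_on_def)
    next
      case False
      then have "tvec u c = 0" for u :: "real ^ 'n idx" by (simp add: tvec_def)
      then show ?thesis by (simp add: w fm smooth_on_def Ck_on_const)
    qed
    show "((\<lambda>t. frame_map 0 (C t) v c) has_vector_derivative B v c) (at 0)"
    proof (cases "c = std_chart")
      case True
      show ?thesis
        using bounded_linear.has_vector_derivative[OF mv.bounded_linear_left C(4)]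
        by (simp add: True w fm B_def)
    next
      case False
      then have "tvec u c = 0" for u :: "real ^ 'n idx" by (simp add: tvec_def)
      then show ?thesis by (simp add: w fm B_def)
    qed
  qed
  moreover have "endo_matrix (range tvec) (\<lambda>v. v std_chart) B = M"
    by (simp add: endo_matrix_std_chart B_def fm)
  ultimately show ?thesis by blast
qed

lemma tangent_isometry_gm: "tangent_isometry {std_chart} gm 0 (eta \<epsilon>) (\<lambda>v. v std_chart)"
  unfolding tangent_isometry_def tangent_space_std_chart
  by (auto simp: bij_betw_def inj_on_def image_image gm_def G_def)

end

theorem theorem1:
  fixes r s :: nat and e :: "nat \<Rightarrow> 'n::finite" and \<hh> :: "(real ^ 'n ^ 'n) set"
  assumes "r + s \<ge> 2"
    and "bij_betw e {1..r + s} UNIV"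
    and "lie_subalgebra \<hh> (so_form (eta0 (signs e r)))"
  shows "\<exists>(X :: (real ^ 'n idx) topology) (\<A> :: (real ^ 'n idx, 'n idx) chart set) g x L.
    pseudo_riemannian_manifold X \<A> g (r + 2) (s + 2) \<and>
    x \<in> topspace X \<and>
    tangent_isometry \<A> g x (eta (signs e r)) L \<and>
    endo_matrix (tangent_space \<A> x) L ` holonomy_algebra X \<A> g x = g_alg (signs e r) \<hh>"
proof -
  interpret walker "signs e r" \<hh>
    by standard (use assms(3) in \<open>auto simp: signs_def\<close>)
  have inj: "inj_on e {1..r + s}" using assms(2) by (simp add: bij_betw_def)
  have "card (e ` {1..r}) = r"
    by (subst card_image) (auto intro: inj_on_subset[OF inj])
  moreover have "{i. signs e r i = -1} = e ` {1..r}" "{i. signs e r i = 1} = UNIV - e ` {1..r}"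
    by (auto simp: signs_def)
  moreover have "card (UNIV :: 'n set) = r + s"
    using bij_betw_same_card[OF assms(2)] by simp
  ultimately have "card {i. signs e r i = -1} = r" "card {i. signs e r i = 1} = s"
    by (simp_all add: card_Diff_subset)
  then have "pseudo_riemannian_manifold euclidean {std_chart} gm (r + 2) (s + 2)"
    by (rule pseudo_riemannian_gm)
  moreover have "endo_matrix (tangent_space {std_chart} 0) (\<lambda>v. v std_chart) `
      holonomy_algebra euclidean {std_chart} gm 0 = g_alg (signs e r) \<hh>"
    using holonomy_algebra_subset g_alg_subset_holonomy_algebra by (auto simp: tangent_space_std_chart)
  ultimately show ?thesis
    using tangent_isometry_gm
    by (intro exI[of _ euclidean] exI[of _ "{std_chart}"] exI[of _ gm] exI[of _ 0] exI[of _ "\<lambda>v. v std_chart"]) simp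
qed

end
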